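(* Let $X_0,X_1,\dots,X_n$ be real vector fields on a bounded domain $\Omega\subset\mathbb{R}^p$ satisfying assumptions (C) for some integer $r\ge2$. For any $\Omega'\Subset\Omega$ there exist positive constants $c_1,c_2$ such that $$c_1|x-y|\le d_1(x,y)\le c_2|x-y|^{1/r}\quad\text{for any }x,y\in\Omega'.$$
   Context: $\Omega'\Subset\Omega$ means $\Omega'$ is a domain (connected open set) with $\overline{\Omega'}$ compact and contained in $\Omega$. Weights: $p_0=2$ and $p_i=1$ for $i=1,\dots,n$. For a multiindex $I=(i_1,\dots,i_k)$ with entries in $\{0,1,\dots,n\}$, the weight is $|I|=\sum_{j=1}^k p_{i_j}$, and $X_{[I]}=[X_{i_1},[X_{i_2},\dots[X_{i_{k-1}},X_{i_k}]\dots]]$ (with $X_{[I]}=X_{i_1}$ if $I=(i_1)$), where $[X,Y]=XY-YX$. Assumptions (C), for an integer $r\ge2$: the coefficients of $X_1,\dots,X_n$ belong to $C^{r-1}(\overline\Omega)$; the coefficients of $X_0$ belong to $C^{r-2}(\overline\Omega)$ and, in the case $r=2$, moreover to $C^1$; the vectors $\{(X_{[I]})_x\}_{|I|\le r}$ span $\mathbb{R}^p$ at every $x\in\Omega$. Control distance: for $\delta>0$ let $C_1(\delta)$ be the class of absolutely continuous maps $\varphi:[0,1]\to\Omega$ with $\varphi'(t)=\sum_{i=0}^n a_i(t)(X_i)_{\varphi(t)}$ for a.e. $t$, where the $a_i$ are measurable, $|a_0(t)|\le\delta^2$ and $|a_i(t)|\le\delta$ for $i=1,\dots,n$. Then $d_1(x,y)=\inf\{\delta>0:\exists\varphi\in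 C_1(\delta),\ \varphi(0)=x,\ \varphi(1)=y\}$. *)

theory Defs
  imports "HOL-Analysis.Analysis"
begin

section \<open>Domains\<close>

definition is_domain :: "'a::topological_space set \<Rightarrow> bool" where
  "is_domain \<Omega> \<longleftrightarrow> open \<Omega> \<and> connected \<Omega>"

definition compactly_inside :: "'a::topological_space set \<Rightarrow> 'a set \<Rightarrow> bool" (infix "\<Subset>" 50) where
  "\<Omega>' \<Subset> \<Omega> \<longleftrightarrow> is_domain \<Omega>' \<and> compact (closure \<Omega>') \<and> closure \<Omega>' \<subseteq> \<Omega>"

section \<open>Functions of class C^k on an open set and up to its boundary\<close>

definition has_partial_at :: "'p \<Rightarrow> (real^'p \<Rightarrow> real) \<Rightarrow> real^'p \<Rightarrow> bool" where
  "has_partial_at j f x \<longleftrightarrow> (\<lambda>t. f (x + t *\<^sub>R axis j 1)) differentiable (at 0)"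

definition partial :: "'p \<Rightarrow> (real^'p \<Rightarrow> real) \<Rightarrow> real^'p \<Rightarrow> real" where
  "partial j f x = deriv (\<lambda>t. f (x + t *\<^sub>R axis j 1)) 0"

primrec Ck_on :: "nat \<Rightarrow> (real^'p) set \<Rightarrow> (real^'p \<Rightarrow> real) \<Rightarrow> bool" where
  "Ck_on 0 \<Omega> f \<longleftrightarrow> continuous_on \<Omega> f"
| "Ck_on (Suc k) \<Omega> f \<longleftrightarrow> continuous_on \<Omega> f \<and>
     (\<forall>j. (\<forall>x\<in>\<Omega>. has_partial_at j f x) \<and> Ck_on k \<Omega> (partial j f))"

text \<open>
  The class of functions that are C^k in the open set \<open>\<Omega>\<close> and whose partial derivatives of
  order at most k, the function itself included, all extend continuously to the closure.
  Only the values of \<open>f\<close> in \<open>\<Omega>\<close> matter.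
\<close>

definition extends_continuously :: "(real^'p) set \<Rightarrow> (real^'p \<Rightarrow> real) \<Rightarrow> bool" where
  "extends_continuously \<Omega> f \<longleftrightarrow> (\<exists>g. continuous_on (closure \<Omega>) g \<and> (\<forall>x\<in>\<Omega>. g x = f x))"

primrec Ck_closure :: "nat \<Rightarrow> (real^'p) set \<Rightarrow> (real^'p \<Rightarrow> real) \<Rightarrow> bool" where
  "Ck_closure 0 \<Omega> f \<longleftrightarrow> extends_continuously \<Omega> f"
| "Ck_closure (Suc k) \<Omega> f \<longleftrightarrow> extends_continuously \<Omega> f \<and>
     (\<forall>j. (\<forall>x\<in>\<Omega>. has_partial_at j f x) \<and> Ck_closure k \<Omega> (partial j f))"

section \<open>Vector fields and their commutators\<close>

text \<open>
  A vector field is given by its coefficient vector: \<open>X\<close> stands for the operator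
  \<open>\<Sum>j. X\<^sub>j \<partial>\<^sub>j\<close>. In \<open>XY - YX\<close> the second order terms cancel, and what is left is
  the vector field whose j-th coefficient is \<open>X (Y\<^sub>j) - Y (X\<^sub>j)\<close>.
\<close>

definition vf_apply :: "(real^'p \<Rightarrow> real^'p) \<Rightarrow> (real^'p \<Rightarrow> real) \<Rightarrow> real^'p \<Rightarrow> real" where
  "vf_apply X f x = (\<Sum>j\<in>UNIV. X x $ j * partial j f x)"

definition vf_bracket ::
    "(real^'p \<Rightarrow> real^'p) \<Rightarrow> (real^'p \<Rightarrow> real^'p) \<Rightarrow> real^'p \<Rightarrow> real^'p" where
  "vf_bracket X Y x = (\<chi> j. vf_apply X (\<lambda>y. Y y $ j) x - vf_apply Y (\<lambda>y. X y $ j) x)"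

text \<open>The value on the empty list is a dummy; multiindices are nonempty.\<close>

fun iter_bracket :: "(nat \<Rightarrow> real^'p \<Rightarrow> real^'p) \<Rightarrow> nat list \<Rightarrow> real^'p \<Rightarrow> real^'p" where
  "iter_bracket X [] = (\<lambda>x. 0)"
| "iter_bracket X [i] = X i"
| "iter_bracket X (i # j # I) = vf_bracket (X i) (iter_bracket X (j # I))"

definition multiindices :: "nat \<Rightarrow> nat list set" where
  "multiindices n = {I. I \<noteq> [] \<and> set I \<subseteq> {0..n}}"

definition weight :: "nat list \<Rightarrow> nat" where
  "weight I = (\<Sum>i\<leftarrow>I. if i = 0 then 2 else 1)"

section \<open>Assumptions (C)\<close>

text \<open>
  For \<open>r = 2\<close> the drift \<open>X 0\<close> is continuous up to the boundary and C^1 in the open set; its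
  first derivatives are not required to extend to the closure.
\<close>

definition assumptions_C ::
    "(real^'p) set \<Rightarrow> nat \<Rightarrow> nat \<Rightarrow> (nat \<Rightarrow> real^'p \<Rightarrow> real^'p) \<Rightarrow> bool" where
  "assumptions_C \<Omega> n r X \<longleftrightarrow>
     (\<forall>i\<in>{1..n}. \<forall>j. Ck_closure (r - 1) \<Omega> (\<lambda>x. X i x $ j)) \<and>
     (\<forall>j. Ck_closure (r - 2) \<Omega> (\<lambda>x. X 0 x $ j)) \<and>
     (r = 2 \<longrightarrow> (\<forall>j. Ck_on 1 \<Omega> (\<lambda>x. X 0 x $ j))) \<and>
     (\<forall>x\<in>\<Omega>. span {iter_bracket X I x | I. I \<in> multiindices n \<and> weight I \<le> r} = UNIV)"

section \<open>The control distance\<close>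

definition abs_continuous_on_interval ::
    "real \<Rightarrow> real \<Rightarrow> (real \<Rightarrow> 'a::real_normed_vector) \<Rightarrow> bool" where
  "abs_continuous_on_interval a b f \<longleftrightarrow>
     (\<forall>\<epsilon>>0. \<exists>\<eta>>0. \<forall>(N::nat) s t.
        (\<forall>k<N. a \<le> s k \<and> s k \<le> t k \<and> t k \<le> b) \<longrightarrow>
        disjoint_family_on (\<lambda>k. {s k<..<t k}) {..<N} \<longrightarrow>
        (\<Sum>k<N. t k - s k) < \<eta> \<longrightarrow> (\<Sum>k<N. norm (f (t k) - f (s k))) < \<epsilon>)"

definition admissible_curves ::
    "(real^'p) set \<Rightarrow> nat \<Rightarrow> (nat \<Rightarrow> real^'p \<Rightarrow> real^'p) \<Rightarrow> real \<Rightarrow> (real \<Rightarrow> real^'p) set" where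
  "admissible_curves \<Omega> n X \<delta> =
     {\<phi>. abs_continuous_on_interval 0 1 \<phi> \<and> \<phi> ` {0..1} \<subseteq> \<Omega> \<and>
         (\<exists>a :: nat \<Rightarrow> real \<Rightarrow> real.
            (\<forall>i\<le>n. a i \<in> borel_measurable (lebesgue_on {0..1})) \<and>
            (\<forall>t\<in>{0..1}. \<bar>a 0 t\<bar> \<le> \<delta>\<^sup>2 \<and> (\<forall>i\<in>{1..n}. \<bar>a i t\<bar> \<le> \<delta>)) \<and>
            (AE t in lebesgue_on {0..1}.
               (\<phi> has_vector_derivative (\<Sum>i\<le>n. a i t *\<^sub>R X i (\<phi> t))) (at t within {0..1})))}"

text \<open>The infimum is taken in the extended reals, so that it is infinite if no curve joins the points.\<close>

definition control_dist ::
    "(real^'p) set \<Rightarrow> nat \<Rightarrow> (nat \<Rightarrow> real^'p \<Rightarrow> real^'p) \<Rightarrow> real^'p \<Rightarrow> real^'p \<Rightarrow> ereal" where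
  "control_dist \<Omega> n X x y =
     Inf {ereal \<delta> | \<delta>. \<delta> > 0 \<and> (\<exists>\<phi>\<in>admissible_curves \<Omega> n X \<delta>. \<phi> 0 = x \<and> \<phi> 1 = y)}"

end

theory Submission
  imports Defs
begin

text \<open>
  The lower bound integrates the velocity of an admissible curve. For the upper bound,
  follow flows of single fields \<open>X\<^sub>i\<close> for time \<open>t\<close> to the power of the weight of \<open>i\<close>. Along a chain of such flows the values
  \<open>X\<^sub>w f\<close>, \<open>w\<close> ranging over words of weight at most \<open>r\<close>, have Taylor expansions whose coefficients multiply
  like noncommutative power series; only as many derivatives occur as the assumptions provide, and no
  differentiability of the flows in the initial point is needed. The nested group commutator of the
  exponential series of \<open>i\<^sub>1, \<dots>, i\<^sub>k\<close> starts with the Lie bracket, so the corresponding chain moves a point \<open>z\<close> to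
  \<open>z + t\<^bsup>|I|\<^esup> X\<^bsub>[I]\<^esub>(z) + o(t\<^bsup>|I|\<^esup>)\<close> at cost \<open>O(t)\<close>. As the brackets span, from any point near \<open>x\<^sub>0\<close> one can
  halve the distance \<open>d\<close> to a given target at cost \<open>O(d\<^bsup>1/r\<^esup>)\<close>. Repeating this infinitely often, the costs form a
  geometric series and the concatenated curve is still Lipschitz, hence admissible. Compactness and
  connectedness of the closure of \<open>\<Omega>'\<close> globalise the estimate.
\<close>

section \<open>Functions of class C^k\<close>

text \<open>The available regularity shapes the argument. The drift coefficients are only C^(r-2),
  so a derivative along \<open>X 0\<close> is charged two orders; counted this way, the values along
  words of weight at most \<open>r\<close> are guaranteed to be continuous. At weight
  \<open>r\<close> nothing beyond continuity is left, so the expansions have an error o(t^r) without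
  a rate. This provides no differentiable endpoint map to invert; the error can only be made a small
  fraction of the intended displacement, hence the repeated halving. Each halving starts at a new
  point, so all expansions must be uniform in the starting point on a compact ball. The exponent 1/r
  comes from the worst bracket: a coefficient h in front of a bracket of weight W requires t =
  |h|^(1/W), which is at most |h|^(1/r) when |h| is at most 1 and W is at most r. Negative h is
  served by the chain run backwards, whose series is the inverse in the ring. If a displacement v
  has coefficients bounded by C |v|, accuracy 1/(2C) leaves an error of at most |v|/2.\<close>

lemma has_partial_atD:
  "has_partial_at j f x \<Longrightarrow> ((\<lambda>t. f (x + t *\<^sub>R axis j 1)) has_real_derivative partial j f x) (at 0)"
  unfolding has_partial_at_def partial_def by (simp add: DERIV_deriv_iff_real_differentiable)

lemma has_partial_atI:
  assumes "((\<lambda>t. f (x + t *\<^sub>R axis j 1)) has_real_derivative d) (at 0)"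
  shows "has_partial_at j f x" "partial j f x = d"
  using assms unfolding has_partial_at_def partial_def
  by (auto simp: real_differentiable_def DERIV_imp_deriv)

lemma has_partial_at_line:
  assumes "has_partial_at j f (x + s *\<^sub>R axis j 1)"
  shows "((\<lambda>t. f (x + t *\<^sub>R axis j 1)) has_real_derivative partial j f (x + s *\<^sub>R axis j 1)) (at s)"
proof -
  have "((\<lambda>t. f (x + (s + t) *\<^sub>R axis j 1)) has_real_derivative partial j f (x + s *\<^sub>R axis j 1)) (at 0)"
    using has_partial_atD[OF assms] by (simp add: scaleR_add_left add.assoc)
  then show ?thesis
    using DERIV_shift[of "\<lambda>t. f (x + t *\<^sub>R axis j 1)" _ 0 s] by (simp add: add.commute)
qed

lemma eventually_line_in_open:
  fixes x :: "'a::real_normed_vector"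
  assumes "open \<Omega>" "x \<in> \<Omega>"
  shows "eventually (\<lambda>t. x + t *\<^sub>R e \<in> \<Omega>) (nhds 0)"
proof -
  have "((\<lambda>t. x + t *\<^sub>R e) \<longlongrightarrow> x + 0 *\<^sub>R e) (nhds 0)"
    by (intro tendsto_intros filterlim_ident)
  then show ?thesis using assms by (simp add: tendsto_def)
qed

lemma partial_cong:
  assumes "open \<Omega>" "x \<in> \<Omega>" "\<And>y. y \<in> \<Omega> \<Longrightarrow> f y = g y" "has_partial_at j f x"
  shows "has_partial_at j g x" "partial j g x = partial j f x"
proof -
  have "((\<lambda>t. g (x + t *\<^sub>R axis j 1)) has_real_derivative partial j f x) (at 0)"
    using has_partial_atD[OF assms(4)] eventually_line_in_open[OF assms(1,2), of "axis j 1"] assms(2,3)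
    by (subst DERIV_cong_ev[OF refl _ refl, of _ "\<lambda>t. f (x + t *\<^sub>R axis j 1)"])
      (auto elim!: eventually_mono)
  from has_partial_atI[OF this] show "has_partial_at j g x" "partial j g x = partial j f x" by auto
qed

lemma Ck_on_imp_continuous: "Ck_on k \<Omega> f \<Longrightarrow> continuous_on \<Omega> f"
  by (cases k) auto

lemma Ck_on_cong:
  assumes "open \<Omega>" "\<And>y. y \<in> \<Omega> \<Longrightarrow> f y = g y" "Ck_on k \<Omega> f"
  shows "Ck_on k \<Omega> g"
  using assms(2,3)
proof (induction k arbitrary: f g)
  case 0
  then show ?case using continuous_on_cong[of \<Omega> \<Omega> f g] by auto
next
  case (Suc k)
  then show ?case using partial_cong[OF assms(1), of _ f g] continuous_on_cong[of \<Omega> \<Omega> f g]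
    by (auto intro!: Suc.IH[of "partial _ f"])
qed

lemma Ck_on_Suc_imp: "Ck_on (Suc k) \<Omega> f \<Longrightarrow> Ck_on k \<Omega> f"
  by (induction k arbitrary: f) auto

lemma Ck_on_mono: "Ck_on k \<Omega> f \<Longrightarrow> l \<le> k \<Longrightarrow> Ck_on l \<Omega> f"
  by (rotate_tac, induction rule: inc_induct) (auto dest: Ck_on_Suc_imp simp del: Ck_on.simps)

lemma partial_const: "has_partial_at j (\<lambda>x. c) x" "partial j (\<lambda>x. c) = (\<lambda>x. 0)"
  using has_partial_atI[of "\<lambda>x. c" _ j 0] by auto

lemma Ck_on_const: "Ck_on k \<Omega> (\<lambda>x. c)"
  by (induction k arbitrary: c) (auto simp: partial_const)

lemma partial_add:
  assumes "has_partial_at j f x" "has_partial_at j g x"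
  shows "has_partial_at j (\<lambda>x. f x + g x) x" "partial j (\<lambda>x. f x + g x) x = partial j f x + partial j g x"
  using has_partial_atI[OF DERIV_add[OF assms[THEN has_partial_atD]]] by auto

lemma partial_mult:
  assumes "has_partial_at j f x" "has_partial_at j g x"
  shows "has_partial_at j (\<lambda>x. f x * g x) x"
    "partial j (\<lambda>x. f x * g x) x = partial j f x * g x + partial j g x * f x"
  using has_partial_atI[OF DERIV_mult[OF assms[THEN has_partial_atD]]] by auto

lemma Ck_on_add:
  assumes "open \<Omega>" "Ck_on k \<Omega> f" "Ck_on k \<Omega> g"
  shows "Ck_on k \<Omega> (\<lambda>x. f x + g x)"
  using assms(2,3)
proof (induction k arbitrary: f g)
  case (Suc k)
  have "Ck_on k \<Omega> (partial j (\<lambda>x. f x + g x))" for j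
    by (rule Ck_on_cong[OF assms(1) _ Suc.IH[of "partial j f" "partial j g"]])
      (use Suc.prems in \<open>auto simp: partial_add\<close>)
  then show ?case using Suc.prems by (auto intro!: continuous_intros partial_add)
qed (auto intro: continuous_intros)

lemma Ck_on_mult:
  assumes "open \<Omega>" "Ck_on k \<Omega> f" "Ck_on k \<Omega> g"
  shows "Ck_on k \<Omega> (\<lambda>x. f x * g x)"
  using assms(2,3)
proof (induction k arbitrary: f g)
  case (Suc k)
  have "Ck_on k \<Omega> (partial j (\<lambda>x. f x * g x))" for j
    by (rule Ck_on_cong[OF assms(1) _ Ck_on_add[OF assms(1) Suc.IH[of "partial j f" g] Suc.IH[of "partial j g" f]]])
      (use Suc.prems Ck_on_Suc_imp in \<open>auto simp: partial_mult\<close>)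
  then show ?case using Suc.prems by (auto intro!: continuous_intros partial_mult)
qed (auto intro: continuous_intros)

lemma Ck_on_sum:
  assumes "open \<Omega>" "finite A" "\<And>i. i \<in> A \<Longrightarrow> Ck_on k \<Omega> (f i)"
  shows "Ck_on k \<Omega> (\<lambda>x. \<Sum>i\<in>A. f i x)"
  using assms(2,3) by (induction A rule: finite_induct) (auto intro: Ck_on_const Ck_on_add assms(1))

lemma partial_coord: "has_partial_at j (\<lambda>x. x $ l) x" "partial j (\<lambda>x. x $ l) x = axis j 1 $ l"
proof -
  have "((\<lambda>t. (x + t *\<^sub>R axis j 1) $ l) has_real_derivative axis j 1 $ l) (at 0)"
    by (auto intro!: derivative_eq_intros)
  from has_partial_atI[OF this] show "has_partial_at j (\<lambda>x. x $ l) x" "partial j (\<lambda>x. x $ l) x = axis j 1 $ l"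
    by auto
qed

lemma Ck_on_coord: "Ck_on k \<Omega> (\<lambda>x. x $ l)"
proof (cases k)
  case (Suc m)
  have "partial j (\<lambda>x. x $ l) = (\<lambda>x. axis j 1 $ l)" for j
    by (auto simp: partial_coord)
  with Suc show ?thesis by (auto intro!: continuous_intros Ck_on_const partial_coord)
qed (auto intro: continuous_intros)

text \<open>The analysis along curves works with interior regularity; the extension to the boundary
  returns only in \<open>assumptions_C_bound\<close>, as a bound on the fields.\<close>

lemma Ck_closure_imp_Ck_on: "Ck_closure k \<Omega> f \<Longrightarrow> Ck_on k \<Omega> f"
proof -
  have "extends_continuously \<Omega> f \<Longrightarrow> continuous_on \<Omega> f" for f
    unfolding extends_continuously_def
    by (metis closure_subset continuous_on_cong continuous_on_subset)
  then show "Ck_closure k \<Omega> f \<Longrightarrow> Ck_on k \<Omega> f"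
    by (induction k arbitrary: f) auto
qed

section \<open>Total differentiability of C^1 functions and the chain rule along curves\<close>

lemma norm_sum_axis_le:
  "norm (\<Sum>j\<in>S. c j *\<^sub>R axis j (1::real)) \<le> (\<Sum>j\<in>S. \<bar>c j\<bar>)"
  by (rule order_trans[OF norm_sum]) (simp add: norm_axis_1)

text \<open>Changing one coordinate at a time reduces the increment to the mean value theorem.\<close>

lemma increment_estimate:
  assumes "finite S" "\<And>j y. y \<in> ball x d \<Longrightarrow> has_partial_at j f y"
    and "\<And>j y. y \<in> ball x d \<Longrightarrow> \<bar>partial j f y - partial j f x\<bar> \<le> e"
    and "norm (y - x) + (\<Sum>j\<in>S. \<bar>h j\<bar>) < d"
  shows "\<bar>f (y + (\<Sum>j\<in>S. h j *\<^sub>R axis j 1)) - f y - (\<Sum>j\<in>S. h j * partial j f x)\<bar> \<le> e * (\<Sum>j\<in>S. \<bar>h j\<bar>)"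
  using assms(1,4)
proof (induction S rule: finite_induct)
  case (insert k S)
  let ?y = "y + (\<Sum>j\<in>S. h j *\<^sub>R axis j 1)"
  let ?g = "\<lambda>t. f (?y + t *\<^sub>R axis k 1)"
  have ins: "?y + (t * h k) *\<^sub>R axis k 1 \<in> ball x d" if "t \<in> {0..1}" for t
  proof -
    have "dist x (?y + (t * h k) *\<^sub>R axis k 1) = norm ((y - x) + (\<Sum>j\<in>S. h j *\<^sub>R axis j 1) + (t * h k) *\<^sub>R axis k 1)"
      by (simp add: dist_norm norm_minus_commute algebra_simps)
    also have "\<dots> \<le> norm (y - x) + (\<Sum>j\<in>S. \<bar>h j\<bar>) + \<bar>h k\<bar>"
    proof -
      have "norm ((t * h k) *\<^sub>R axis k (1::real)) \<le> 1 * \<bar>h k\<bar>"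
        using that mult_right_mono[of t 1 "\<bar>h k\<bar>"] by (auto simp: norm_axis_1 abs_mult)
      then show ?thesis using norm_sum_axis_le[of h S] by (smt (verit) norm_triangle_ineq)
    qed
    also have "\<dots> < d" using insert by simp
    finally show ?thesis by simp
  qed
  have "((\<lambda>t. f (?y + (t * h k) *\<^sub>R axis k 1)) has_real_derivative
          partial k f (?y + (t * h k) *\<^sub>R axis k 1) * h k) (at t)" if "t \<in> {0..1}" for t
    by (rule DERIV_chain2[where f = ?g and g = "\<lambda>t. t * h k"])
      (use has_partial_at_line[OF assms(2)[OF ins[OF that]]] in \<open>auto intro!: derivative_eq_intros\<close>)
  from MVT2[of 0 1, OF _ this] obtain z where z: "0 < z" "z < 1"
     "f (?y + h k *\<^sub>R axis k 1) - f ?y = partial k f (?y + (z * h k) *\<^sub>R axis k 1) * h k" by auto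
  have "\<bar>f (?y + h k *\<^sub>R axis k 1) - f ?y - h k * partial k f x\<bar>
      = \<bar>partial k f (?y + (z * h k) *\<^sub>R axis k 1) - partial k f x\<bar> * \<bar>h k\<bar>"
    unfolding z(3) by (simp add: algebra_simps flip: abs_mult)
  also have "\<dots> \<le> e * \<bar>h k\<bar>" using assms(3)[OF ins[of z]] z by (auto intro: mult_right_mono)
  finally have "\<bar>f (?y + h k *\<^sub>R axis k 1) - f ?y - h k * partial k f x\<bar> \<le> e * \<bar>h k\<bar>" .
  moreover have "\<bar>f ?y - f y - (\<Sum>j\<in>S. h j * partial j f x)\<bar> \<le> e * (\<Sum>j\<in>S. \<bar>h j\<bar>)"
    using insert by auto
  moreover have "y + (\<Sum>j\<in>insert k S. h j *\<^sub>R axis j 1) = ?y + h k *\<^sub>R axis k 1"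
    using insert by (simp add: algebra_simps)
  ultimately show ?case using insert.hyps
    by (simp only: sum.insert[OF insert.hyps] distrib_left)
qed auto

text \<open>\<open>Ck_on\<close> speaks of partial derivatives only, while curves need the total
  derivative. With N the dimension, continuity of the finitely many partials gives a common radius
  on which each varies by at most e / N; the sum of the coordinate increments is at most N times the
  norm, which restores e and explains the radius \<open>\<delta> / N\<close>.\<close>

lemma C1_has_derivative:
  fixes f :: "real^'p \<Rightarrow> real"
  assumes "open \<Omega>" "Ck_on (Suc 0) \<Omega> f" "x \<in> \<Omega>"
  shows "(f has_derivative (\<lambda>h. \<Sum>j\<in>UNIV. h $ j * partial j f x)) (at x)"
  unfolding has_derivative_at_alt
proof (intro conjI allI impI)
  show "bounded_linear (\<lambda>h. \<Sum>j\<in>UNIV. h $ j * partial j f x)"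
    by (intro bounded_linear_sum bounded_linear_mult_const bounded_linear_vec_nth)
next
  fix e :: real assume "e > 0"
  define N where "N = real CARD('p)"
  have N: "N > 0" by (simp add: N_def)
  obtain d0 where d0: "d0 > 0" "ball x d0 \<subseteq> \<Omega>" using assms openE by blast
  have "\<exists>d>0. \<forall>y\<in>\<Omega>. dist y x < d \<longrightarrow> dist (partial j f y) (partial j f x) < e / N" for j
    using assms(2,3) \<open>e > 0\<close> N unfolding Ck_on.simps continuous_on_iff by simp
  then obtain d where d: "\<And>j. d j > 0" "\<And>j y. y \<in> \<Omega> \<Longrightarrow> dist y x < d j \<Longrightarrow> \<bar>partial j f y - partial j f x\<bar> < e / N"
    by (metis dist_real_def)
  define \<delta> where "\<delta> = min d0 (Min (range d))"
  have \<delta>: "\<delta> > 0" "\<delta> \<le> d0" "\<And>j. \<delta> \<le> d j" using d0 d(1) by (auto simp: \<delta>_def min_le_iff_disj)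
  show "\<exists>d>0. \<forall>y. norm (y - x) < d \<longrightarrow> norm (f y - f x - (\<Sum>j\<in>UNIV. (y - x) $ j * partial j f x)) \<le> e * norm (y - x)"
  proof (intro exI[of _ "\<delta> / N"] conjI allI impI)
    fix y assume y: "norm (y - x) < \<delta> / N"
    have s: "(\<Sum>j\<in>UNIV. \<bar>(y - x) $ j\<bar>) \<le> N * norm (y - x)"
      using sum_bounded_above[of UNIV "\<lambda>j. \<bar>(y - x) $ j\<bar>" "norm (y - x)"] component_le_norm_cart[of "y - x"]
      by (auto simp: N_def)
    have *: "x + (\<Sum>j\<in>UNIV. (y - x) $ j *\<^sub>R axis j 1) = y"
      using basis_expansion[of "y - x"] by (simp add: scalar_mult_eq_scaleR)
    have "\<bar>f (x + (\<Sum>j\<in>UNIV. (y - x) $ j *\<^sub>R axis j 1)) - f x - (\<Sum>j\<in>UNIV. (y - x) $ j * partial j f x)\<bar>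
       \<le> e / N * (\<Sum>j\<in>UNIV. \<bar>(y - x) $ j\<bar>)"
    proof (rule increment_estimate[where d = \<delta>])
      show "norm (x - x) + (\<Sum>j\<in>UNIV. \<bar>(y - x) $ j\<bar>) < \<delta>" using s y N by (simp add: field_simps)
    next
      fix j z assume "z \<in> ball x \<delta>"
      then have "z \<in> \<Omega>" "dist z x < d j" using \<delta>(2) \<delta>(3)[of j] d0 by (auto simp: dist_commute)
      then show "has_partial_at j f z" "\<bar>partial j f z - partial j f x\<bar> \<le> e / N"
        using assms(2) d(2)[of z j] by auto
    qed auto
    also have "\<dots> \<le> e / N * (N * norm (y - x))" using s N \<open>e > 0\<close> by (intro mult_left_mono) auto
    finally show "norm (f y - f x - (\<Sum>j\<in>UNIV. (y - x) $ j * partial j f x)) \<le> e * norm (y - x)"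
      using N unfolding * by simp
  qed (use \<delta> N in auto)
qed

lemma C1_chain:
  fixes f :: "real^'p \<Rightarrow> real"
  assumes "open \<Omega>" "Ck_on (Suc 0) \<Omega> f" "\<phi> t \<in> \<Omega>" "(\<phi> has_vector_derivative v) (at t within T)"
  shows "((\<lambda>s. f (\<phi> s)) has_real_derivative vf_apply (\<lambda>_. v) f (\<phi> t)) (at t within T)"
proof -
  have "((f \<circ> \<phi>) has_vector_derivative (\<Sum>j\<in>UNIV. v $ j * partial j f (\<phi> t))) (at t within T)"
    by (rule vector_derivative_diff_chain_within[OF assms(4) has_derivative_at_withinI[OF C1_has_derivative[OF assms(1-3)]]])
  then show ?thesis by (simp add: has_real_derivative_iff_has_vector_derivative o_def vf_apply_def)
qed

section \<open>Symmetry of second derivatives\<close>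

lemma second_difference:
  assumes "h > 0" "\<And>y. y \<in> cball x (2 * h) \<Longrightarrow> has_partial_at i f y"
    and "\<And>y. y \<in> cball x (2 * h) \<Longrightarrow> has_partial_at j (partial i f) y"
  obtains y where "y \<in> cball x (2 * h)"
    "f (x + h *\<^sub>R axis i 1 + h *\<^sub>R axis j 1) - f (x + h *\<^sub>R axis i 1) - f (x + h *\<^sub>R axis j 1) + f x
       = h * h * partial j (partial i f) y"
proof -
  have ins: "x + s *\<^sub>R axis i 1 + t *\<^sub>R axis j 1 \<in> cball x (2 * h)" if "0 \<le> s" "s \<le> h" "0 \<le> t" "t \<le> h" for s t
    using that norm_triangle_ineq[of "s *\<^sub>R axis i (1::real)" "t *\<^sub>R axis j 1"]
    by (auto simp: dist_norm norm_axis_1 add.assoc norm_minus_commute[of "- (s *\<^sub>R axis i 1)"] add.commute)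
  define g where "g s = f (x + s *\<^sub>R axis i 1 + h *\<^sub>R axis j 1) - f (x + s *\<^sub>R axis i 1)" for s
  have "(g has_real_derivative partial i f (x + s *\<^sub>R axis i 1 + h *\<^sub>R axis j 1) - partial i f (x + s *\<^sub>R axis i 1)) (at s)"
    if "0 \<le> s" "s \<le> h" for s
  proof -
    have 1: "has_partial_at i f (x + h *\<^sub>R axis j 1 + s *\<^sub>R axis i 1)"
      using assms(2)[OF ins[of s h]] that assms(1) by (simp add: add_ac)
    have 2: "has_partial_at i f (x + s *\<^sub>R axis i 1)"
      using assms(2)[OF ins[of s 0]] that assms(1) by simp
    show ?thesis
      using DERIV_diff[OF has_partial_at_line[OF 1] has_partial_at_line[OF 2]]
      unfolding g_def by (simp add: add_ac)
  qed
  from MVT2[OF assms(1) this] obtain s where s: "0 < s" "s < h" and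
    gs: "g h - g 0 = h * (partial i f (x + s *\<^sub>R axis i 1 + h *\<^sub>R axis j 1) - partial i f (x + s *\<^sub>R axis i 1))"
    by auto
  have "((\<lambda>t. partial i f (x + s *\<^sub>R axis i 1 + t *\<^sub>R axis j 1)) has_real_derivative
       partial j (partial i f) (x + s *\<^sub>R axis i 1 + t *\<^sub>R axis j 1)) (at t)" if "0 \<le> t" "t \<le> h" for t
    using has_partial_at_line[OF assms(3)[OF ins[of s t]]] that s by auto
  from MVT2[OF assms(1) this] obtain t where t: "0 < t" "t < h" and
    "partial i f (x + s *\<^sub>R axis i 1 + h *\<^sub>R axis j 1) - partial i f (x + s *\<^sub>R axis i 1) =
     h * partial j (partial i f) (x + s *\<^sub>R axis i 1 + t *\<^sub>R axis j 1)" by auto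
  then show ?thesis using gs that[OF ins[of s t]] s t unfolding g_def by (auto simp: add_ac)
qed

text \<open>The second difference of \<open>f\<close> over a small square is symmetric in the two
  directions, and by two mean value steps it equals \<open>h * h\<close> times either mixed
  derivative at some nearby point. So the two mixed derivatives agree at points arbitrarily close to
  \<open>x\<close>, and continuity excludes a gap of \<open>2 * e\<close> at
  \<open>x\<close>.\<close>

lemma partial_commute:
  assumes "open \<Omega>" "Ck_on (Suc (Suc 0)) \<Omega> f" "x \<in> \<Omega>"
  shows "partial i (partial j f) x = partial j (partial i f) x"
proof (rule ccontr)
  assume ne: "partial i (partial j f) x \<noteq> partial j (partial i f) x"
  define e where "e = \<bar>partial i (partial j f) x - partial j (partial i f) x\<bar> / 2"
  have "e > 0" using ne by (simp add: e_def)
  obtain d0 where d0: "d0 > 0" "ball x d0 \<subseteq> \<Omega>" using assms openE by blast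
  have "\<exists>d>0. \<forall>y\<in>\<Omega>. dist y x < d \<longrightarrow> dist (partial k (partial l f) y) (partial k (partial l f) x) < e" for k l
    using assms(2,3) \<open>e > 0\<close> unfolding Ck_on.simps continuous_on_iff by simp
  then obtain d where d: "\<And>k l. d k l > 0" and
    dl: "\<And>k l y. y \<in> \<Omega> \<Longrightarrow> dist y x < d k l \<Longrightarrow> \<bar>partial k (partial l f) y - partial k (partial l f) x\<bar> < e"
    by (metis dist_real_def)
  define h where "h = min d0 (min (d i j) (d j i)) / 3"
  have h: "h > 0" "2 * h < d0" "2 * h < d i j" "2 * h < d j i" using d0 d[of i j] d[of j i] unfolding h_def by linarith+
  have sub: "y \<in> \<Omega>" "dist y x < d i j" "dist y x < d j i" if "y \<in> cball x (2 * h)" for y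
    using that h d0 by (auto simp: dist_commute subset_iff)
  obtain y where y: "y \<in> cball x (2 * h)"
    "f (x + h *\<^sub>R axis i 1 + h *\<^sub>R axis j 1) - f (x + h *\<^sub>R axis i 1) - f (x + h *\<^sub>R axis j 1) + f x
       = h * h * partial j (partial i f) y"
    by (rule second_difference[OF h(1), of x i f j]) (use assms(2) sub in auto)
  obtain z where z: "z \<in> cball x (2 * h)"
    "f (x + h *\<^sub>R axis j 1 + h *\<^sub>R axis i 1) - f (x + h *\<^sub>R axis j 1) - f (x + h *\<^sub>R axis i 1) + f x
       = h * h * partial i (partial j f) z"
    by (rule second_difference[OF h(1), of x j f i]) (use assms(2) sub in auto)
  have "h * h * partial j (partial i f) y = h * h * partial i (partial j f) z"
    using y(2) z(2) by (simp add: algebra_simps)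
  then have "partial j (partial i f) y = partial i (partial j f) z" using h by simp
  then show False using dl[OF sub(1,3)[OF y(1)]] dl[OF sub(1,2)[OF z(1)]] unfolding e_def by argo
qed

section \<open>The coefficient bracket as a commutator of operators\<close>

lemma Ck_on_vf_apply:
  assumes "open \<Omega>" "\<And>j. Ck_on k \<Omega> (\<lambda>x. X x $ j)" "Ck_on (Suc k) \<Omega> g"
  shows "Ck_on k \<Omega> (vf_apply X g)"
  unfolding vf_apply_def[abs_def] using assms
  by (intro Ck_on_sum Ck_on_mult) auto

lemma partial_sum:
  assumes "finite A" "\<And>i. i \<in> A \<Longrightarrow> has_partial_at j (f i) x"
  shows "has_partial_at j (\<lambda>x. \<Sum>i\<in>A. f i x) x \<and> partial j (\<lambda>x. \<Sum>i\<in>A. f i x) x = (\<Sum>i\<in>A. partial j (f i) x)"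
  using assms by (induction A rule: finite_induct) (auto simp: partial_const partial_add)

lemma vf_apply_vf_apply:
  fixes X Y :: "real^'p \<Rightarrow> real^'p"
  assumes "\<And>j. Ck_on (Suc 0) \<Omega> (\<lambda>x. Y x $ j)" "Ck_on (Suc (Suc 0)) \<Omega> g" "x \<in> \<Omega>"
  shows "vf_apply X (vf_apply Y g) x = (\<Sum>l\<in>UNIV. vf_apply X (\<lambda>y. Y y $ l) x * partial l g x)
     + (\<Sum>j\<in>UNIV. \<Sum>l\<in>UNIV. X x $ j * Y x $ l * partial j (partial l g) x)"
proof -
  have "partial j (vf_apply Y g) x = (\<Sum>l\<in>UNIV. partial j (\<lambda>y. Y y $ l) x * partial l g x + partial j (partial l g) x * Y x $ l)" for j
    unfolding vf_apply_def[abs_def] using assms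
    by (subst partial_sum[THEN conjunct2]) (auto intro!: sum.cong partial_mult)
  then have "vf_apply X (vf_apply Y g) x = (\<Sum>j\<in>UNIV. X x $ j * (\<Sum>l\<in>UNIV. partial j (\<lambda>y. Y y $ l) x * partial l g x + partial j (partial l g) x * Y x $ l))"
    by (subst vf_apply_def) simp
  also have "\<dots> = (\<Sum>j\<in>UNIV. \<Sum>l\<in>UNIV. X x $ j * partial j (\<lambda>y. Y y $ l) x * partial l g x)
     + (\<Sum>j\<in>UNIV. \<Sum>l\<in>UNIV. X x $ j * Y x $ l * partial j (partial l g) x)"
    by (simp add: sum_distrib_left sum.distrib algebra_simps)
  also have "(\<Sum>j\<in>UNIV. \<Sum>l\<in>UNIV. X x $ j * partial j (\<lambda>y. Y y $ l) x * partial l g x)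
      = (\<Sum>l\<in>UNIV. vf_apply X (\<lambda>y. Y y $ l) x * partial l g x)"
    unfolding vf_apply_def sum_distrib_right by (rule sum.swap)
  finally show ?thesis .
qed

text \<open>Both compositions contribute a double sum with second derivatives of \<open>g\<close>;
  renaming the indices and \<open>partial_commute\<close> identify the two sums, so they cancel. The
  first order rest is the coefficient formula of \<open>vf_bracket\<close>.\<close>

lemma vf_apply_bracket:
  fixes X Y :: "real^'p \<Rightarrow> real^'p"
  assumes "open \<Omega>" "\<And>j. Ck_on (Suc 0) \<Omega> (\<lambda>x. X x $ j)" "\<And>j. Ck_on (Suc 0) \<Omega> (\<lambda>x. Y x $ j)"
    and "Ck_on (Suc (Suc 0)) \<Omega> g" "x \<in> \<Omega>"
  shows "vf_apply (vf_bracket X Y) g x = vf_apply X (vf_apply Y g) x - vf_apply Y (vf_apply X g) x"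
proof -
  have "(\<Sum>j\<in>UNIV. \<Sum>l\<in>UNIV. X x $ j * Y x $ l * partial j (partial l g) x)
     = (\<Sum>j\<in>UNIV. \<Sum>l\<in>UNIV. Y x $ j * X x $ l * partial j (partial l g) x)"
    by (subst sum.swap) (simp add: partial_commute[OF assms(1,4,5)] mult_ac)
  then show ?thesis
    unfolding vf_apply_vf_apply[OF assms(2,4,5)] vf_apply_vf_apply[OF assms(3,4,5)]
    by (simp add: vf_apply_def vf_bracket_def algebra_simps sum_subtractf)
qed

section \<open>Noncommutative power series\<close>

definition wt :: "nat \<Rightarrow> nat" where "wt i = (if i = 0 then 2 else 1)"

lemma wt_pos [simp]: "wt i > 0" and wt_le_2: "wt i \<le> 2" by (auto simp: wt_def)

lemma diff_wt_less [simp]: "wt i \<le> m \<Longrightarrow> m - wt i < m"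
  using wt_pos[of i] by linarith

lemma weight_simps [simp]:
  "weight [] = 0" "weight (i # u) = wt i + weight u" "weight (u @ v) = weight u + weight v"
  "weight (replicate k i) = k * wt i"
  by (auto simp: weight_def wt_def sum_list_replicate)

lemma length_le_weight: "length u \<le> weight u"
  by (induction u) (auto simp: wt_def)

text \<open>This is the product of noncommutative power series: the sum of \<open>A u * B v\<close>
  over all splittings \<open>w = u @ v\<close>. The recursion separates the splitting with empty
  \<open>u\<close> from those in which the first letter belongs to \<open>u\<close>.\<close>

primrec conv :: "nat list \<Rightarrow> (nat list \<Rightarrow> real) \<Rightarrow> (nat list \<Rightarrow> real) \<Rightarrow> real" where
  "conv [] A B = A [] * B []"
| "conv (x # w) A B = A [] * B (x # w) + conv w (\<lambda>v. A (x # v)) B"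

lemma conv_add_left: "conv w (\<lambda>v. A v + B v) C = conv w A C + conv w B C"
  by (induction w arbitrary: A B) (auto simp: algebra_simps)

lemma conv_scale_left: "conv w (\<lambda>v. c * A v) C = c * conv w A C"
  by (induction w arbitrary: A) (auto simp: algebra_simps)

lemma conv_add_right: "conv w A (\<lambda>v. B v + C v) = conv w A B + conv w A C"
  by (induction w arbitrary: A) (auto simp: algebra_simps)

text \<open>The recursion shifts only the left factor, so the induction varies \<open>A\<close>. The
  shift of a product by a letter consists of two terms, which left linearity of \<open>conv\<close>
  separates.\<close>

lemma conv_assoc: "conv w (\<lambda>v. conv v A B) C = conv w A (\<lambda>v. conv v B C)"
  by (induction w arbitrary: A) (auto simp: algebra_simps conv_add_left conv_scale_left)

lemma conv_zero: "conv w (\<lambda>v. 0) B = 0"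
  by (induction w) auto

lemma conv_one_left: "conv w (\<lambda>v. if v = [] then 1 else 0) B = B w"
  by (cases w) (auto simp: conv_zero)

lemma conv_one_right: "conv w A (\<lambda>v. if v = [] then 1 else 0) = A w"
  by (induction w arbitrary: A) auto

text \<open>Formal power series in noncommuting variables indexed by \<open>nat\<close>: the coefficient function on words.\<close>

typedef ncps = "UNIV :: (nat list \<Rightarrow> real) set"
  morphisms cf Ncps by simp

lemma cf_Ncps [simp]: "cf (Ncps f) = f" by (simp add: Ncps_inverse)

lemma ncps_eqI: "(\<And>w. cf A w = cf B w) \<Longrightarrow> A = B"
  by (simp add: cf_inject[symmetric] fun_eq_iff)

instantiation ncps :: ring_1
begin
definition "0 = Ncps (\<lambda>_. 0)"
definition "1 = Ncps (\<lambda>v. if v = [] then 1 else 0)"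
definition "A + B = Ncps (\<lambda>w. cf A w + cf B w)"
definition "A - B = Ncps (\<lambda>w. cf A w - cf B w)"
definition "- A = Ncps (\<lambda>w. - cf A w)"
definition "A * B = Ncps (\<lambda>w. conv w (cf A) (cf B))"
lemmas ncps_defs = zero_ncps_def one_ncps_def plus_ncps_def minus_ncps_def uminus_ncps_def times_ncps_def
instance
proof
  show "(0::ncps) \<noteq> 1"
    by (auto simp: ncps_defs Ncps_inject fun_eq_iff)
qed (simp_all add: ncps_defs conv_assoc conv_one_left conv_one_right conv_add_left conv_add_right algebra_simps cf_inverse)
end

lemma cf_simps [simp]:
  "cf 0 w = 0" "cf 1 w = (if w = [] then 1 else 0)" "cf (A + B) w = cf A w + cf B w"
  "cf (A - B) w = cf A w - cf B w" "cf (- A) w = - cf A w" "cf (A * B) w = conv w (cf A) (cf B)"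
  by (auto simp: ncps_defs)

definition wmono :: "real \<Rightarrow> nat list \<Rightarrow> ncps" where
  "wmono c v = Ncps (\<lambda>w. if w = v then c else 0)"

lemma cf_wmono [simp]: "cf (wmono c v) w = (if w = v then c else 0)"
  by (simp add: wmono_def)

lemma conv_mono_left: "conv w (\<lambda>u. if u = v then c else 0) B
   = (if take (length v) w = v then c * B (drop (length v) w) else 0)"
proof (induction v arbitrary: w)
  case Nil
  have "conv w (\<lambda>u. c * (if u = [] then 1 else 0)) B = c * B w"
    by (simp only: conv_scale_left conv_one_left)
  then show ?case by (simp add: if_distrib cong: if_cong)
next
  case (Cons a v)
  show ?case
  proof (cases w)
    case (Cons x w')
    then show ?thesis using Cons.IH[of w'] by (cases "x = a") (auto simp: conv_zero)
  qed auto
qed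

lemma wmono_mult: "wmono c u * wmono d v = wmono (c * d) (u @ v)"
proof (rule ncps_eqI)
  fix w
  have "take (length u) w = u \<and> drop (length u) w = v \<longleftrightarrow> w = u @ v"
    by (metis append_take_drop_id append_eq_conv_conj)
  then show "cf (wmono c u * wmono d v) w = cf (wmono (c * d) (u @ v)) w"
    unfolding cf_simps cf_wmono conv_mono_left by auto
qed

text \<open>The formal exponential of \<open>s\<close> times the letter \<open>i\<close>. The time
  of a flow does not occur: powers of \<open>t\<close> are carried by \<open>state\<close>.\<close>

definition expser :: "real \<Rightarrow> nat \<Rightarrow> ncps" where
  "expser s i = Ncps (\<lambda>w. if w = replicate (length w) i then s ^ length w / fact (length w) else 0)"

text \<open>Series in a single letter multiply like ordinary power series, because every splitting
  of a power of \<open>i\<close> consists of powers of \<open>i\<close>.\<close>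

lemma conv_powers:
  "conv w (\<lambda>w. if w = replicate (length w) i then c (length w) else 0)
          (\<lambda>w. if w = replicate (length w) i then d (length w) else 0)
   = (if w = replicate (length w) i then \<Sum>k\<le>length w. c k * d (length w - k) else 0)"
proof (induction w arbitrary: c)
  case (Cons x w)
  show ?case
  proof (cases "x = i")
    case True
    then show ?thesis using Cons[of "\<lambda>k. c (Suc k)"] by (auto simp: sum.atMost_Suc_shift simp del: sum.atMost_Suc cong: if_cong)
  qed (auto simp: conv_zero)
qed auto

text \<open>After multiplication by \<open>fact n\<close> this is the binomial expansion of
  \<open>(s + - s) ^ n\<close>.\<close>

lemma exp_cauchy: "(\<Sum>k\<le>n. s ^ k / fact k * ((- s) ^ (n - k) / fact (n - k))) = (if n = 0 then 1 else (0::real))"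
proof -
  have "(\<Sum>k\<le>n. s ^ k / fact k * ((- s) ^ (n - k) / fact (n - k)))
     = (\<Sum>k\<le>n. of_nat (n choose k) * s ^ k * (- s) ^ (n - k)) / fact n"
    unfolding sum_divide_distrib by (intro sum.cong) (auto simp: binomial_fact field_simps)
  also have "\<dots> = (s + - s) ^ n / fact n" by (subst binomial_ring) simp
  finally show ?thesis by (auto simp: power_0_left)
qed

lemma expser_inverse: "expser s i * expser (- s) i = 1"
  unfolding expser_def times_ncps_def cf_Ncps
proof (rule ncps_eqI)
  fix w
  have "cf (Ncps (\<lambda>w. conv w (\<lambda>w. if w = replicate (length w) i then s ^ length w / fact (length w) else 0)
      (\<lambda>w. if w = replicate (length w) i then (- s) ^ length w / fact (length w) else 0))) w
     = (if w = replicate (length w) i then if length w = 0 then 1 else 0 else 0)"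
    using conv_powers[of w i "\<lambda>n. s ^ n / fact n" "\<lambda>n. (- s) ^ n / fact n"]
    by (simp only: cf_Ncps exp_cauchy)
  then show "cf (Ncps (\<lambda>w. conv w (\<lambda>w. if w = replicate (length w) i then s ^ length w / fact (length w) else 0)
      (\<lambda>w. if w = replicate (length w) i then (- s) ^ length w / fact (length w) else 0))) w = cf 1 w"
    by auto
qed

section \<open>The weight filtration of the ring and group commutators\<close>

definition vanish :: "nat \<Rightarrow> ncps \<Rightarrow> bool" where
  "vanish m A \<longleftrightarrow> (\<forall>w. weight w < m \<longrightarrow> cf A w = 0)"

text \<open>Weight is additive, so in each splitting of \<open>w\<close> one part lies below its
  threshold. Removing a first letter \<open>x\<close> lowers the left threshold to
  \<open>a - wt x\<close>; if truncated subtraction gives 0, the rest of the word already weighs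
  less than \<open>b\<close>.\<close>

lemma conv_vanish:
  assumes "\<And>w. weight w < a \<Longrightarrow> A w = 0" "\<And>w. weight w < b \<Longrightarrow> B w = 0" "weight w < a + b"
  shows "conv w A B = 0"
  using assms
proof (induction w arbitrary: A a)
  case (Cons x w)
  have "conv w (\<lambda>v. A (x # v)) B = 0"
    by (rule Cons.IH[of "a - wt x"]) (use Cons.prems in auto)
  moreover have "A [] * B (x # w) = 0"
    using Cons.prems by (cases "a = 0") auto
  ultimately show ?case by simp
qed auto

lemma vanish_mult: "vanish a A \<Longrightarrow> vanish b B \<Longrightarrow> vanish (a + b) (A * B)"
  unfolding vanish_def cf_simps by (intro allI impI conv_vanish[of a "cf A" b "cf B"]) auto

lemma vanish_add: "vanish a A \<Longrightarrow> vanish a B \<Longrightarrow> vanish a (A + B)"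
  and vanish_diff: "vanish a A \<Longrightarrow> vanish a B \<Longrightarrow> vanish a (A - B)"
  and vanish_mono: "vanish a A \<Longrightarrow> b \<le> a \<Longrightarrow> vanish b A"
  and vanish_0: "vanish 0 A"
  by (auto simp: vanish_def)

text \<open>Read as A = 1 + c + terms of weight above \<open>a\<close>. Positivity of
  \<open>a\<close> makes products of two such deviations from 1 fall into the error.\<close>

definition leading :: "nat \<Rightarrow> ncps \<Rightarrow> ncps \<Rightarrow> bool" where
  "leading a A c \<longleftrightarrow> a > 0 \<and> vanish a c \<and> vanish (Suc a) (A - 1 - c)"

lemma leading_imp_vanish: "leading a A c \<Longrightarrow> vanish a (A - 1)"
  using vanish_add[of a "A - 1 - c" c] vanish_mono[of "Suc a" "A - 1 - c" a] by (auto simp: leading_def)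

text \<open>From \<open>A * A' = 1\<close> follows A' - 1 + c = (A - 1)(1 - A') - (A - 1 - c). The
  product vanishes to order 2a, which is at least a + 1.\<close>

lemma leading_inverse:
  assumes "leading a A c" "A * A' = 1"
  shows "leading a A' (- c)"
proof -
  have "vanish a ((A - 1) * A')"
    using vanish_mult[OF leading_imp_vanish[OF assms(1)] vanish_0[of A']] by simp
  moreover have eq: "(A - 1) * A' = 1 - A'" using assms(2) by (simp add: algebra_simps)
  ultimately have v: "vanish a (1 - A')" by simp
  have "vanish (a + a) ((A - 1) * (1 - A'))" by (intro vanish_mult leading_imp_vanish[OF assms(1)] v)
  then have "vanish (Suc a) ((A - 1) * (1 - A'))" using assms(1) by (auto simp: leading_def intro: vanish_mono)
  moreover have "A' - 1 - - c = (A - 1) * (1 - A') - (A - 1 - c)"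
    using assms(2) by (simp add: algebra_simps)
  ultimately have "vanish (Suc a) (A' - 1 - - c)" using assms(1) unfolding leading_def by (metis vanish_diff)
  then show ?thesis using assms(1) by (auto simp: leading_def vanish_def)
qed

text \<open>Since \<open>A' * B'\<close> inverts \<open>B * A\<close>, the group commutator minus 1
  equals (AB - BA) A'B'. Here AB - BA is the commutator of A - 1 and B - 1, with leading part cd -
  dc, and A'B' = 1 + R with R of positive order, so R only affects higher weights.\<close>

lemma leading_commutator:
  assumes A: "leading a A c" "A * A' = 1" and B: "leading b B d" "B * B' = 1"
    and inv: "A' * A = 1" "B' * B = 1"
  shows "leading (a + b) (A * B * A' * B') (c * d - d * c)"
proof -
  define C where "C = (A - 1) * (B - 1) - (B - 1) * (A - 1) - (c * d - d * c)"
  have "C = (A - 1 - c) * (B - 1) + c * (B - 1 - d) - (B - 1 - d) * (A - 1) - d * (A - 1 - c)"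
    by (simp add: C_def algebra_simps)
  moreover have "vanish (Suc (a + b)) ((A - 1 - c) * (B - 1))" "vanish (Suc (a + b)) (c * (B - 1 - d))"
      "vanish (Suc (a + b)) ((B - 1 - d) * (A - 1))" "vanish (Suc (a + b)) (d * (A - 1 - c))"
    using vanish_mult[of "Suc a" "A - 1 - c" b "B - 1"] vanish_mult[of a c "Suc b" "B - 1 - d"]
      vanish_mult[of "Suc b" "B - 1 - d" a "A - 1"] vanish_mult[of b d "Suc a" "A - 1 - c"]
      A(1) B(1) leading_imp_vanish[OF A(1)] leading_imp_vanish[OF B(1)]
    unfolding leading_def by (auto simp: add_ac)
  ultimately have C: "vanish (Suc (a + b)) C" by (metis vanish_add vanish_diff)
  have cd: "vanish (a + b) (c * d - d * c)"
    using vanish_mult[of a c b d] vanish_mult[of b d a c] A(1) B(1)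
    by (auto simp: leading_def add.commute intro!: vanish_diff)
  have BA: "B * A * (A' * B') = 1" using A B by (metis mult.assoc mult.right_neutral)
  define R where "R = A' * B' - 1"
  have "vanish 1 R"
  proof -
    have 1: "vanish 1 (A' - 1)" "vanish 1 (B' - 1)"
      using vanish_mono[OF leading_imp_vanish[OF leading_inverse[OF A]], of 1]
        vanish_mono[OF leading_imp_vanish[OF leading_inverse[OF B]], of 1] A(1) B(1)
      by (auto simp: leading_def)
    have "vanish 1 ((A' - 1) * B')"
      using vanish_mult[OF 1(1) vanish_0[of B']] by simp
    moreover have "A' * B' - 1 = (A' - 1) * B' + (B' - 1)" by (simp add: algebra_simps)
    ultimately show ?thesis unfolding R_def using 1(2) by (metis vanish_add)
  qed
  have "A * B * A' * B' - 1 = (A * B - B * A) * (A' * B')"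
    using BA by (simp add: algebra_simps)
  also have "A * B - B * A = C + (c * d - d * c)" by (simp add: C_def algebra_simps)
  also have "(C + (c * d - d * c)) * (A' * B') = (c * d - d * c) + (C * (A' * B') + (c * d - d * c) * R)"
    by (simp add: R_def algebra_simps)
  finally have "A * B * A' * B' - 1 - (c * d - d * c) = C * (A' * B') + (c * d - d * c) * R"
    by simp
  moreover have "vanish (Suc (a + b)) (C * (A' * B'))" "vanish (Suc (a + b)) ((c * d - d * c) * R)"
    using vanish_mult[OF C vanish_0] vanish_mult[OF cd \<open>vanish 1 R\<close>] by auto
  ultimately have "vanish (Suc (a + b)) (A * B * A' * B' - 1 - (c * d - d * c))"
    by (simp add: vanish_add)
  then show ?thesis using cd A(1) by (auto simp: leading_def)
qed

lemma leading_expser: "s = 1 \<or> s = -1 \<Longrightarrow> leading (wt i) (expser s i) (wmono s [i])"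
proof -
  have "cf (expser s i - 1 - wmono s [i]) w = 0" if "weight w < Suc (wt i)" for w
  proof -
    have "w = []" if "w = replicate (length w) i" "w \<noteq> [i]"
    proof -
      have "weight w = length w * wt i" using that(1) by (metis weight_simps(4))
      then have "length w * wt i \<le> wt i" using \<open>weight w < Suc (wt i)\<close> by linarith
      then have "length w * wt i < 2 * wt i" using wt_pos[of i] by linarith
      then have "length w < 2" by (metis mult_less_cancel2)
      then have "length w \<le> 1" by simp
      then show "w = []" using that by (cases w) (auto)
    qed
    then show ?thesis by (auto simp: expser_def)
  qed
  then show "leading (wt i) (expser s i) (wmono s [i])"
    by (auto simp: leading_def vanish_def)
qed

text \<open>\<open>ev n m A S\<close> is the sum of \<open>cf A w * S w\<close> over the words \<open>w\<close> on \<open>{0..n}\<close> of weight at most \<open>m\<close>.\<close>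

function ev :: "nat \<Rightarrow> nat \<Rightarrow> (nat list \<Rightarrow> real) \<Rightarrow> (nat list \<Rightarrow> real) \<Rightarrow> real" where
  "ev n m A S = A [] * S [] + (\<Sum>i | i \<le> n \<and> wt i \<le> m. ev n (m - wt i) (\<lambda>v. A (i # v)) (\<lambda>v. S (i # v)))"
  by pat_completeness auto
termination
proof (relation "Wellfounded.measure (\<lambda>(n, m, A, S). m)")
  fix n m i :: nat assume "i \<in> {i. i \<le> n \<and> wt i \<le> m}"
  then show "((n, m - wt i, a, b), n, m, c, d) \<in> Wellfounded.measure (\<lambda>(n, m, A, S). m)" for a b c d
    using wt_pos[of i] by auto
qed auto

declare ev.simps [simp del]

lemma ev_add_left: "ev n m (\<lambda>v. A v + B v) S = ev n m A S + ev n m B S"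
proof (induction m arbitrary: A B S rule: less_induct)
  case (less m)
  have "ev n (m - wt i) (\<lambda>v. A (i # v) + B (i # v)) (\<lambda>v. S (i # v)) =
        ev n (m - wt i) (\<lambda>v. A (i # v)) (\<lambda>v. S (i # v)) + ev n (m - wt i) (\<lambda>v. B (i # v)) (\<lambda>v. S (i # v))"
    if "wt i \<le> m" for i using less[of "m - wt i"] wt_pos[of i] that by simp
  then show ?case by (subst (1 2 3) ev.simps) (simp add: algebra_simps sum.distrib)
qed

lemma ev_scale_left: "ev n m (\<lambda>v. c * A v) S = c * ev n m A S"
proof (induction m arbitrary: A S rule: less_induct)
  case (less m)
  have "ev n (m - wt i) (\<lambda>v. c * A (i # v)) (\<lambda>v. S (i # v)) =
        c * ev n (m - wt i) (\<lambda>v. A (i # v)) (\<lambda>v. S (i # v))"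
    if "wt i \<le> m" for i using less[of "m - wt i"] wt_pos[of i] that by simp
  then show ?case by (subst (1 2) ev.simps) (simp add: algebra_simps sum_distrib_left)
qed

lemma ev_zero [simp]: "ev n m (\<lambda>v. 0) S = 0"
  using ev_scale_left[of n m 0] by simp

lemma ev_sum_list: "ev n m (cf (sum_list As)) S = (\<Sum>A\<leftarrow>As. ev n m (cf A) S)"
  by (induction As) (simp_all add: ev_add_left fun_eq_iff)

text \<open>A product is evaluated by letting the right factor act on the values first and the left
  factor on the results. A left word \<open>v\<close> has used up \<open>weight v\<close> of the
  budget \<open>m\<close>, so the right factor is cut off at the remainder. This turns successive
  flows into a product of series.\<close>

lemma ev_conv: "ev n m (\<lambda>w. conv w A B) S = ev n m A (\<lambda>v. ev n (m - weight v) B (\<lambda>v'. S (v @ v')))"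
proof (induction m arbitrary: A S rule: less_induct)
  case (less m)
  let ?I = "{i. i \<le> n \<and> wt i \<le> m}"
  have step: "ev n (m - wt i) (\<lambda>w. conv (i # w) A B) (\<lambda>v. S (i # v)) =
        A [] * ev n (m - wt i) (\<lambda>v. B (i # v)) (\<lambda>v. S (i # v)) +
        ev n (m - wt i) (\<lambda>v. A (i # v)) (\<lambda>v. ev n (m - wt i - weight v) B (\<lambda>v'. S (i # v @ v')))"
    if "i \<in> ?I" for i
  proof -
    have "ev n (m - wt i) (\<lambda>w. conv w (\<lambda>v. A (i # v)) B) (\<lambda>v. S (i # v)) =
      ev n (m - wt i) (\<lambda>v. A (i # v)) (\<lambda>v. ev n (m - wt i - weight v) B (\<lambda>v'. S (i # v @ v')))"
      using less[of "m - wt i" "\<lambda>v. A (i # v)" "\<lambda>v. S (i # v)"] wt_pos[of i] that by simp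
    then show ?thesis by (simp add: ev_add_left ev_scale_left)
  qed
  have "ev n m (\<lambda>w. conv w A B) S = A [] * (B [] * S [] + (\<Sum>i\<in>?I. ev n (m - wt i) (\<lambda>v. B (i # v)) (\<lambda>v. S (i # v))))
    + (\<Sum>i\<in>?I. ev n (m - wt i) (\<lambda>v. A (i # v)) (\<lambda>v. ev n (m - wt i - weight v) B (\<lambda>v'. S (i # v @ v'))))"
    unfolding ev.simps[of n m "\<lambda>w. conv w A B"]
    by (subst sum.cong[OF refl step]) (simp_all add: sum.distrib sum_distrib_left distrib_left)
  also have "B [] * S [] + (\<Sum>i\<in>?I. ev n (m - wt i) (\<lambda>v. B (i # v)) (\<lambda>v. S (i # v))) = ev n m B S"
    by (rule ev.simps[of n m B S, symmetric])
  also have "A [] * ev n m B S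
    + (\<Sum>i\<in>?I. ev n (m - wt i) (\<lambda>v. A (i # v)) (\<lambda>v. ev n (m - wt i - weight v) B (\<lambda>v'. S (i # v @ v'))))
    = ev n m A (\<lambda>v. ev n (m - weight v) B (\<lambda>v'. S (v @ v')))"
    by (simp add: ev.simps[of n m A])
  finally show ?case .
qed

lemma ev_zero_right [simp]: "ev n m A (\<lambda>_. 0) = 0"
proof (induction m arbitrary: A rule: less_induct)
  case (less m)
  then show ?case by (simp add: ev.simps[of n m])
qed

lemma ev_one: "ev n m (cf 1) S = S []"
  by (subst ev.simps) simp

lemma ev_mono: "set w \<subseteq> {0..n} \<Longrightarrow> weight w \<le> m \<Longrightarrow> ev n m (cf (wmono c w)) S = c * S w"
proof (induction w arbitrary: m S)
  case Nil
  show ?case by (subst ev.simps) simp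
next
  case (Cons i w)
  have "(\<Sum>j | j \<le> n \<and> wt j \<le> m. ev n (m - wt j) (\<lambda>v. cf (wmono c (i # w)) (j # v)) (\<lambda>v. S (j # v)))
     = (\<Sum>j | j \<le> n \<and> wt j \<le> m. if j = i then ev n (m - wt i) (cf (wmono c w)) (\<lambda>v. S (i # v)) else 0)"
    by (intro sum.cong) (auto simp: fun_eq_iff intro!: arg_cong2[of _ _ _ _ "ev n (m - wt i)"])
  also have "\<dots> = ev n (m - wt i) (cf (wmono c w)) (\<lambda>v. S (i # v))"
    using Cons.prems by (subst sum.delta) auto
  also have "\<dots> = c * S (i # w)"
    using Cons.prems by (intro Cons.IH) auto
  finally show ?case by (subst ev.simps) simp
qed

text \<open>The upper limit \<open>m div wt i\<close> is the largest power of the letter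
  \<open>i\<close> whose weight is at most \<open>m\<close>.\<close>

lemma ev_powers:
  assumes "i \<le> n"
  shows "ev n m (\<lambda>w. if w = replicate (length w) i then c (length w) else 0) S
    = (\<Sum>k\<le>m div wt i. c k * S (replicate k i))"
proof (induction m arbitrary: c S rule: less_induct)
  case (less m)
  let ?A = "\<lambda>c w. if w = replicate (length w) i then c (length w) else 0"
  have "(\<Sum>j | j \<le> n \<and> wt j \<le> m. ev n (m - wt j) (\<lambda>v. ?A c (j # v)) (\<lambda>v. S (j # v)))
     = (\<Sum>j | j \<le> n \<and> wt j \<le> m. if j = i then ev n (m - wt i) (?A (\<lambda>k. c (Suc k))) (\<lambda>v. S (i # v)) else 0)"
    by (intro sum.cong) (auto simp: fun_eq_iff intro!: arg_cong2[of _ _ _ _ "ev n (m - wt i)"])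
  also have "\<dots> = (if wt i \<le> m then ev n (m - wt i) (?A (\<lambda>k. c (Suc k))) (\<lambda>v. S (i # v)) else 0)"
    using assms by (subst sum.delta) auto
  also have "\<dots> = (if wt i \<le> m then (\<Sum>k\<le>(m - wt i) div wt i. c (Suc k) * S (replicate (Suc k) i)) else 0)"
    using less[of "m - wt i" "\<lambda>k. c (Suc k)" "\<lambda>v. S (i # v)"] by (simp only: diff_wt_less replicate_Suc cong: if_cong)
  finally have *: "ev n m (?A c) S = c 0 * S [] + \<dots>"
    by (subst ev.simps[of n m "?A c" S]) (simp only: replicate_0 list.size if_True simp_thms)
  show ?case
  proof (cases "wt i \<le> m")
    case True
    then have "m div wt i = Suc ((m - wt i) div wt i)" by (simp add: le_div_geq)
    then have "(\<Sum>k\<le>m div wt i. c k * S (replicate k i)) =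
       c 0 * S [] + (\<Sum>k\<le>(m - wt i) div wt i. c (Suc k) * S (replicate (Suc k) i))"
      by (simp only: sum.atMost_Suc_shift replicate_0)
    then show ?thesis unfolding * if_P[OF True] by (rule sym)
  next
    case False
    then have "m div wt i = 0" by simp
    then show ?thesis unfolding * if_not_P[OF False] by simp
  qed
qed

text \<open>The factor in front of \<open>B\<close> is the total absolute mass of the coefficients
  up to weight \<open>m\<close>. The comparison is asked only where \<open>A w\<close> is nonzero,
  so that a series of high order profits from the smallness of the values at heavy words.\<close>

lemma ev_bound:
  assumes "\<And>w. set w \<subseteq> {0..n} \<Longrightarrow> weight w \<le> m \<Longrightarrow> A w \<noteq> 0 \<Longrightarrow> \<bar>S w - S' w\<bar> \<le> B"
  shows "\<bar>ev n m A S - ev n m A S'\<bar> \<le> ev n m (\<lambda>w. \<bar>A w\<bar>) (\<lambda>_. 1) * B"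
  using assms
proof (induction m arbitrary: A S S' rule: less_induct)
  case (less m)
  let ?I = "{i. i \<le> n \<and> wt i \<le> m}"
  have "\<bar>ev n m A S - ev n m A S'\<bar> = \<bar>A [] * (S [] - S' []) + (\<Sum>i\<in>?I. ev n (m - wt i) (\<lambda>v. A (i # v)) (\<lambda>v. S (i # v)) - ev n (m - wt i) (\<lambda>v. A (i # v)) (\<lambda>v. S' (i # v)))\<bar>"
    by (simp add: ev.simps[of n m A] algebra_simps sum_subtractf)
  also have "\<dots> \<le> \<bar>A []\<bar> * \<bar>S [] - S' []\<bar> + (\<Sum>i\<in>?I. \<bar>ev n (m - wt i) (\<lambda>v. A (i # v)) (\<lambda>v. S (i # v)) - ev n (m - wt i) (\<lambda>v. A (i # v)) (\<lambda>v. S' (i # v))\<bar>)"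
    by (rule order_trans[OF abs_triangle_ineq add_mono]) (auto simp: abs_mult)
  also have "\<dots> \<le> \<bar>A []\<bar> * B + (\<Sum>i\<in>?I. ev n (m - wt i) (\<lambda>v. \<bar>A (i # v)\<bar>) (\<lambda>_. 1) * B)"
  proof (intro add_mono sum_mono)
    show "\<bar>A []\<bar> * \<bar>S [] - S' []\<bar> \<le> \<bar>A []\<bar> * B"
      using less.prems[of "[]"] by (cases "A [] = 0") auto
    fix i assume "i \<in> ?I"
    then show "\<bar>ev n (m - wt i) (\<lambda>v. A (i # v)) (\<lambda>v. S (i # v)) - ev n (m - wt i) (\<lambda>v. A (i # v)) (\<lambda>v. S' (i # v))\<bar> \<le> ev n (m - wt i) (\<lambda>v. \<bar>A (i # v)\<bar>) (\<lambda>_. 1) * B"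
      using wt_pos[of i] by (intro less.IH less.prems) auto
  qed
  also have "\<dots> = ev n m (\<lambda>w. \<bar>A w\<bar>) (\<lambda>_. 1) * B"
    by (simp add: ev.simps[of n m "\<lambda>w. \<bar>A w\<bar>"] distrib_right sum_distrib_right)
  finally show ?case .
qed

section \<open>Concatenation of curves\<close>

lemma has_vector_derivative_reparam:
  assumes "(\<phi> has_vector_derivative v) (at (g t))" "(g has_real_derivative m) (at t)"
  shows "((\<lambda>s. \<phi> (g s)) has_vector_derivative m *\<^sub>R v) (at t)"
  using vector_diff_chain_at[of g m t \<phi> v] assms
  by (simp add: o_def has_real_derivative_iff_has_vector_derivative)

lemma vector_derivative_lipschitz:
  fixes \<psi> :: "real \<Rightarrow> 'a::real_normed_vector"
  assumes "\<And>s. s \<in> {a..b} \<Longrightarrow> (\<psi> has_vector_derivative g s) (at s within {a..b})"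
    and "\<And>s. s \<in> {a..b} \<Longrightarrow> norm (g s) \<le> B" and "u \<in> {a..b}" "v \<in> {a..b}"
  shows "norm (\<psi> u - \<psi> v) \<le> B * \<bar>u - v\<bar>"
proof -
  have "norm (\<psi> u - \<psi> v) \<le> B * norm (u - v)"
  proof (rule differentiable_bound[of "{a..b}" \<psi> "\<lambda>s h. h *\<^sub>R g s"])
    show "onorm (\<lambda>h. h *\<^sub>R g s) \<le> B" if "s \<in> {a..b}" for s
      using mult_left_mono[OF assms(2)[OF that] abs_ge_zero]
      by (intro onorm_le) (simp add: mult.commute)
  qed (use assms in \<open>auto simp: has_vector_derivative_def\<close>)
  then show ?thesis by simp
qed

text \<open>Picard iteration, for curves that are continued constantly outside of the unit interval.\<close>

lemma flow_exists:
  fixes F :: "'a::euclidean_space \<Rightarrow> 'a"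
  assumes "0 \<le> L" "L < 1" "\<And>x y. norm (F x - F y) \<le> L * norm (x - y)"
  obtains \<psi> where "\<psi> 0 = z" "\<And>s. s \<in> {0..1} \<Longrightarrow> (\<psi> has_vector_derivative F (\<psi> s)) (at s within {0..1})"
proof -
  define c :: "real \<Rightarrow> real" where "c s = max 0 (min 1 s)" for s
  have c: "c s \<in> {0..1}" "s \<in> {0..1} \<Longrightarrow> c s = s" for s by (auto simp: c_def)
  have contF: "continuous_on S F" for S
    by (rule lipschitz_on_continuous_on[of L])
       (use assms in \<open>auto intro!: lipschitz_onI simp: dist_norm\<close>)
  define G :: "(real \<Rightarrow>\<^sub>C 'a) \<Rightarrow> real \<Rightarrow> 'a" where "G \<psi> s = z + integral {0..c s} (\<lambda>u. F (\<psi> u))" for \<psi> s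
  have contF\<psi>: "continuous_on S (\<lambda>u. F (apply_bcontfun \<psi> u))" for S \<psi>
    by (intro continuous_on_compose2[OF contF[of UNIV]]) auto
  have G: "G \<psi> \<in> bcontfun" for \<psi>
  proof -
    have cont: "continuous_on {0..1} (\<lambda>s. integral {0..s} (\<lambda>u. F (\<psi> u)))"
      by (intro indefinite_integral_continuous_1 integrable_continuous_real contF\<psi>)
    then have "bounded ((\<lambda>s. integral {0..s} (\<lambda>u. F (\<psi> u))) ` {0..1})"
      by (intro compact_imp_bounded compact_continuous_image) auto
    then obtain B where B: "\<And>s. s \<in> {0..1} \<Longrightarrow> norm (integral {0..s} (\<lambda>u. F (\<psi> u))) \<le> B"
      unfolding bounded_iff by blast
    have "continuous_on UNIV (\<lambda>s. integral {0..c s} (\<lambda>u. F (\<psi> u)))"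
      by (rule continuous_on_compose2[OF cont]) (use c in \<open>auto simp: c_def intro!: continuous_intros\<close>)
    then show ?thesis unfolding G_def
      using B[OF c(1)] by (intro bcontfun_normI[of _ "norm z + B"] continuous_intros order_trans[OF norm_triangle_ineq add_left_mono])
  qed
  define P where "P \<psi> = Bcontfun (G \<psi>)" for \<psi>
  have P: "apply_bcontfun (P \<psi>) = G \<psi>" for \<psi>
    using G by (simp add: P_def Bcontfun_inverse)
  \<comment> \<open>On an interval of unit length the Lipschitz constant of \<open>F\<close> is
    itself the contraction factor; later applications make it less than 1 by choosing the flow time
    small.\<close>
  have "dist (P \<psi>) (P \<xi>) \<le> L * dist \<psi> \<xi>" for \<psi> \<xi>
  proof (rule dist_bound)
    fix s
    have "G \<psi> s - G \<xi> s = integral {0..c s} (\<lambda>u. F (\<psi> u) - F (\<xi> u))"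
      by (simp add: G_def Henstock_Kurzweil_Integration.integral_diff integrable_continuous_real contF\<psi>)
    also have "norm \<dots> \<le> (L * dist \<psi> \<xi>) * (c s - 0)"
    proof (rule integral_bound)
      fix u
      have "norm (F (\<psi> u) - F (\<xi> u)) \<le> L * dist (\<psi> u) (\<xi> u)" using assms(3) by (simp add: dist_norm)
      also have "\<dots> \<le> L * dist \<psi> \<xi>" using assms(1) by (intro mult_left_mono dist_bounded)
      finally show "norm (F (\<psi> u) - F (\<xi> u)) \<le> L * dist \<psi> \<xi>" .
    qed (use c in \<open>auto intro!: continuous_intros contF\<psi>\<close>)
    also have "\<dots> \<le> L * dist \<psi> \<xi> * 1"
      using c(1)[of s] assms(1) by (intro mult_left_mono) auto
    finally show "dist (P \<psi> s) (P \<xi> s) \<le> L * dist \<psi> \<xi>" by (simp add: P dist_norm)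
  qed
  then obtain \<psi> where "P \<psi> = \<psi>" using banach_fix_type[OF assms(1,2), of P] by auto
  then have \<psi>: "apply_bcontfun \<psi> = G \<psi>" using P by metis
  show ?thesis
  proof (rule that[of "apply_bcontfun \<psi>"])
    show "\<psi> 0 = z" using fun_cong[OF \<psi>, of 0] c(2)[of 0] by (simp add: G_def)
    fix s :: real assume s: "s \<in> {0..1}"
    have "((\<lambda>s. z + integral {0..s} (\<lambda>u. F (\<psi> u))) has_vector_derivative 0 + F (\<psi> s)) (at s within {0..1})"
      by (intro derivative_intros integral_has_vector_derivative contF\<psi> s)
    moreover have "\<psi> t = z + integral {0..t} (\<lambda>u. F (\<psi> u))" if "t \<in> {0..1}" for t
      using fun_cong[OF \<psi>, of t] c(2)[OF that] by (simp add: G_def)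
    ultimately show "(\<psi> has_vector_derivative F (\<psi> s)) (at s within {0..1})"
      using s by (subst has_vector_derivative_cong_ev)
        (auto intro!: eventually_mono[OF eventually_True] simp del: UNIV_I)
  qed
qed

text \<open>
  Curves run at time-dependent speed on an interval of length \<open>T\<close> and rest outside of it, so that
  \<open>T\<close> is additive under concatenation; rescaling \<open>[0, \<delta>]\<close> to \<open>[0, 1]\<close> turns the control bounds
  \<open>\<bar>a 0\<bar> \<le> \<delta>\<close>, \<open>\<bar>a i\<bar> \<le> 1\<close> into \<open>\<delta>\<^sup>2\<close>, \<open>\<delta>\<close>.
\<close>

definition curve :: "(real^'p) set \<Rightarrow> nat \<Rightarrow> (nat \<Rightarrow> real^'p \<Rightarrow> real^'p) \<Rightarrow> real \<Rightarrow> real \<Rightarrow> real \<Rightarrow> real^'p \<Rightarrow> real^'p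
    \<Rightarrow> (real \<Rightarrow> real^'p) \<Rightarrow> (nat \<Rightarrow> real \<Rightarrow> real) \<Rightarrow> bool" where
  "curve \<Omega> n X M D T x y \<phi> a \<longleftrightarrow>
     (\<forall>t\<le>0. \<phi> t = x) \<and> (\<forall>t\<ge>T. \<phi> t = y) \<and> range \<phi> \<subseteq> \<Omega> \<and>
     (\<forall>s t. norm (\<phi> s - \<phi> t) \<le> M * (1 + D) * \<bar>s - t\<bar>) \<and>
     (\<forall>i\<le>n. a i \<in> borel_measurable borel) \<and>
     (\<forall>t. \<bar>a 0 t\<bar> \<le> D \<and> (\<forall>i\<in>{1..n}. \<bar>a i t\<bar> \<le> 1)) \<and>
     (\<exists>C. countable C \<and> (\<forall>t. t \<notin> C \<longrightarrow> (\<phi> has_vector_derivative (\<Sum>i\<le>n. a i t *\<^sub>R X i (\<phi> t))) (at t)))"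

text \<open>Durations \<open>T\<close> add up under concatenation, but the drift bound
  \<open>D\<close> holds along the whole curve and must be raised to a common value before pieces
  are joined. \<open>within_cost\<close> puts both equal, as the control distance requires.\<close>

definition reach :: "(real^'p) set \<Rightarrow> nat \<Rightarrow> (nat \<Rightarrow> real^'p \<Rightarrow> real^'p) \<Rightarrow> real \<Rightarrow> real \<Rightarrow> real \<Rightarrow> real^'p \<Rightarrow> real^'p \<Rightarrow> bool" where
  "reach \<Omega> n X M D T x y \<longleftrightarrow> 0 \<le> T \<and> (\<exists>\<phi> a. curve \<Omega> n X M D T x y \<phi> a)"

lemma curve_const:
  assumes "x \<in> \<Omega>" "0 \<le> D" "0 \<le> M"
  shows "curve \<Omega> n X M D 0 x x (\<lambda>_. x) (\<lambda>_ _. 0)"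
  unfolding curve_def using assms by auto

definition glue :: "real \<Rightarrow> (real \<Rightarrow> 'b) \<Rightarrow> (real \<Rightarrow> 'b) \<Rightarrow> real \<Rightarrow> 'b" where
  "glue T f g t = (if t \<le> T then f t else g (t - T))"

lemma curve_glue:
  assumes c1: "curve \<Omega> n X M D T1 x y \<phi> a" and c2: "curve \<Omega> n X M D T2 y z \<psi> b" and "0 \<le> T1" "0 \<le> T2"
  shows "curve \<Omega> n X M D (T1 + T2) x z (glue T1 \<phi> \<psi>) (\<lambda>i. glue T1 (a i) (b i))"
  unfolding curve_def
proof (intro conjI allI impI)
  let ?f = "glue T1 \<phi> \<psi>" and ?K = "M * (1 + D)"
  have lip: "norm (\<phi> s - \<phi> t) \<le> ?K * \<bar>s - t\<bar>" "norm (\<psi> s - \<psi> t) \<le> ?K * \<bar>s - t\<bar>" for s t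
    using c1 c2 by (auto simp: curve_def)
  have y: "\<phi> T1 = y" "\<psi> 0 = y" using c1 c2 by (auto simp: curve_def)
  show "?f t = x" if "t \<le> 0" for t using that c1 \<open>0 \<le> T1\<close> by (auto simp: glue_def curve_def)
  show "?f t = z" if "t \<ge> T1 + T2" for t
    using that c1 c2 \<open>0 \<le> T2\<close> y by (auto simp: glue_def curve_def)
  show "range ?f \<subseteq> \<Omega>" using c1 c2 by (auto simp: glue_def curve_def)
  have *: "norm (?f s - ?f t) \<le> ?K * (t - s)" if "s \<le> t" for s t
  proof (cases "s \<le> T1 \<and> T1 < t")
    case True
    then have "?f s - ?f t = (\<phi> s - \<phi> T1) + (\<psi> 0 - \<psi> (t - T1))" by (simp add: glue_def y)
    also have "norm \<dots> \<le> ?K * (T1 - s) + ?K * (t - T1)"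
      using lip(1)[of s T1] lip(2)[of 0 "t - T1"] True by (intro norm_triangle_mono) auto
    finally show ?thesis by (simp add: algebra_simps)
  next
    case False
    then show ?thesis using that lip(1)[of s t] lip(2)[of "s - T1" "t - T1"] by (auto simp: glue_def)
  qed
  show "norm (?f s - ?f t) \<le> ?K * \<bar>s - t\<bar>" for s t
    using *[of s t] *[of t s] by (cases "s \<le> t") (auto simp: norm_minus_commute)
  show "glue T1 (a i) (b i) \<in> borel_measurable borel" if "i \<le> n" for i
  proof -
    have [measurable]: "a i \<in> borel_measurable borel" "b i \<in> borel_measurable borel"
      using c1 c2 that by (auto simp: curve_def)
    show ?thesis unfolding glue_def[abs_def] by measurable
  qed
  show "\<bar>glue T1 (a 0) (b 0) t\<bar> \<le> D" for t using c1 c2 by (auto simp: curve_def glue_def)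
  show "\<forall>i\<in>{1..n}. \<bar>glue T1 (a i) (b i) t\<bar> \<le> 1" for t using c1 c2 by (auto simp: curve_def glue_def)
  obtain C1 where C1: "countable C1" "\<And>t. t \<notin> C1 \<Longrightarrow> (\<phi> has_vector_derivative (\<Sum>i\<le>n. a i t *\<^sub>R X i (\<phi> t))) (at t)"
    using c1 by (auto simp: curve_def)
  obtain C2 where C2: "countable C2" "\<And>t. t \<notin> C2 \<Longrightarrow> (\<psi> has_vector_derivative (\<Sum>i\<le>n. b i t *\<^sub>R X i (\<psi> t))) (at t)"
    using c2 by (auto simp: curve_def)
  have "(?f has_vector_derivative (\<Sum>i\<le>n. glue T1 (a i) (b i) t *\<^sub>R X i (?f t))) (at t)"
    if t: "t \<notin> insert T1 (C1 \<union> (\<lambda>s. s + T1) ` C2)" for t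
  proof (cases "t < T1")
    case True
    then show ?thesis using C1(2)[of t] t
      by - (rule has_vector_derivative_transform_within_open[of \<phi> _ t "{..<T1}"], (auto simp: glue_def))
  next
    case False
    then have "t > T1" using t by auto
    have "t - T1 \<notin> C2" using t by (auto simp: image_iff)
    then have "((\<lambda>s. \<psi> (s - T1)) has_vector_derivative (\<Sum>i\<le>n. b i (t - T1) *\<^sub>R X i (\<psi> (t - T1)))) (at t)"
      using has_vector_derivative_reparam[where g = "\<lambda>s. s - T1" and m = 1 and t = t, OF C2(2)]
      by (simp add: DERIV_diff[OF DERIV_ident DERIV_const, simplified])
    then show ?thesis using \<open>t > T1\<close>
      by - (rule has_vector_derivative_transform_within_open[of "\<lambda>s. \<psi> (s - T1)" _ t "{T1<..}"], (auto simp: glue_def))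
  qed
  then show "\<exists>C. countable C \<and> (\<forall>t. t \<notin> C \<longrightarrow> (?f has_vector_derivative (\<Sum>i\<le>n. glue T1 (a i) (b i) t *\<^sub>R X i (?f t))) (at t))"
    using C1(1) C2(1) by (intro exI[of _ "insert T1 (C1 \<union> (\<lambda>s. s + T1) ` C2)"]) auto
qed

lemma reach_refl: "x \<in> \<Omega> \<Longrightarrow> 0 \<le> D \<Longrightarrow> 0 \<le> M \<Longrightarrow> reach \<Omega> n X M D 0 x x"
  unfolding reach_def using curve_const by blast

lemma reach_trans:
  "reach \<Omega> n X M D T1 x y \<Longrightarrow> reach \<Omega> n X M D T2 y z \<Longrightarrow> reach \<Omega> n X M D (T1 + T2) x z"
  unfolding reach_def using curve_glue[of \<Omega> n X M D T1 x y _ _ T2 z] by (elim conjE exE) (auto, blast)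

lemma reach_mono:
  assumes "reach \<Omega> n X M D T x y" "D \<le> D'" "T \<le> T'" "0 \<le> M"
  shows "reach \<Omega> n X M D' T' x y"
proof -
  obtain \<phi> a where c: "curve \<Omega> n X M D T x y \<phi> a" and "0 \<le> T" using assms by (auto simp: reach_def)
  have le: "M * (1 + D) * \<bar>s - t\<bar> \<le> M * (1 + D') * \<bar>s - t\<bar>" for s t
    using assms by (intro mult_right_mono mult_left_mono) auto
  have "curve \<Omega> n X M D' T' x y \<phi> a"
    unfolding curve_def
  proof (intro conjI allI impI)
    show "norm (\<phi> s - \<phi> t) \<le> M * (1 + D') * \<bar>s - t\<bar>" for s t
      using c le[of s t] order_trans unfolding curve_def by blast
    show "\<bar>a 0 t\<bar> \<le> D'" for t using c assms(2) order_trans unfolding curve_def by blast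
  qed (use c assms(3) in \<open>auto simp: curve_def\<close>)
  then show ?thesis using \<open>0 \<le> T\<close> assms(3) by (auto simp: reach_def)
qed

lemma reach_in: "reach \<Omega> n X M D T x y \<Longrightarrow> x \<in> \<Omega> \<and> y \<in> \<Omega>"
  unfolding reach_def curve_def by (metis order_refl rangeI subsetD)

lemma lipschitz_abs_continuous:
  assumes "\<And>s t. norm (f s - f t) \<le> K * \<bar>s - t\<bar>"
  shows "abs_continuous_on_interval a b f"
  unfolding abs_continuous_on_interval_def
proof (intro allI impI)
  fix e :: real assume "e > 0"
  show "\<exists>\<eta>>0. \<forall>(N::nat) s t. (\<forall>k<N. a \<le> s k \<and> s k \<le> t k \<and> t k \<le> b) \<longrightarrow>
        disjoint_family_on (\<lambda>k. {s k<..<t k}) {..<N} \<longrightarrow>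
        (\<Sum>k<N. t k - s k) < \<eta> \<longrightarrow> (\<Sum>k<N. norm (f (t k) - f (s k))) < e"
  proof (intro exI[of _ "e / (\<bar>K\<bar> + 1)"] conjI allI impI)
    fix N :: nat and s t :: "nat \<Rightarrow> real"
    assume st: "\<forall>k<N. a \<le> s k \<and> s k \<le> t k \<and> t k \<le> b" and "(\<Sum>k<N. t k - s k) < e / (\<bar>K\<bar> + 1)"
    have "(\<Sum>k<N. norm (f (t k) - f (s k))) \<le> (\<Sum>k<N. (\<bar>K\<bar> + 1) * (t k - s k))"
    proof (rule sum_mono)
      fix k assume "k \<in> {..<N}"
      have "norm (f (t k) - f (s k)) \<le> K * \<bar>t k - s k\<bar>" by (rule assms)
      also have "\<dots> \<le> (\<bar>K\<bar> + 1) * \<bar>t k - s k\<bar>" by (intro mult_right_mono) auto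
      finally show "norm (f (t k) - f (s k)) \<le> (\<bar>K\<bar> + 1) * (t k - s k)" using st \<open>k \<in> _\<close> by auto
    qed
    also have "\<dots> = (\<bar>K\<bar> + 1) * (\<Sum>k<N. t k - s k)" by (simp add: sum_distrib_left)
    also have "\<dots> < (\<bar>K\<bar> + 1) * (e / (\<bar>K\<bar> + 1))"
      by (intro mult_strict_left_mono \<open>(\<Sum>k<N. t k - s k) < _\<close>) auto
    also have "\<dots> = e" by (simp add: field_simps add_nonneg_eq_0_iff)
    finally show "(\<Sum>k<N. norm (f (t k) - f (s k))) < e" .
  qed (use \<open>e > 0\<close> in \<open>auto intro!: divide_pos_pos add_nonneg_pos\<close>)
qed

lemma reach_control_dist:
  assumes "reach \<Omega> n X M D T x y" "0 < D" "T \<le> D"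
  shows "control_dist \<Omega> n X x y \<le> ereal D"
proof -
  obtain \<phi> a where c: "curve \<Omega> n X M D T x y \<phi> a" and "0 \<le> T" using assms by (auto simp: reach_def)
  obtain C where C: "countable C" "\<And>t. t \<notin> C \<Longrightarrow> (\<phi> has_vector_derivative (\<Sum>i\<le>n. a i t *\<^sub>R X i (\<phi> t))) (at t)"
    using c by (auto simp: curve_def)
  define \<psi> where "\<psi> t = \<phi> (D * t)" for t
  define b where "b i t = D * a i (D * t)" for i t
  have "norm (\<psi> s - \<psi> t) \<le> (M * (1 + D) * D) * \<bar>s - t\<bar>" for s t
  proof -
    have "norm (\<psi> s - \<psi> t) \<le> M * (1 + D) * \<bar>D * s - D * t\<bar>"
      using c unfolding curve_def \<psi>_def by blast
    also have "\<bar>D * s - D * t\<bar> = D * \<bar>s - t\<bar>"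
      using \<open>0 < D\<close> by (simp add: abs_mult flip: right_diff_distrib)
    finally show ?thesis by (simp add: mult.assoc)
  qed
  then have "abs_continuous_on_interval 0 1 \<psi>" by (rule lipschitz_abs_continuous)
  moreover have "\<psi> ` {0..1} \<subseteq> \<Omega>" using c by (auto simp: curve_def \<psi>_def)
  moreover have "b i \<in> borel_measurable (lebesgue_on {0..1})" if "i \<le> n" for i
  proof -
    have [measurable]: "a i \<in> borel_measurable borel" using c that by (auto simp: curve_def)
    have "b i \<in> borel_measurable borel" unfolding b_def[abs_def] by measurable
    then show ?thesis by (intro measurable_restrict_space1) (simp add: measurable_completion)
  qed
  moreover have "\<bar>b 0 t\<bar> \<le> D\<^sup>2 \<and> (\<forall>i\<in>{1..n}. \<bar>b i t\<bar> \<le> D)" for t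
    using c \<open>0 < D\<close> by (auto simp: curve_def b_def abs_mult power2_eq_square)
  moreover have "AE t in lebesgue_on {0..1}. (\<psi> has_vector_derivative (\<Sum>i\<le>n. b i t *\<^sub>R X i (\<psi> t))) (at t within {0..1})"
  proof -
    let ?N = "(\<lambda>t. t / D) ` C"
    have "?N \<in> null_sets lebesgue" using C(1) by (intro null_sets_completionI countable_imp_null_set_lborel) auto
    then have "AE t in lebesgue. t \<notin> ?N" by (rule AE_not_in)
    then have "AE t in lebesgue. t \<in> {0..1} \<longrightarrow> (\<psi> has_vector_derivative (\<Sum>i\<le>n. b i t *\<^sub>R X i (\<psi> t))) (at t within {0..1})"
    proof (rule eventually_mono, intro impI)
      fix t assume "t \<notin> ?N"
      then have "D * t \<notin> C" using \<open>0 < D\<close> by (auto simp: image_iff)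
      then have "(\<psi> has_vector_derivative D *\<^sub>R (\<Sum>i\<le>n. a i (D * t) *\<^sub>R X i (\<phi> (D * t)))) (at t)"
        unfolding \<psi>_def by (intro has_vector_derivative_reparam[where g = "\<lambda>s. D * s"] C(2)) (auto intro!: derivative_eq_intros)
      then show "(\<psi> has_vector_derivative (\<Sum>i\<le>n. b i t *\<^sub>R X i (\<psi> t))) (at t within {0..1})"
        by (auto simp: b_def \<psi>_def[symmetric] scaleR_sum_right intro: has_vector_derivative_at_within)
    qed
    then show ?thesis by (subst AE_restrict_space_iff) auto
  qed
  ultimately have "\<psi> \<in> admissible_curves \<Omega> n X D"
    unfolding admissible_curves_def by blast
  moreover have "\<psi> 0 = x" "\<psi> 1 = y" using c \<open>T \<le> D\<close> by (auto simp: curve_def \<psi>_def)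
  ultimately show ?thesis unfolding control_dist_def using \<open>0 < D\<close> by (intro Inf_lower) blast
qed

text \<open>The curves glued from the first k pieces agree with all later ones up to time
  \<open>s k\<close>, so they converge pointwise. The common Lipschitz constant and measurability
  pass to the limit, and the exceptional set remains countable. Only the time
  \<open>suminf T\<close>, where infinitely many pieces may accumulate, is added to it.\<close>

lemma reach_limit:
  assumes pieces: "\<And>k. reach \<Omega> n X M D (T k) (x k) (x (Suc k))" and "summable T"
    and lim: "x \<longlonglongrightarrow> y" and y: "y \<in> \<Omega>" and D: "0 \<le> D" and "0 \<le> M"
  shows "reach \<Omega> n X M D (suminf T) (x 0) y"
proof -
  have T0: "T k \<ge> 0" for k using pieces by (auto simp: reach_def)
  obtain p c where pc: "\<And>k. curve \<Omega> n X M D (T k) (x k) (x (Suc k)) (p k) (c k)"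
    using pieces unfolding reach_def by metis
  define s where "s k = (\<Sum>j<k. T j)" for k
  have s_mono: "j \<le> k \<Longrightarrow> s j \<le> s k" for j k unfolding s_def using T0 by (intro sum_mono2) auto
  have s_lim: "s \<longlonglongrightarrow> suminf T" unfolding s_def using \<open>summable T\<close> by (rule summable_LIMSEQ)
  have s_le: "s k \<le> suminf T" for k unfolding s_def using \<open>summable T\<close> T0 by (intro sum_le_suminf) auto
  have s0: "s k \<ge> 0" for k unfolding s_def using T0 by (intro sum_nonneg) auto
  define \<Phi> where "\<Phi> = rec_nat (\<lambda>_. x 0) (\<lambda>k f. glue (s k) f (p k))"
  define \<alpha> where "\<alpha> = rec_nat (\<lambda>_ _. 0) (\<lambda>k f i. glue (s k) (f i) (c k i))"
  have rec: "\<Phi> 0 = (\<lambda>_. x 0)" "\<alpha> 0 = (\<lambda>_ _. 0)" "\<Phi> (Suc k) = glue (s k) (\<Phi> k) (p k)"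
     "\<alpha> (Suc k) = (\<lambda>i. glue (s k) (\<alpha> k i) (c k i))" for k by (auto simp: \<Phi>_def \<alpha>_def)
  have x0: "x 0 \<in> \<Omega>" using reach_in[OF pieces] by auto
  have curve_k: "curve \<Omega> n X M D (s k) (x 0) (x k) (\<Phi> k) (\<alpha> k)" for k
  proof (induction k)
    case 0
    show ?case using curve_const[OF x0 D \<open>0 \<le> M\<close>] by (simp add: rec s_def)
  next
    case (Suc k)
    show ?case using curve_glue[OF Suc pc s0 T0] unfolding rec by (simp add: s_def)
  qed
  have stable: "\<Phi> (k + j) t = \<Phi> k t" "\<alpha> (k + j) i t = \<alpha> k i t" if "t \<le> s k" for k j t i
    by (induction j) (use that s_mono[of k "k + j" for j] order_trans[OF that s_mono[of k "k + j" for j]] in \<open>auto simp: rec glue_def\<close>)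
  define idx where "idx t = (LEAST k. t \<le> s k)" for t
  \<comment> \<open>Times beyond all \<open>s k\<close> get the limit point \<open>y\<close>; this
    includes the accumulation time itself if it is not attained.\<close>
  define \<phi> where "\<phi> t = (if \<exists>k. t \<le> s k then \<Phi> (idx t) t else y)" for t
  define \<beta> where "\<beta> i t = (if \<exists>k. t \<le> s k then \<alpha> (idx t) i t else 0)" for i t
  have eq: "\<phi> t = \<Phi> k t" "\<beta> i t = \<alpha> k i t" if "t \<le> s k" for t k i
  proof -
    have "idx t \<le> k" "t \<le> s (idx t)" unfolding idx_def using that by (auto intro: Least_le LeastI)
    then show "\<phi> t = \<Phi> k t" "\<beta> i t = \<alpha> k i t"
      using stable[of t "idx t" "k - idx t"] that by (auto simp: \<phi>_def \<beta>_def)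
  qed
  have \<Phi>_end: "\<Phi> k t = x k" if "s k \<le> t" for k t using curve_k[of k] that by (auto simp: curve_def)
  have conv: "(\<lambda>k. \<Phi> k t) \<longlonglongrightarrow> \<phi> t" for t
  proof (cases "\<exists>k. t \<le> s k")
    case True
    then obtain k where k: "t \<le> s k" by auto
    have "\<Phi> j t = \<phi> t" if "k \<le> j" for j
      using eq(1)[OF order_trans[OF k s_mono[OF that]]] by simp
    then have "eventually (\<lambda>j. \<Phi> j t = \<phi> t) sequentially" by (rule eventually_sequentiallyI)
    then show ?thesis by (rule tendsto_eventually)
  next
    case False
    then have "\<phi> t = y" "\<Phi> k t = x k" for k by (auto simp: \<phi>_def intro!: \<Phi>_end) (metis linear)
    then show ?thesis using lim by simp
  qed
  have conv\<beta>: "(\<lambda>k. if t \<le> s k then \<alpha> k i t else 0) \<longlonglongrightarrow> \<beta> i t" for t i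
  proof (cases "\<exists>k. t \<le> s k")
    case True
    then obtain k where k: "t \<le> s k" by auto
    have "(if t \<le> s j then \<alpha> j i t else 0) = \<beta> i t" if "k \<le> j" for j
      using eq(2)[OF order_trans[OF k s_mono[OF that]]] order_trans[OF k s_mono[OF that]] by simp
    then have "eventually (\<lambda>j. (if t \<le> s j then \<alpha> j i t else 0) = \<beta> i t) sequentially"
      by (rule eventually_sequentiallyI)
    then show ?thesis by (rule tendsto_eventually)
  qed (auto simp: \<beta>_def)
  have before: "\<exists>k. t < s k" if "t < suminf T" for t
    using order_tendstoD(1)[OF s_lim that] by (auto simp: eventually_sequentially)
  have "\<forall>k. \<exists>C. countable C \<and> (\<forall>t. t \<notin> C \<longrightarrow>
      (\<Phi> k has_vector_derivative (\<Sum>i\<le>n. \<alpha> k i t *\<^sub>R X i (\<Phi> k t))) (at t))"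
    using curve_k by (simp add: curve_def)
  from choice[OF this] obtain C where "\<forall>k. countable (C k) \<and> (\<forall>t. t \<notin> C k \<longrightarrow>
      (\<Phi> k has_vector_derivative (\<Sum>i\<le>n. \<alpha> k i t *\<^sub>R X i (\<Phi> k t))) (at t))" ..
  then have C: "\<And>k. countable (C k)"
    "\<And>k t. t \<notin> C k \<Longrightarrow> (\<Phi> k has_vector_derivative (\<Sum>i\<le>n. \<alpha> k i t *\<^sub>R X i (\<Phi> k t))) (at t)"
    by simp_all
  have "curve \<Omega> n X M D (suminf T) (x 0) y \<phi> \<beta>"
    unfolding curve_def
  proof (intro conjI allI impI)
    show "\<phi> t = x 0" if "t \<le> 0" for t
      using eq(1)[of t 0] that by (simp add: s_def rec)
    show after: "\<phi> t = y" if "t \<ge> suminf T" for t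
    proof -
      have "\<Phi> k t = x k" for k using \<Phi>_end[of k t] s_le[of k] that by simp
      then show ?thesis using conv[of t] lim LIMSEQ_unique by simp
    qed
    show "range \<phi> \<subseteq> \<Omega>"
    proof
      fix z assume "z \<in> range \<phi>"
      then obtain t where t: "z = \<phi> t" by auto
      show "z \<in> \<Omega>"
      proof (cases "\<exists>k. t \<le> s k")
        case True
        then obtain k where "t \<le> s k" by auto
        then show ?thesis using eq(1)[of t k] curve_k[of k] t by (auto simp: curve_def)
      qed (use y t in \<open>auto simp: \<phi>_def\<close>)
    qed
    show "norm (\<phi> u - \<phi> v) \<le> M * (1 + D) * \<bar>u - v\<bar>" for u v
    proof (rule LIMSEQ_le_const2)
      show "(\<lambda>k. norm (\<Phi> k u - \<Phi> k v)) \<longlonglongrightarrow> norm (\<phi> u - \<phi> v)"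
        by (intro tendsto_intros conv)
      show "\<exists>N. \<forall>k\<ge>N. norm (\<Phi> k u - \<Phi> k v) \<le> M * (1 + D) * \<bar>u - v\<bar>"
        using curve_k by (auto simp: curve_def)
    qed
    show "\<beta> i \<in> borel_measurable borel" if "i \<le> n" for i
    proof (rule borel_measurable_LIMSEQ_real)
      show "(\<lambda>k. if t \<le> s k then \<alpha> k i t else 0) \<longlonglongrightarrow> \<beta> i t" for t by (rule conv\<beta>)
      show "(\<lambda>t. if t \<le> s k then \<alpha> k i t else 0) \<in> borel_measurable borel" for k
      proof -
        have [measurable]: "\<alpha> k i \<in> borel_measurable borel" using curve_k[of k] that by (auto simp: curve_def)
        show ?thesis by measurable
      qed
    qed
    show "\<bar>\<beta> 0 t\<bar> \<le> D" "\<forall>i\<in>{1..n}. \<bar>\<beta> i t\<bar> \<le> 1" for t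
      using curve_k D by (auto simp: \<beta>_def curve_def)
    have "(\<phi> has_vector_derivative (\<Sum>i\<le>n. \<beta> i t *\<^sub>R X i (\<phi> t))) (at t)"
      if t: "t \<notin> insert (suminf T) (\<Union>k. C k)" for t
    proof (cases "t < suminf T")
      case True
      then obtain k where k: "t < s k" using before by auto
      have "(\<Phi> k has_vector_derivative (\<Sum>i\<le>n. \<alpha> k i t *\<^sub>R X i (\<Phi> k t))) (at t)" using C(2) t by auto
      then show ?thesis using k eq[of _ k]
        by - (rule has_vector_derivative_transform_within_open[of "\<Phi> k" _ t "{..<s k}"], auto)
    next
      case False
      then have t: "t > suminf T" using t by auto
      then have "\<beta> i t = 0" for i unfolding \<beta>_def using le_less_trans[OF s_le t] by (metis not_le)
      moreover have "((\<lambda>_. y) has_vector_derivative 0) (at t)" by simp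
      ultimately show ?thesis using t after
        by - (rule has_vector_derivative_transform_within_open[of "\<lambda>_. y" _ t "{suminf T<..}"], auto)
    qed
    then show "\<exists>C. countable C \<and> (\<forall>t. t \<notin> C \<longrightarrow> (\<phi> has_vector_derivative (\<Sum>i\<le>n. \<beta> i t *\<^sub>R X i (\<phi> t))) (at t))"
      using C(1) by (intro exI[of _ "insert (suminf T) (\<Union>k. C k)"]) auto
  qed
  then show ?thesis using suminf_nonneg[OF \<open>summable T\<close> T0] by (auto simp: reach_def)
qed

text \<open>The unit-time flow with factor \<open>t ^ wt i\<close> is stretched to duration
  \<open>t\<close>, so the control becomes \<open>t ^ (wt i - 1)\<close>: 1 for an ordinary field,
  \<open>t\<close> for the drift, whence \<open>t \<le> D\<close>. Only one field is active at a
  time, so the speed is at most \<open>M\<close>, within the Lipschitz constant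
  \<open>M * (1 + D)\<close>.\<close>

lemma reach_flow:
  fixes X :: "nat \<Rightarrow> real^'p \<Rightarrow> real^'p"
  assumes "i \<le> n" "0 < t" "t \<le> D" "t \<le> 1" and \<sigma>: "\<bar>\<sigma>\<bar> = 1" and M: "\<And>x. x \<in> \<Omega> \<Longrightarrow> norm (X i x) \<le> M"
    and flow: "\<And>s. s \<in> {0..1} \<Longrightarrow> (\<psi> has_vector_derivative (\<sigma> * t ^ wt i) *\<^sub>R X i (\<psi> s)) (at s within {0..1})"
    and in\<Omega>: "\<psi> ` {0..1} \<subseteq> \<Omega>"
  shows "reach \<Omega> n X M D t (\<psi> 0) (\<psi> 1)"
proof -
  define c :: "real \<Rightarrow> real" where "c s = max 0 (min 1 s)" for s
  have c: "c s \<in> {0..1}" "s \<in> {0..1} \<Longrightarrow> c s = s" "\<bar>c u - c v\<bar> \<le> \<bar>u - v\<bar>" for s u v by (auto simp: c_def)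
  define \<phi> where "\<phi> s = \<psi> (c (s / t))" for s
  define a where "a j s = (if j = i \<and> 0 < s \<and> s < t then \<sigma> * t ^ (wt i - 1) else 0)" for j s
  have wt: "t ^ wt i = t * t ^ (wt i - 1)" by (simp add: wt_def power2_eq_square)
  have M0: "0 \<le> M" using order_trans[OF norm_ge_zero M[of "\<psi> 0"]] in\<Omega> by (auto simp: image_subset_iff)
  have tt: "t ^ (wt i - 1) \<le> 1" using assms by (intro power_le_one) auto
  have "curve \<Omega> n X M D t (\<psi> 0) (\<psi> 1) \<phi> a"
    unfolding curve_def
  proof (intro conjI allI impI)
    show start: "\<phi> s = \<psi> 0" if "s \<le> 0" for s using that \<open>0 < t\<close> by (simp add: \<phi>_def c_def max_absorb1 min_def divide_nonpos_pos)
    show final: "\<phi> s = \<psi> 1" if "s \<ge> t" for s using that \<open>0 < t\<close> by (simp add: \<phi>_def c_def)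
    show "range \<phi> \<subseteq> \<Omega>" using in\<Omega> c(1) by (auto simp: \<phi>_def)
    show "norm (\<phi> u - \<phi> v) \<le> M * (1 + D) * \<bar>u - v\<bar>" for u v
    proof -
      have "norm (\<phi> u - \<phi> v) \<le> (t ^ wt i * M) * \<bar>c (u / t) - c (v / t)\<bar>"
        unfolding \<phi>_def
      proof (rule vector_derivative_lipschitz[OF flow])
        fix s :: real assume "s \<in> {0..1}"
        then show "norm ((\<sigma> * t ^ wt i) *\<^sub>R X i (\<psi> s)) \<le> t ^ wt i * M"
          using in\<Omega> M[OF subsetD[OF in\<Omega> imageI]] \<sigma> \<open>0 < t\<close> by (auto simp: abs_mult intro!: mult_left_mono)
      qed (use c in auto)
      also have "\<dots> \<le> (t ^ wt i * M) * \<bar>u / t - v / t\<bar>"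
        using M0 \<open>0 < t\<close> by (intro mult_left_mono c) auto
      also have "\<bar>u / t - v / t\<bar> = \<bar>u - v\<bar> / t" using \<open>0 < t\<close> by (simp add: diff_divide_distrib[symmetric])
      also have "(t ^ wt i * M) * (\<bar>u - v\<bar> / t) = M * t ^ (wt i - 1) * \<bar>u - v\<bar>" using \<open>0 < t\<close> by (simp add: wt)
      also have "\<dots> \<le> M * (1 + D) * \<bar>u - v\<bar>" using M0 tt assms by (intro mult_right_mono mult_left_mono) auto
      finally show ?thesis .
    qed
    show "a j \<in> borel_measurable borel" for j unfolding a_def[abs_def] by (cases "j = i") simp_all
    show "\<bar>a 0 s\<bar> \<le> D" for s using assms by (auto simp: a_def abs_mult wt_def)
    show "\<forall>j\<in>{1..n}. \<bar>a j s\<bar> \<le> 1" for s using \<sigma> tt \<open>0 < t\<close> by (auto simp: a_def abs_mult)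
    have "(\<phi> has_vector_derivative (\<Sum>j\<le>n. a j s *\<^sub>R X j (\<phi> s))) (at s)" if "s \<notin> {0, t}" for s
    proof -
      have sum: "(\<Sum>j\<le>n. a j s *\<^sub>R X j (\<phi> s)) = (if 0 < s \<and> s < t then (\<sigma> * t ^ (wt i - 1)) *\<^sub>R X i (\<phi> s) else 0)"
        using \<open>i \<le> n\<close> sum.delta[of "{..n}" i "\<lambda>j. if 0 < s \<and> s < t then (\<sigma> * t ^ (wt i - 1)) *\<^sub>R X j (\<phi> s) else 0"]
        by (auto simp: a_def if_distrib[of "\<lambda>r. r *\<^sub>R _"] cong: if_cong)
      consider "s < 0" | "s > t" | "0 < s" "s < t" using \<open>s \<notin> {0, t}\<close> by force
      then show ?thesis
      proof cases
        case 1
        have "((\<lambda>_. \<psi> 0) has_vector_derivative 0) (at s)" by simp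
        moreover have "\<phi> u = \<psi> 0" if "u < 0" for u using start that by simp
        ultimately show ?thesis using 1 unfolding sum
          by - (rule has_vector_derivative_transform_within_open[of "\<lambda>_. \<psi> 0" _ s "{..<0}"], auto)
      next
        case 2
        have "((\<lambda>_. \<psi> 1) has_vector_derivative 0) (at s)" by simp
        moreover have "\<phi> u = \<psi> 1" if "u > t" for u using final that by simp
        ultimately show ?thesis using 2 unfolding sum
          by - (rule has_vector_derivative_transform_within_open[of "\<lambda>_. \<psi> 1" _ s "{t<..}"], auto)
      next
        case 3
        have "s / t \<in> {0<..<1}" using 3 by (auto simp: field_simps)
        then have "(\<psi> has_vector_derivative (\<sigma> * t ^ wt i) *\<^sub>R X i (\<psi> (s / t))) (at (s / t))"
          using flow[of "s / t"] at_within_Icc_at[of 0 "s / t" 1] by auto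
        then have "((\<lambda>s. \<psi> (s / t)) has_vector_derivative (1 / t) *\<^sub>R (\<sigma> * t ^ wt i) *\<^sub>R X i (\<psi> (s / t))) (at s)"
          by (rule has_vector_derivative_reparam[where g = "\<lambda>s. s / t"]) (use \<open>0 < t\<close> in \<open>auto intro!: derivative_eq_intros\<close>)
        moreover have "(1 / t) *\<^sub>R (\<sigma> * t ^ wt i) *\<^sub>R X i (\<psi> (s / t)) = (\<sigma> * t ^ (wt i - 1)) *\<^sub>R X i (\<phi> s)"
          using 3 \<open>s / t \<in> _\<close> c(2)[of "s / t"] \<open>0 < t\<close> by (auto simp: \<phi>_def wt)
        moreover have "\<psi> (u / t) = \<phi> u" if "u \<in> {0<..<t}" for u
          using that c(2)[of "u / t"] by (simp add: \<phi>_def divide_le_eq)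
        ultimately show ?thesis using 3 unfolding sum
          by - (rule has_vector_derivative_transform_within_open[of "\<lambda>s. \<psi> (s / t)" _ s "{0<..<t}"], auto)
      qed
    qed
    then show "\<exists>C. countable C \<and> (\<forall>s. s \<notin> C \<longrightarrow> (\<phi> has_vector_derivative (\<Sum>j\<le>n. a j s *\<^sub>R X j (\<phi> s))) (at s))"
      by (intro exI[of _ "{0, t}"]) auto
  qed
  then show ?thesis using \<open>0 < t\<close> by (auto simp: reach_def)
qed

section \<open>Steps and brackets\<close>

lemma finite_words: "finite {u. set u \<subseteq> {0..n} \<and> weight u \<le> m}"
  by (rule finite_subset[OF _ finite_lists_length_le[of "{0..n}" m]])
    (auto intro: order_trans[OF length_le_weight])

lemma taylor_chain:
  fixes G :: "nat \<Rightarrow> real \<Rightarrow> real"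
  assumes "\<And>k s. k < N \<Longrightarrow> s \<in> {0..1} \<Longrightarrow> (G k has_real_derivative \<sigma> * G (Suc k) s) (at s within {0..1})"
    and "\<bar>\<sigma>\<bar> = 1" and "\<And>s. s \<in> {0..1} \<Longrightarrow> \<bar>G N s - G N 0\<bar> \<le> \<eta>" and "s \<in> {0..1}"
  shows "\<bar>G 0 s - (\<Sum>k\<le>N. (\<sigma> * s) ^ k / fact k * G k 0)\<bar> \<le> \<eta>"
  using assms(1,3,4)
proof (induction N arbitrary: G s)
  case 0
  then show ?case by simp
next
  case (Suc N)
  have IH: "\<bar>G (Suc 0) u - (\<Sum>k\<le>N. (\<sigma> * u) ^ k / fact k * G (Suc k) 0)\<bar> \<le> \<eta>" if "u \<in> {0..1}" for u
    using Suc.prems that by (intro Suc.IH[of "\<lambda>k. G (Suc k)"]) auto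
  define H where "H u = G 0 u - (\<Sum>k\<le>Suc N. (\<sigma> * u) ^ k / fact k * G k 0)" for u
  have H: "H u = G 0 u - (G 0 0 + (\<Sum>k\<le>N. (\<sigma> * u) ^ Suc k / fact (Suc k) * G (Suc k) 0))" for u
    unfolding H_def by (subst sum.atMost_Suc_shift) simp
  have dH: "(H has_vector_derivative \<sigma> * (G (Suc 0) u - (\<Sum>k\<le>N. (\<sigma> * u) ^ k / fact k * G (Suc k) 0))) (at u within {0..1})"
    if u: "u \<in> {0..1}" for u
  proof -
    have "((\<lambda>u. (\<sigma> * u) ^ Suc k / fact (Suc k) * G (Suc k) 0) has_real_derivative \<sigma> * ((\<sigma> * u) ^ k / fact k * G (Suc k) 0)) (at u within {0..1})" for k
      by (rule derivative_eq_intros refl | simp add: field_simps del: of_nat_Suc)+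
    then have "(H has_real_derivative \<sigma> * G (Suc 0) u - (0 + (\<Sum>k\<le>N. \<sigma> * ((\<sigma> * u) ^ k / fact k * G (Suc k) 0)))) (at u within {0..1})"
      unfolding H[abs_def] using Suc.prems(1)[of 0 u] u
      by (intro DERIV_diff DERIV_add DERIV_const DERIV_sum) auto
    then show ?thesis by (simp add: has_real_derivative_iff_has_vector_derivative sum_distrib_left right_diff_distrib)
  qed
  have "norm (H s - H 0) \<le> \<eta> * \<bar>s - 0\<bar>"
    by (rule vector_derivative_lipschitz[OF dH]) (use IH assms(2) Suc.prems in \<open>auto simp: abs_mult\<close>)
  moreover have "H 0 = 0" by (simp add: H)
  moreover have "\<eta> * \<bar>s\<bar> \<le> \<eta>"
    using Suc.prems(3) IH[of 0] by (intro mult_left_le) auto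
  ultimately show ?case by (simp add: H_def)
qed

lemma C1_lipschitz:
  assumes "open \<Omega>" "Ck_on (Suc 0) \<Omega> f" "compact K" "convex K" "K \<subseteq> \<Omega>"
  obtains B where "0 \<le> B" "\<And>x y. x \<in> K \<Longrightarrow> y \<in> K \<Longrightarrow> \<bar>f x - f y\<bar> \<le> B * norm (x - y)"
proof -
  have "continuous_on K (\<lambda>x. \<Sum>j\<in>UNIV. \<bar>partial j f x\<bar>)"
    using assms(2,5) by (intro continuous_intros) (auto intro: continuous_on_subset)
  then have "bounded ((\<lambda>x. \<Sum>j\<in>UNIV. \<bar>partial j f x\<bar>) ` K)"
    using assms(3) compact_continuous_image compact_imp_bounded by blast
  then obtain B where B: "\<And>x. x \<in> K \<Longrightarrow> \<bar>\<Sum>j\<in>UNIV. \<bar>partial j f x\<bar>\<bar> \<le> B"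
    by (auto simp: bounded_iff)
  show ?thesis
  proof (rule that[of "\<bar>B\<bar>"])
    fix x y assume "x \<in> K" "y \<in> K"
    have "norm (f x - f y) \<le> \<bar>B\<bar> * norm (x - y)"
    proof (rule differentiable_bound[OF assms(4) _ _ \<open>x \<in> K\<close> \<open>y \<in> K\<close>])
      fix z assume z: "z \<in> K"
      then show "(f has_derivative (\<lambda>h. \<Sum>j\<in>UNIV. h $ j * partial j f z)) (at z within K)"
        using C1_has_derivative[OF assms(1,2)] assms(5) by (auto intro: has_derivative_at_withinI)
      show "onorm (\<lambda>h. \<Sum>j\<in>UNIV. h $ j * partial j f z) \<le> \<bar>B\<bar>"
      proof (rule onorm_le)
        fix h :: "real^'a"
        have "norm (\<Sum>j\<in>UNIV. h $ j * partial j f z) \<le> (\<Sum>j\<in>UNIV. norm h * \<bar>partial j f z\<bar>)"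
          by (rule order_trans[OF norm_sum sum_mono])
            (auto simp: abs_mult intro: mult_right_mono component_le_norm_cart)
        also have "\<dots> \<le> norm h * \<bar>B\<bar>"
          unfolding sum_distrib_left[symmetric] using B[OF z] by (intro mult_left_mono) auto
        finally show "norm (\<Sum>j\<in>UNIV. h $ j * partial j f z) \<le> \<bar>B\<bar> * norm h" by (simp add: mult.commute)
      qed
    qed
    then show "\<bar>f x - f y\<bar> \<le> \<bar>B\<bar> * norm (x - y)" by simp
  qed simp
qed

lemma vf_apply_coord: "vf_apply X (\<lambda>y. y $ j) x = X x $ j"
  by (simp add: vf_apply_def partial_coord axis_def if_distrib sum.delta cong: if_cong)

lemma vf_apply_cong:
  assumes "open \<Omega>" "x \<in> \<Omega>" "\<And>y. y \<in> \<Omega> \<Longrightarrow> f y = g y" "\<And>j. has_partial_at j f x"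
  shows "vf_apply X g x = vf_apply X f x"
  using partial_cong(2)[OF assms(1-3) assms(4)] by (simp add: vf_apply_def)

lemma vf_apply_sum_list:
  assumes "\<And>c h j. (c, h) \<in> set l \<Longrightarrow> has_partial_at j h x"
  shows "(\<forall>j. has_partial_at j (\<lambda>y. \<Sum>(c, h)\<leftarrow>l. c * h y) x) \<and>
    vf_apply X (\<lambda>y. \<Sum>(c, h)\<leftarrow>l. c * h y) x = (\<Sum>(c, h)\<leftarrow>l. c * vf_apply X h x)"
  using assms
proof (induction l)
  case Nil
  then show ?case by (simp add: partial_const vf_apply_def)
next
  case (Cons p l)
  obtain c h where p: "p = (c, h)" by force
  have h: "has_partial_at j (\<lambda>y. c * h y) x" "partial j (\<lambda>y. c * h y) x = c * partial j h x" for j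
    using partial_mult[of j "\<lambda>_. c" x h] Cons.prems[of c h] by (auto simp: p partial_const mult.commute)
  have IH: "\<And>j. has_partial_at j (\<lambda>y. \<Sum>(c, h)\<leftarrow>l. c * h y) x"
    "vf_apply X (\<lambda>y. \<Sum>(c, h)\<leftarrow>l. c * h y) x = (\<Sum>(c, h)\<leftarrow>l. c * vf_apply X h x)"
    using Cons by auto
  have "vf_apply X (\<lambda>y. c * h y + (\<Sum>(c, h)\<leftarrow>l. c * h y)) x = c * vf_apply X h x + vf_apply X (\<lambda>y. \<Sum>(c, h)\<leftarrow>l. c * h y) x"
    unfolding vf_apply_def by (simp add: partial_add[OF h(1) IH(1)] h(2) sum.distrib sum_distrib_left algebra_simps)
  then show ?case using IH partial_add(1)[OF h(1) IH(1)] by (simp add: p)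
qed

text \<open>
  A word lists the fields in the order in which they
  act on a function, the reverse of the order in a composition of operators.
\<close>

fun bracket_terms :: "nat list \<Rightarrow> (real \<times> nat list) list" where
  "bracket_terms [] = []"
| "bracket_terms [i] = [(1, [i])]"
| "bracket_terms (i # j # I) = map (\<lambda>(c, w). (c, w @ [i])) (bracket_terms (j # I))
     @ map (\<lambda>(c, w). (- c, i # w)) (bracket_terms (j # I))"

lemma bracket_terms_words: "(c, w) \<in> set (bracket_terms I) \<Longrightarrow> weight w = weight I \<and> set w = set I"
  by (induction I arbitrary: c w rule: bracket_terms.induct) force+

text \<open>The expansion of the iterated bracket into words as an element of the ring, in the
  reversed word order.\<close>

definition bracket_poly :: "nat list \<Rightarrow> ncps" where
  "bracket_poly I = (\<Sum>(c, w)\<leftarrow>bracket_terms I. wmono c w)"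

text \<open>In the operator X_i Y the field X_i acts last, so its letter is appended on the right.
  The commutator therefore has the opposite order of factors compared with operator
  notation.\<close>

lemma bracket_poly_Cons:
  "bracket_poly (i # j # I) = bracket_poly (j # I) * wmono 1 [i] - wmono 1 [i] * bracket_poly (j # I)"
proof -
  have "(\<Sum>(c, w)\<leftarrow>l. wmono c (w @ [i])) = (\<Sum>(c, w)\<leftarrow>l. wmono c w) * wmono 1 [i]"
    "(\<Sum>(c, w)\<leftarrow>l. wmono (- c) (i # w)) = - (wmono 1 [i] * (\<Sum>(c, w)\<leftarrow>l. wmono c w))" for l
  proof (induction l)
    case (Cons p l)
    obtain c w where p: "p = (c, w)" by force
    have "wmono (- c) v = - wmono c v" for c v by (rule ncps_eqI) simp
    then show "(\<Sum>(c, w)\<leftarrow>p # l. wmono c (w @ [i])) = (\<Sum>(c, w)\<leftarrow>p # l. wmono c w) * wmono 1 [i]"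
      "(\<Sum>(c, w)\<leftarrow>p # l. wmono (- c) (i # w)) = - (wmono 1 [i] * (\<Sum>(c, w)\<leftarrow>p # l. wmono c w))"
      using Cons by (auto simp: p wmono_mult algebra_simps)
  qed auto
  then show ?thesis by (simp add: bracket_poly_def o_def case_prod_unfold)
qed

section \<open>Step lists, their series and nested group commutators\<close>

definition inv_steps :: "(real \<times> nat) list \<Rightarrow> (real \<times> nat) list" where
  "inv_steps l = rev (map (\<lambda>(\<sigma>, i). (- \<sigma>, i)) l)"

text \<open>The first step stands on the right: the values at the end point are expanded at the
  point after the first step, and these values in turn at the starting point, in the order of
  \<open>ev_conv\<close>.\<close>

primrec series :: "(real \<times> nat) list \<Rightarrow> ncps" where
  "series [] = 1"
| "series (p # l) = series l * expser (fst p) (snd p)"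

lemma series_append: "series (l @ l') = series l' * series l"
  by (induction l) (auto simp: mult.assoc)

lemma series_inv: "series (inv_steps l) * series l = 1" "series l * series (inv_steps l) = 1"
proof -
  show "series (inv_steps l) * series l = 1"
  proof (induction l)
    case (Cons p l)
    have "series (inv_steps (p # l)) * series (p # l)
       = expser (- fst p) (snd p) * (series (inv_steps l) * series l) * expser (fst p) (snd p)"
      by (simp add: inv_steps_def series_append case_prod_unfold mult.assoc)
    then show ?case using Cons expser_inverse[of "- fst p" "snd p"] by simp
  qed (simp add: inv_steps_def)
  show "series l * series (inv_steps l) = 1"
  proof (induction l)
    case (Cons p l)
    have "series (p # l) * series (inv_steps (p # l))
       = series l * (expser (fst p) (snd p) * expser (- fst p) (snd p)) * series (inv_steps l)"
      by (simp add: inv_steps_def series_append case_prod_unfold mult.assoc)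
    then show ?case using Cons by (simp add: expser_inverse)
  qed (simp add: inv_steps_def)
qed

text \<open>A group commutator: with A the series of the tail, this list has the series
  \<open>A * expser 1 i * A' * expser (- 1) i\<close>. The list looks reversed because
  \<open>series\<close> puts later steps on the left.\<close>

fun bracket_steps :: "nat list \<Rightarrow> (real \<times> nat) list" where
  "bracket_steps [] = []"
| "bracket_steps [i] = [(1, i)]"
| "bracket_steps (i # j # I) =
     (- 1, i) # inv_steps (bracket_steps (j # I)) @ (1, i) # bracket_steps (j # I)"

text \<open>\<open>leading_commutator\<close>, with the tail's series as A and the exponential of
  \<open>i\<close> as B, produces exactly the recursion of \<open>bracket_poly_Cons\<close>.\<close>

lemma leading_bracket_steps:
  assumes "I \<noteq> []"
  shows "leading (weight I) (series (bracket_steps I)) (bracket_poly I)"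
  using assms
proof (induction I rule: bracket_steps.induct)
  case (2 i)
  then show ?case using leading_expser[of 1 i] by (simp add: bracket_poly_def)
next
  case (3 i j I)
  let ?A = "series (bracket_steps (j # I))" and ?A' = "series (inv_steps (bracket_steps (j # I)))"
  have "leading (weight (j # I) + wt i) (?A * expser 1 i * ?A' * expser (- 1) i)
     (bracket_poly (j # I) * wmono 1 [i] - wmono 1 [i] * bracket_poly (j # I))"
    using 3 expser_inverse[of "1" i] expser_inverse[of "-1" i] leading_expser[of 1 i]
    by (intro leading_commutator series_inv) auto
  then show ?case
    unfolding bracket_poly_Cons by (simp add: series_append mult.assoc add.commute add.assoc)
qed simp

definition valid_steps :: "nat \<Rightarrow> (real \<times> nat) list \<Rightarrow> bool" where
  "valid_steps n l \<longleftrightarrow> (\<forall>(\<sigma>, i)\<in>set l. \<bar>\<sigma>\<bar> = 1 \<and> i \<le> n)"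

lemma valid_steps_simps [simp]:
  "valid_steps n []" "valid_steps n ((\<sigma>, i) # l) \<longleftrightarrow> \<bar>\<sigma>\<bar> = 1 \<and> i \<le> n \<and> valid_steps n l"
  "valid_steps n (l @ l') \<longleftrightarrow> valid_steps n l \<and> valid_steps n l'"
  "valid_steps n (inv_steps l) \<longleftrightarrow> valid_steps n l"
  by (auto simp: valid_steps_def inv_steps_def)

lemma valid_bracket_steps: "set I \<subseteq> {0..n} \<Longrightarrow> valid_steps n (bracket_steps I)"
  by (induction I rule: bracket_steps.induct) auto

section \<open>Taylor expansion along chains of flows\<close>

text \<open>For \<open>r = 2\<close> the assumption \<open>Ck_X\<close> says no more about the drift
  than continuity. The separate C^1 assumption covers that case: it makes the drift locally
  Lipschitz, so that its flow can be constructed.\<close>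

locale vector_fields =
  fixes \<Omega> :: "(real^'p) set" and n r :: nat and X :: "nat \<Rightarrow> real^'p \<Rightarrow> real^'p" and M :: real
  assumes open_dom: "open \<Omega>" and M_nonneg: "0 \<le> M"
    and M_bound: "\<And>i x. i \<le> n \<Longrightarrow> x \<in> \<Omega> \<Longrightarrow> norm (X i x) \<le> M"
    and Ck_X: "\<And>i j. i \<le> n \<Longrightarrow> Ck_on (r - wt i) \<Omega> (\<lambda>x. X i x $ j)"
    and C1_X: "\<And>i j. i \<le> n \<Longrightarrow> Ck_on (Suc 0) \<Omega> (\<lambda>x. X i x $ j)"
begin

abbreviation within_cost :: "real \<Rightarrow> real^'p \<Rightarrow> real^'p \<Rightarrow> bool" where
  "within_cost c \<equiv> reach \<Omega> n X M c c"

definition word_deriv :: "nat list \<Rightarrow> (real^'p \<Rightarrow> real) \<Rightarrow> real^'p \<Rightarrow> real" where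
  "word_deriv u f = fold (\<lambda>i. vf_apply (X i)) u f"

lemma word_deriv_simps [simp]: "word_deriv [] f = f" "word_deriv (i # u) f = word_deriv u (vf_apply (X i) f)"
  and word_deriv_append: "word_deriv (u @ v) f = word_deriv v (word_deriv u f)"
  and word_deriv_snoc: "word_deriv (u @ [i]) f = vf_apply (X i) (word_deriv u f)"
  by (auto simp: word_deriv_def)

text \<open>Differentiating \<open>f\<close> costs one order. The drift is charged a second one
  because its coefficients are only C^(r-2).\<close>

lemma Ck_apply:
  assumes "i \<le> n" "Ck_on k \<Omega> f" "wt i \<le> k" "k \<le> r"
  shows "Ck_on (k - wt i) \<Omega> (vf_apply (X i) f)"
proof (rule Ck_on_vf_apply[OF open_dom])
  show "Ck_on (k - wt i) \<Omega> (\<lambda>x. X i x $ j)" for j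
    using assms by (intro Ck_on_mono[OF Ck_X]) auto
  show "Ck_on (Suc (k - wt i)) \<Omega> f"
    using assms(3) wt_pos[of i] by (intro Ck_on_mono[OF assms(2)]) linarith
qed

lemma Ck_word_deriv:
  assumes "set u \<subseteq> {0..n}" "Ck_on k \<Omega> f" "weight u \<le> k" "k \<le> r"
  shows "Ck_on (k - weight u) \<Omega> (word_deriv u f)"
  using assms
proof (induction u arbitrary: f k)
  case (Cons i u)
  have "Ck_on (k - wt i - weight u) \<Omega> (word_deriv u (vf_apply (X i) f))"
    using Cons.prems by (intro Cons.IH Ck_apply) auto
  then show ?case by simp
qed simp

lemma continuous_word_deriv:
  assumes "set u \<subseteq> {0..n}" "Ck_on r \<Omega> f" "weight u \<le> r"
  shows "continuous_on \<Omega> (word_deriv u f)"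
  using Ck_word_deriv[OF assms order_refl] by (rule Ck_on_imp_continuous)

lemma weight_pos: "I \<noteq> [] \<Longrightarrow> weight I > 0"
  by (cases I) auto

text \<open>A bracket differentiates each of its two fields once. Both weights are positive and add
  up, so \<open>r - weight I\<close> is at least one less than the regularity of either
  field.\<close>

lemma Ck_iter_bracket:
  assumes "I \<noteq> []" "set I \<subseteq> {0..n}" "weight I \<le> r"
  shows "Ck_on (r - weight I) \<Omega> (\<lambda>x. iter_bracket X I x $ j)"
  using assms
proof (induction I arbitrary: j rule: bracket_steps.induct)
  case (2 i)
  then show ?case using Ck_X[of i j] by simp
next
  case (3 i k I)
  define Y where "Y = iter_bracket X (k # I)"
  define m where "m = r - weight (i # k # I)"
  have w: "weight (k # I) > 0" "wt i > 0" "wt i + weight (k # I) \<le> r" using 3 by (auto simp: weight_pos)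
  have Y: "Ck_on (r - weight (k # I)) \<Omega> (\<lambda>x. Y x $ j)" for j
    unfolding Y_def using 3 by (intro 3) auto
  have Xi: "Ck_on (r - wt i) \<Omega> (\<lambda>x. X i x $ j)" for j using 3 by (intro Ck_X) auto
  have m: "m = r - wt i - weight (k # I)" by (simp add: m_def)
  have le: "m \<le> r - wt i" "m \<le> r - weight (k # I)" "Suc m \<le> r - wt i" "Suc m \<le> r - weight (k # I)"
    using w unfolding m by linarith+
  have "Ck_on m \<Omega> (vf_apply (X i) (\<lambda>x. Y x $ j))"
    using le by (intro Ck_on_vf_apply[OF open_dom] Ck_on_mono[OF Xi] Ck_on_mono[OF Y])
  moreover have "Ck_on m \<Omega> (vf_apply Y (\<lambda>x. X i x $ j))"
    using le by (intro Ck_on_vf_apply[OF open_dom] Ck_on_mono[OF Xi] Ck_on_mono[OF Y])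
  ultimately have "Ck_on m \<Omega> (\<lambda>x. vf_apply (X i) (\<lambda>x. Y x $ j) x + (- 1) * vf_apply Y (\<lambda>x. X i x $ j) x)"
    by (intro Ck_on_add Ck_on_mult Ck_on_const open_dom) auto
  then show ?case by (simp add: vf_bracket_def Y_def m_def)
qed simp

text \<open>The inner expansion is an identity on the whole open set, so it may be differentiated
  along \<open>X i\<close> once more; this appends \<open>i\<close> to its words. The other term of
  the commutator applies the induction hypothesis to the derivative of \<open>g\<close> along
  \<open>X i\<close>, with \<open>k\<close> lowered by \<open>wt i\<close>, which prepends
  \<open>i\<close>.\<close>

lemma vf_apply_iter_bracket:
  assumes "I \<noteq> []" "set I \<subseteq> {0..n}" "Ck_on k \<Omega> g" "weight I \<le> k" "k \<le> r" "z \<in> \<Omega>"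
  shows "vf_apply (iter_bracket X I) g z = (\<Sum>(c, w)\<leftarrow>bracket_terms I. c * word_deriv w g z)"
  using assms
proof (induction I arbitrary: g k z rule: bracket_steps.induct)
  case (3 i j I)
  define Y where "Y = iter_bracket X (j # I)"
  have w: "weight (j # I) > 0" "wt i > 0" "wt i + weight (j # I) \<le> k" using 3 by (auto simp: weight_pos)
  have i: "i \<le> n" using 3 by auto
  have "vf_apply (vf_bracket (X i) Y) g z = vf_apply (X i) (vf_apply Y g) z - vf_apply Y (vf_apply (X i) g) z"
  proof (rule vf_apply_bracket[OF open_dom C1_X[OF i] _ _ \<open>z \<in> \<Omega>\<close>])
    show "Ck_on (Suc 0) \<Omega> (\<lambda>x. Y x $ l)" for l
      unfolding Y_def
    proof (rule Ck_on_mono[OF Ck_iter_bracket])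
      show "weight (j # I) \<le> r" "Suc 0 \<le> r - weight (j # I)" using w \<open>k \<le> r\<close> by linarith+
    qed (use 3 in auto)
    show "Ck_on (Suc (Suc 0)) \<Omega> g" using w by (intro Ck_on_mono[OF \<open>Ck_on k \<Omega> g\<close>]) linarith
  qed
  also have "vf_apply Y (vf_apply (X i) g) z = (\<Sum>(c, w)\<leftarrow>bracket_terms (j # I). c * word_deriv (i # w) g z)"
    unfolding Y_def using 3 w i
    by (subst "3.IH"[of "k - wt i"]) (auto intro: Ck_apply)
  also have "vf_apply (X i) (vf_apply Y g) z = (\<Sum>(c, w)\<leftarrow>bracket_terms (j # I). c * word_deriv (w @ [i]) g z)"
  proof -
    let ?l = "map (\<lambda>(c, w). (c, word_deriv w g)) (bracket_terms (j # I))"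
    have "has_partial_at l h z" if ch: "(c, h) \<in> set ?l" for c h l
    proof -
      obtain w' where w': "(c, w') \<in> set (bracket_terms (j # I))" "h = word_deriv w' g" using ch by auto
      have "Ck_on (k - weight w') \<Omega> h" unfolding w'(2)
        using bracket_terms_words[OF w'(1)] 3 w by (intro Ck_word_deriv) auto
      then have "Ck_on (Suc 0) \<Omega> h"
        by (rule Ck_on_mono) (use bracket_terms_words[OF w'(1)] w in linarith)
      then show ?thesis using \<open>z \<in> \<Omega>\<close> by simp
    qed
    have "vf_apply (X i) (vf_apply Y g) z = vf_apply (X i) (\<lambda>y. \<Sum>(c, h)\<leftarrow>?l. c * h y) z"
    proof (rule vf_apply_cong[OF open_dom \<open>z \<in> \<Omega>\<close>])
      fix y assume "y \<in> \<Omega>"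
      have "vf_apply Y g y = (\<Sum>(c, w)\<leftarrow>bracket_terms (j # I). c * word_deriv w g y)"
        unfolding Y_def using 3 w \<open>y \<in> \<Omega>\<close> by (intro "3.IH"[of k]) auto
      then show "(\<Sum>(c, h)\<leftarrow>?l. c * h y) = vf_apply Y g y"
        by (simp add: o_def case_prod_unfold)
    next
      show "has_partial_at l (\<lambda>y. \<Sum>(c, h)\<leftarrow>?l. c * h y) z" for l
        using vf_apply_sum_list[of ?l z] \<open>\<And>l h c. (c, h) \<in> set ?l \<Longrightarrow> has_partial_at l h z\<close> by blast
    qed
    also have "\<dots> = (\<Sum>(c, h)\<leftarrow>?l. c * vf_apply (X i) h z)"
      using vf_apply_sum_list[of ?l z] \<open>\<And>l h c. (c, h) \<in> set ?l \<Longrightarrow> has_partial_at l h z\<close> by blast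
    finally show ?thesis by (simp add: o_def case_prod_unfold word_deriv_snoc)
  qed
  finally show ?case
    by (simp add: Y_def o_def case_prod_unfold sum_list_subtractf uminus_sum_list_map)
qed auto

text \<open>The factor \<open>t ^ weight u\<close> absorbs all flow times: on these rescaled values
  a flow of \<open>X i\<close> for time \<open>t ^ wt i\<close> acts by an exponential series free
  of \<open>t\<close>, so one computation in the ring serves every \<open>t\<close>.\<close>

definition state :: "real \<Rightarrow> (real^'p \<Rightarrow> real) \<Rightarrow> real^'p \<Rightarrow> nat list \<Rightarrow> real" where
  "state t f z u = t ^ weight u * word_deriv u f z"

definition flow_in :: "(real^'p) set \<Rightarrow> real \<Rightarrow> real \<Rightarrow> nat \<Rightarrow> (real \<Rightarrow> real^'p) \<Rightarrow> bool" where
  "flow_in K t \<sigma> i \<psi> \<longleftrightarrow> \<psi> ` {0..1} \<subseteq> K \<and>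
     (\<forall>s\<in>{0..1}. (\<psi> has_vector_derivative (\<sigma> * t ^ wt i) *\<^sub>R X i (\<psi> s)) (at s within {0..1}))"

lemma flow_mem: "flow_in K t \<sigma> i \<psi> \<Longrightarrow> s \<in> {0..1} \<Longrightarrow> \<psi> s \<in> K"
  by (auto simp: flow_in_def)

lemma flow_word_deriv:
  assumes fl: "flow_in K t \<sigma> i \<psi>" and "K \<subseteq> \<Omega>" "Ck_on (Suc 0) \<Omega> g" "s \<in> {0..1}"
  shows "((\<lambda>s. g (\<psi> s)) has_real_derivative \<sigma> * t ^ wt i * vf_apply (X i) g (\<psi> s)) (at s within {0..1})"
proof -
  have "\<psi> s \<in> \<Omega>" "(\<psi> has_vector_derivative (\<sigma> * t ^ wt i) *\<^sub>R X i (\<psi> s)) (at s within {0..1})"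
    using assms flow_mem[OF fl] by (auto simp: flow_in_def)
  from C1_chain[OF open_dom assms(3) this] show ?thesis
    by (simp add: vf_apply_def sum_distrib_left mult.assoc)
qed

lemma flow_dist:
  assumes fl: "flow_in K t \<sigma> i \<psi>" and "K \<subseteq> \<Omega>" "\<bar>\<sigma>\<bar> = 1" "i \<le> n" "0 < t" "t \<le> 1" "s \<in> {0..1}"
  shows "norm (\<psi> s - \<psi> 0) \<le> M * t"
proof -
  have "norm (\<psi> s - \<psi> 0) \<le> (t ^ wt i * M) * \<bar>s - 0\<bar>"
  proof (rule vector_derivative_lipschitz)
    fix u :: real assume u: "u \<in> {0..1}"
    then show "(\<psi> has_vector_derivative (\<sigma> * t ^ wt i) *\<^sub>R X i (\<psi> u)) (at u within {0..1})"
      using fl by (auto simp: flow_in_def)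
    have "\<psi> u \<in> \<Omega>" using flow_mem[OF fl u] \<open>K \<subseteq> \<Omega>\<close> by auto
    then show "norm ((\<sigma> * t ^ wt i) *\<^sub>R X i (\<psi> u)) \<le> t ^ wt i * M"
      using M_bound[of i "\<psi> u"] assms by (auto simp: abs_mult intro!: mult_left_mono)
  qed (use assms in auto)
  also have "\<dots> \<le> (t * M) * 1"
  proof (rule mult_mono)
    have "t ^ wt i \<le> t ^ 1" using assms by (intro power_decreasing) (auto simp: Suc_leI)
    then show "t ^ wt i * M \<le> t * M" using M_nonneg by (intro mult_right_mono) auto
  qed (use assms M_nonneg in auto)
  finally show ?thesis by (simp add: mult.commute)
qed

text \<open>These are the words at which an expansion along \<open>X i\<close> has to stop. If
  \<open>weight u = r\<close>, uniform continuity on \<open>K\<close> makes the oscillation o(1), as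
  the flow moves by at most \<open>M * t\<close>. Otherwise \<open>i = 0\<close> and
  \<open>weight u = r - 1\<close>; then the value is still C^1, and the drift, running for time t^2,
  changes it by O(t^2), so the total is O(t^(r+1)).\<close>

lemma flow_remainder:
  assumes K: "compact K" "K \<subseteq> \<Omega>" and f: "Ck_on r \<Omega> f" and "0 < \<epsilon>" and "i \<le> n"
    and u: "set u \<subseteq> {0..n}" "weight u \<le> r" "r < weight u + wt i"
  shows "\<forall>\<^sub>F t in at_right 0. \<forall>\<sigma> \<psi> s. \<bar>\<sigma>\<bar> = 1 \<longrightarrow> flow_in K t \<sigma> i \<psi> \<longrightarrow> s \<in> {0..1} \<longrightarrow>
     \<bar>t ^ weight u * word_deriv u f (\<psi> s) - t ^ weight u * word_deriv u f (\<psi> 0)\<bar> \<le> \<epsilon> * t ^ r"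
proof (cases "weight u = r")
  case True
  have "uniformly_continuous_on K (word_deriv u f)"
    using continuous_word_deriv[OF u(1) f u(2)] K by (intro compact_uniformly_continuous) (auto intro: continuous_on_subset)
  then obtain d where d: "d > 0" "\<And>x y. x \<in> K \<Longrightarrow> y \<in> K \<Longrightarrow> dist y x < d \<Longrightarrow> dist (word_deriv u f y) (word_deriv u f x) < \<epsilon>"
    using \<open>0 < \<epsilon>\<close> unfolding uniformly_continuous_on_def by metis
  have "\<forall>\<^sub>F t in at_right 0. 0 < t \<and> t < min 1 (d / (M + 1))"
    using d M_nonneg by (intro eventually_at_rightI[of 0 "min 1 (d / (M + 1))"]) auto
  then show ?thesis
  proof (rule eventually_mono, intro allI impI)
    fix t \<sigma> \<psi> and s :: real
    assume t: "0 < t \<and> t < min 1 (d / (M + 1))" and fl: "\<bar>\<sigma>\<bar> = 1" "flow_in K t \<sigma> i \<psi>" "s \<in> {0..1}"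
    have "norm (\<psi> s - \<psi> 0) \<le> M * t" using flow_dist[OF fl(2) K(2) fl(1) \<open>i \<le> n\<close> _ _ fl(3)] t by auto
    also have "\<dots> < d" using t M_nonneg by (auto simp: field_simps)
    finally have "\<bar>word_deriv u f (\<psi> s) - word_deriv u f (\<psi> 0)\<bar> < \<epsilon>"
      using d(2)[of "\<psi> 0" "\<psi> s"] fl by (auto simp: flow_in_def dist_norm image_subset_iff)
    then have "t ^ r * \<bar>word_deriv u f (\<psi> s) - word_deriv u f (\<psi> 0)\<bar> \<le> t ^ r * \<epsilon>"
      using t by (intro mult_left_mono) auto
    then show "\<bar>t ^ weight u * word_deriv u f (\<psi> s) - t ^ weight u * word_deriv u f (\<psi> 0)\<bar> \<le> \<epsilon> * t ^ r"
      using t by (simp add: True right_diff_distrib[symmetric] abs_mult mult.commute)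
  qed
next
  case False
  then have w: "r = weight u + 1" "wt i = 2" using u wt_le_2[of i] by linarith+
  have C1: "Ck_on (Suc 0) \<Omega> (word_deriv u f)" using Ck_word_deriv[OF u(1) f u(2) order_refl] w by simp
  have "Ck_on 0 \<Omega> (vf_apply (X i) (word_deriv u f))"
    using C1 C1_X[OF \<open>i \<le> n\<close>] by (intro Ck_on_vf_apply[OF open_dom] Ck_on_mono[of "Suc 0" _ _ 0]) auto
  then have "bounded (vf_apply (X i) (word_deriv u f) ` K)"
    using K by (intro compact_imp_bounded compact_continuous_image) (auto intro: continuous_on_subset)
  then obtain B where B: "\<And>x. x \<in> K \<Longrightarrow> \<bar>vf_apply (X i) (word_deriv u f) x\<bar> \<le> B"
    by (auto simp: bounded_iff)
  have "\<forall>\<^sub>F t in at_right 0. 0 < t \<and> t < \<epsilon> / (\<bar>B\<bar> + 1)"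
    using \<open>0 < \<epsilon>\<close> by (intro eventually_at_rightI[of 0 "\<epsilon> / (\<bar>B\<bar> + 1)"]) auto
  then show ?thesis
  proof (rule eventually_mono, intro allI impI)
    fix t \<sigma> \<psi> and s :: real
    assume t: "0 < t \<and> t < \<epsilon> / (\<bar>B\<bar> + 1)" and fl: "\<bar>\<sigma>\<bar> = 1" "flow_in K t \<sigma> i \<psi>" "s \<in> {0..1}"
    have "norm (word_deriv u f (\<psi> s) - word_deriv u f (\<psi> 0)) \<le> (t ^ 2 * \<bar>B\<bar>) * \<bar>s - 0\<bar>"
    proof (rule vector_derivative_lipschitz)
      fix v :: real assume v: "v \<in> {0..1}"
      show "((\<lambda>s. word_deriv u f (\<psi> s)) has_vector_derivative \<sigma> * t ^ wt i * vf_apply (X i) (word_deriv u f) (\<psi> v)) (at v within {0..1})"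
        using flow_word_deriv[OF fl(2) K(2) C1 v] by (simp add: has_real_derivative_iff_has_vector_derivative)
      have "\<bar>vf_apply (X i) (word_deriv u f) (\<psi> v)\<bar> \<le> \<bar>B\<bar>" using B[of "\<psi> v"] fl v by (auto simp: flow_in_def image_subset_iff)
      then show "norm (\<sigma> * t ^ wt i * vf_apply (X i) (word_deriv u f) (\<psi> v)) \<le> t ^ 2 * \<bar>B\<bar>"
        using fl t w by (auto simp: abs_mult intro!: mult_left_mono)
    qed (use fl in auto)
    also have "\<dots> \<le> (t ^ 2 * \<bar>B\<bar>) * 1" using fl by (intro mult_left_mono) auto
    also have "\<dots> = t * (t * \<bar>B\<bar>)" by (simp add: power2_eq_square)
    also have "\<dots> \<le> t * \<epsilon>"
    proof (rule mult_left_mono)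
      have "t * (\<bar>B\<bar> + 1) \<le> \<epsilon>" using t by (auto simp: field_simps)
      then show "t * \<bar>B\<bar> \<le> \<epsilon>" using t by (simp add: algebra_simps)
    qed (use t in auto)
    finally have "t ^ weight u * \<bar>word_deriv u f (\<psi> s) - word_deriv u f (\<psi> 0)\<bar> \<le> t ^ weight u * (t * \<epsilon>)"
      using t by (intro mult_left_mono) auto
    then show "\<bar>t ^ weight u * word_deriv u f (\<psi> s) - t ^ weight u * word_deriv u f (\<psi> 0)\<bar> \<le> \<epsilon> * t ^ r"
      using t w by (simp add: right_diff_distrib[symmetric] abs_mult mult_ac)
  qed
qed

text \<open>Appending further letters \<open>i\<close> to \<open>u\<close> differentiates along the
  flow. \<open>N\<close> is the number of letters that fit below weight \<open>r\<close>; the Taylor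
  polynomial of that degree is the evaluation of the exponential series, and \<open>rem\<close>
  controls the last term.\<close>

lemma flow_expansion:
  assumes "K \<subseteq> \<Omega>" and f: "Ck_on r \<Omega> f" and "i \<le> n" "\<bar>\<sigma>\<bar> = 1" and fl: "flow_in K t \<sigma> i \<psi>"
    and u: "set u \<subseteq> {0..n}" "weight u \<le> r"
    and rem: "\<And>v s. set v \<subseteq> {0..n} \<Longrightarrow> weight v \<le> r \<Longrightarrow> r < weight v + wt i \<Longrightarrow> s \<in> {0..1} \<Longrightarrow>
       \<bar>t ^ weight v * word_deriv v f (\<psi> s) - t ^ weight v * word_deriv v f (\<psi> 0)\<bar> \<le> \<eta>"
  shows "\<bar>state t f (\<psi> 1) u - ev n (r - weight u) (cf (expser \<sigma> i)) (\<lambda>v. state t f (\<psi> 0) (u @ v))\<bar> \<le> \<eta>"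
proof -
  define N where "N = (r - weight u) div wt i"
  define G where "G k s = state t f (\<psi> s) (u @ replicate k i)" for k s
  have wk: "weight (u @ replicate k i) = weight u + k * wt i" for k by simp
  have N: "N * wt i \<le> r - weight u" "r - weight u < N * wt i + wt i"
    unfolding N_def using div_times_less_eq_dividend[of "r - weight u" "wt i"] dividend_less_div_times[of "wt i" "r - weight u"]
    by (auto simp: add.commute)
  have "\<bar>G 0 1 - (\<Sum>k\<le>N. (\<sigma> * 1) ^ k / fact k * G k 0)\<bar> \<le> \<eta>"
  proof (rule taylor_chain)
    fix k and s :: real assume k: "k < N" and s: "s \<in> {0..1}"
    let ?w = "u @ replicate k i"
    have "k * wt i + wt i \<le> N * wt i" using k by (metis Suc_leI mult_Suc mult_le_mono1 add.commute)
    then have wle: "weight ?w + wt i \<le> r" using N u by simp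
    have C1: "Ck_on (Suc 0) \<Omega> (word_deriv ?w f)"
    proof (rule Ck_on_mono[OF Ck_word_deriv[OF _ f]])
      show "weight ?w \<le> r" "Suc 0 \<le> r - weight ?w" using wle wt_pos[of i] by linarith+
    qed (use u \<open>i \<le> n\<close> in auto)
    have rep: "u @ replicate (Suc k) i = ?w @ [i]" by (simp add: replicate_append_same)
    have "((\<lambda>s. t ^ weight ?w * word_deriv ?w f (\<psi> s)) has_real_derivative
        t ^ weight ?w * (\<sigma> * t ^ wt i * vf_apply (X i) (word_deriv ?w f) (\<psi> s))) (at s within {0..1})"
      by (intro DERIV_cmult flow_word_deriv[OF fl \<open>K \<subseteq> \<Omega>\<close> C1 s])
    moreover have "t ^ weight ?w * (\<sigma> * t ^ wt i * vf_apply (X i) (word_deriv ?w f) (\<psi> s)) = \<sigma> * G (Suc k) s"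
      unfolding G_def rep state_def word_deriv_snoc by (simp add: power_add)
    ultimately show "(G k has_real_derivative \<sigma> * G (Suc k) s) (at s within {0..1})"
      unfolding G_def[of k, abs_def] state_def by (simp only:)
  next
    fix s :: real assume "s \<in> {0..1}"
    then show "\<bar>G N s - G N 0\<bar> \<le> \<eta>"
      unfolding G_def state_def using N u \<open>i \<le> n\<close> by (intro rem) auto
  qed (use assms in auto)
  moreover have "ev n (r - weight u) (cf (expser \<sigma> i)) (\<lambda>v. state t f (\<psi> 0) (u @ v)) = (\<Sum>k\<le>N. \<sigma> ^ k / fact k * G k 0)"
    unfolding expser_def cf_Ncps N_def G_def by (rule ev_powers[OF \<open>i \<le> n\<close>])
  ultimately show ?thesis by (simp add: G_def)
qed

fun chain :: "(real^'p) set \<Rightarrow> real \<Rightarrow> (real \<times> nat) list \<Rightarrow> real^'p \<Rightarrow> real^'p \<Rightarrow> bool" where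
  "chain K t [] z z' \<longleftrightarrow> z \<in> K \<and> z' = z"
| "chain K t ((\<sigma>, i) # l) z z' \<longleftrightarrow> (\<exists>\<psi>. flow_in K t \<sigma> i \<psi> \<and> \<psi> 0 = z \<and> chain K t l (\<psi> 1) z')"

lemma chain_start: "chain K t l z z' \<Longrightarrow> z \<in> K"
  by (cases l) (auto simp: flow_in_def image_subset_iff)

text \<open>Expand the end point at the point after the first step, then replace the values there by
  their expansions at \<open>z\<close>. The second errors are multiplied by the coefficient mass of
  the remaining series, and \<open>ev_conv\<close> recognises the nested evaluation as that of the
  product.\<close>

lemma chain_expansion:
  assumes K: "compact K" "K \<subseteq> \<Omega>" and f: "Ck_on r \<Omega> f" and l: "valid_steps n l" and "0 < \<epsilon>"
  shows "\<forall>\<^sub>F t in at_right 0. \<forall>z z' u. chain K t l z z' \<longrightarrow> set u \<subseteq> {0..n} \<longrightarrow> weight u \<le> r \<longrightarrow>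
    \<bar>state t f z' u - ev n (r - weight u) (cf (series l)) (\<lambda>v. state t f z (u @ v))\<bar> \<le> \<epsilon> * t ^ r"
  using l \<open>0 < \<epsilon>\<close>
proof (induction l arbitrary: \<epsilon>)
  case Nil
  have "\<forall>\<^sub>F t in at_right 0. (0::real) < t" by (simp add: eventually_at_right_less)
  then show ?case by (rule eventually_mono) (use Nil in \<open>auto simp: ev_one simp del: cf_simps\<close>)
next
  case (Cons p l)
  obtain \<sigma> i where p: "p = (\<sigma>, i)" by force
  have \<sigma>: "\<bar>\<sigma>\<bar> = 1" and i: "i \<le> n" and l: "valid_steps n l" using Cons.prems by (auto simp: p)
  let ?A = "cf (series l)"
  define b where "b m = ev n m (\<lambda>w. \<bar>?A w\<bar>) (\<lambda>_. 1)" for m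
  have b0: "0 \<le> b m" for m
    using ev_bound[of n m "?A" "\<lambda>_. 0" "\<lambda>_. 0" 1] by (simp add: b_def)
  define C where "C = (\<Sum>m\<le>r. b m)"
  have C: "b m \<le> C" if "m \<le> r" for m unfolding C_def using that b0 by (intro member_le_sum) auto
  have C0: "0 \<le> C" using b0 by (auto simp: C_def intro: sum_nonneg)
  \<comment> \<open>\<open>C\<close> dominates the coefficient mass for every remaining weight
    \<open>r - weight u\<close>, so the single-flow errors sum to at most half of \<epsilon>; the
    other half is left for the rest of the chain.\<close>
  define \<epsilon>' where "\<epsilon>' = \<epsilon> / (2 * (C + 1))"
  have \<epsilon>': "0 < \<epsilon>'" "C * \<epsilon>' \<le> \<epsilon> / 2" using Cons.prems C0 by (auto simp: \<epsilon>'_def field_simps)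
  have "\<forall>\<^sub>F t in at_right 0. \<forall>u\<in>{u. set u \<subseteq> {0..n} \<and> weight u \<le> r}. r < weight u + wt i \<longrightarrow>
     (\<forall>\<sigma> \<psi> s. \<bar>\<sigma>\<bar> = 1 \<longrightarrow> flow_in K t \<sigma> i \<psi> \<longrightarrow> s \<in> {0..1} \<longrightarrow>
     \<bar>t ^ weight u * word_deriv u f (\<psi> s) - t ^ weight u * word_deriv u f (\<psi> 0)\<bar> \<le> \<epsilon>' * t ^ r)"
  proof (intro eventually_ball_finite finite_words ballI)
    fix u assume u: "u \<in> {u. set u \<subseteq> {0..n} \<and> weight u \<le> r}"
    show "\<forall>\<^sub>F t in at_right 0. r < weight u + wt i \<longrightarrow>
     (\<forall>\<sigma> \<psi> s. \<bar>\<sigma>\<bar> = 1 \<longrightarrow> flow_in K t \<sigma> i \<psi> \<longrightarrow> s \<in> {0..1} \<longrightarrow>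
     \<bar>t ^ weight u * word_deriv u f (\<psi> s) - t ^ weight u * word_deriv u f (\<psi> 0)\<bar> \<le> \<epsilon>' * t ^ r)"
    proof (cases "r < weight u + wt i")
      case True
      then show ?thesis using flow_remainder[OF K f \<epsilon>'(1) i _ _ True] u by simp
    qed simp
  qed
  moreover have "\<forall>\<^sub>F t in at_right 0. \<forall>z z' u. chain K t l z z' \<longrightarrow> set u \<subseteq> {0..n} \<longrightarrow> weight u \<le> r \<longrightarrow>
    \<bar>state t f z' u - ev n (r - weight u) ?A (\<lambda>v. state t f z (u @ v))\<bar> \<le> \<epsilon> / 2 * t ^ r"
    using Cons.prems l by (intro Cons.IH) auto
  moreover have "\<forall>\<^sub>F t in at_right 0. (0::real) < t" by (simp add: eventually_at_right_less)
  ultimately show ?case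
  proof eventually_elim
    case (elim t)
    show ?case
    proof (intro allI impI)
      fix z z' u assume ch: "chain K t (p # l) z z'" and u: "set u \<subseteq> {0..n}" "weight u \<le> r"
      obtain \<psi> where \<psi>: "flow_in K t \<sigma> i \<psi>" "\<psi> 0 = z" "chain K t l (\<psi> 1) z'" using ch by (auto simp: p)
      let ?m = "r - weight u"
      let ?E = "\<lambda>v. ev n (?m - weight v) (cf (expser \<sigma> i)) (\<lambda>v'. state t f z (u @ v @ v'))"
      have "\<bar>ev n ?m ?A (\<lambda>v. state t f (\<psi> 1) (u @ v)) - ev n ?m ?A ?E\<bar> \<le> b ?m * (\<epsilon>' * t ^ r)"
        unfolding b_def
      proof (rule ev_bound)
        fix v assume v: "set v \<subseteq> {0..n}" "weight v \<le> ?m"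
        have "\<bar>state t f (\<psi> 1) (u @ v) - ev n (r - weight (u @ v)) (cf (expser \<sigma> i)) (\<lambda>v'. state t f (\<psi> 0) ((u @ v) @ v'))\<bar> \<le> \<epsilon>' * t ^ r"
          using u v elim(1) \<psi>(1) \<sigma> by (intro flow_expansion[OF K(2) f i \<sigma> \<psi>(1)]) auto
        then show "\<bar>state t f (\<psi> 1) (u @ v) - ?E v\<bar> \<le> \<epsilon>' * t ^ r"
          using \<psi>(2) by (simp add: diff_diff_left)
      qed
      also have "\<dots> \<le> C * (\<epsilon>' * t ^ r)" using C[of ?m] elim \<epsilon>' by (intro mult_right_mono) auto
      also have "\<dots> \<le> \<epsilon> / 2 * t ^ r" using \<epsilon>' elim unfolding mult.assoc[symmetric] by (intro mult_right_mono) auto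
      finally have "\<bar>ev n ?m ?A (\<lambda>v. state t f (\<psi> 1) (u @ v)) - ev n ?m ?A ?E\<bar> \<le> \<epsilon> / 2 * t ^ r" .
      moreover have "\<bar>state t f z' u - ev n ?m ?A (\<lambda>v. state t f (\<psi> 1) (u @ v))\<bar> \<le> \<epsilon> / 2 * t ^ r"
        using elim(2) \<psi>(3) u by blast
      moreover have "ev n ?m ?A ?E = ev n ?m (cf (series (p # l))) (\<lambda>v. state t f z (u @ v))"
        using ev_conv[of n ?m ?A "cf (expser \<sigma> i)" "\<lambda>v. state t f z (u @ v)"]
        by (simp add: p times_ncps_def)
      ultimately show "\<bar>state t f z' u - ev n ?m (cf (series (p # l))) (\<lambda>v. state t f z (u @ v))\<bar> \<le> \<epsilon> * t ^ r"
        by linarith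
    qed
  qed
qed

text \<open>Apply the expansion to each coordinate function and the empty word, with the series
  split as 1 + c + R. The 1 returns the starting point, c the bracket times
  \<open>t ^ weight I\<close>, and R contains only heavier words, hence is O(t) relative to the main
  term. The chain error o(t^r) is o(t^W) for W = \<open>weight I\<close>, since W is at most
  \<open>r\<close>.\<close>

lemma chain_displacement:
  assumes K: "compact K" "K \<subseteq> \<Omega>" and l: "valid_steps n l" and "0 < \<epsilon>"
    and I: "I \<noteq> []" "set I \<subseteq> {0..n}" "weight I \<le> r"
    and lead: "leading (weight I) (series l) c" and c: "c = bracket_poly I \<and> s = 1 \<or> c = - bracket_poly I \<and> s = -1"
  shows "\<forall>\<^sub>F t in at_right 0. \<forall>z z'. chain K t l z z' \<longrightarrow>
    norm (z' - z - (s * t ^ weight I) *\<^sub>R iter_bracket X I z) \<le> \<epsilon> * t ^ weight I"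
proof -
  let ?W = "weight I"
  define R where "R = series l - 1 - c"
  have R: "vanish (Suc ?W) R" using lead by (simp add: leading_def R_def)
  define N where "N = real CARD('p)"
  have "N > 0" by (simp add: N_def)
  define C where "C = ev n r (\<lambda>w. \<bar>cf R w\<bar>) (\<lambda>_. 1)"
  have C0: "0 \<le> C" using ev_bound[of n r "cf R" "\<lambda>_. 0" "\<lambda>_. 0" 1] by (simp add: C_def)
  have "\<exists>B. \<forall>j. \<forall>w\<in>{u. set u \<subseteq> {0..n} \<and> weight u \<le> r}. \<forall>z\<in>K. \<bar>word_deriv w (\<lambda>x. x $ j) z\<bar> \<le> B"
  proof -
    let ?P = "(UNIV :: 'p set) \<times> {u. set u \<subseteq> {0..n} \<and> weight u \<le> r}"
    have "\<exists>B. \<forall>z\<in>K. \<bar>word_deriv (snd p) (\<lambda>x. x $ fst p) z\<bar> \<le> B" if p: "p \<in> ?P" for p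
    proof -
      have "continuous_on \<Omega> (word_deriv (snd p) (\<lambda>x. x $ fst p))"
        using p by (intro continuous_word_deriv Ck_on_coord) auto
      then have "bounded (word_deriv (snd p) (\<lambda>x. x $ fst p) ` K)"
        using K by (meson compact_continuous_image compact_imp_bounded continuous_on_subset)
      then show ?thesis unfolding bounded_iff by force
    qed
    then have "\<exists>B. \<forall>p\<in>?P. \<forall>z\<in>K. \<bar>word_deriv (snd p) (\<lambda>x. x $ fst p) z\<bar> \<le> B p"
      by (intro bchoice) blast
    then obtain B where B: "\<forall>p\<in>?P. \<forall>z\<in>K. \<bar>word_deriv (snd p) (\<lambda>x. x $ fst p) z\<bar> \<le> B p" ..
    have fin: "finite ?P" by (rule finite_cartesian_product[OF finite finite_words])
    have Max: "B p \<le> Max (B ` ?P)" if "p \<in> ?P" for p using that fin by (intro Max_ge) auto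
    have "\<bar>word_deriv w (\<lambda>x. x $ j) z\<bar> \<le> Max (B ` ?P)" if "set w \<subseteq> {0..n}" "weight w \<le> r" "z \<in> K" for j w z
    proof -
      have jw: "(j, w) \<in> ?P" using that by simp
      show ?thesis using order_trans[OF bspec[OF bspec[OF B jw] that(3)] Max[OF jw]] by simp
    qed
    then show ?thesis by blast
  qed
  then obtain B0 where B0: "\<And>j w z. set w \<subseteq> {0..n} \<Longrightarrow> weight w \<le> r \<Longrightarrow> z \<in> K \<Longrightarrow> \<bar>word_deriv w (\<lambda>x. x $ j) z\<bar> \<le> B0"
    by blast
  define B where "B = \<bar>B0\<bar>"
  have B: "set w \<subseteq> {0..n} \<Longrightarrow> weight w \<le> r \<Longrightarrow> z \<in> K \<Longrightarrow> \<bar>word_deriv w (\<lambda>x. x $ j) z\<bar> \<le> B" "0 \<le> B" for j w z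
    using B0[of w z j] by (auto simp: B_def)
  \<comment> \<open>Two errors, from the chain and from \<open>R\<close>, in each of the N
    coordinates add up to \<epsilon>.\<close>
  define e where "e = \<epsilon> / (2 * N)"
  have e: "e > 0" using \<open>0 < \<epsilon>\<close> \<open>N > 0\<close> by (simp add: e_def)
  have "\<forall>\<^sub>F t in at_right 0. \<forall>j\<in>UNIV. \<forall>z z' u. chain K t l z z' \<longrightarrow> set u \<subseteq> {0..n} \<longrightarrow> weight u \<le> r \<longrightarrow>
    \<bar>state t (\<lambda>x. x $ j) z' u - ev n (r - weight u) (cf (series l)) (\<lambda>v. state t (\<lambda>x. x $ j) z (u @ v))\<bar> \<le> e * t ^ r"
    by (intro eventually_ball_finite ballI chain_expansion K l e Ck_on_coord) auto
  moreover have "\<forall>\<^sub>F t in at_right 0. 0 < t \<and> t < min 1 (e / (C * B + 1))"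
    using e C0 B(2) by (intro eventually_at_rightI[of 0 "min 1 (e / (C * B + 1))"]) (auto intro!: divide_pos_pos add_nonneg_pos)
  ultimately show ?thesis
  proof eventually_elim
    case (elim t)
    have "0 < C * B + 1" using C0 B(2) by (simp add: add_nonneg_pos)
    then have t: "0 < t" "t < 1" "t * (C * B + 1) < e"
      using elim(2) unfolding min_less_iff_conj by (simp_all add: less_divide_eq)
    show ?case
    proof (intro allI impI)
      fix z z' assume ch: "chain K t l z z'"
      have zK: "z \<in> K" using chain_start[OF ch] .
      have z\<Omega>: "z \<in> \<Omega>" using zK K by auto
      have comp: "\<bar>(z' - z - (s * t ^ ?W) *\<^sub>R iter_bracket X I z) $ j\<bar> \<le> \<epsilon> / N * t ^ ?W" for j
      proof -
        let ?f = "\<lambda>x :: real^'p. x $ j"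
        let ?S = "state t ?f z"
        have "\<bar>state t ?f z' [] - ev n r (cf (series l)) ?S\<bar> \<le> e * t ^ r"
          using elim(1)[THEN bspec[of _ _ j], rule_format, OF _ ch, of "[]"] by simp
        moreover have "cf (series l) = (\<lambda>w. cf (1 + c) w + cf R w)" by (simp add: R_def fun_eq_iff)
        then have "ev n r (cf (series l)) ?S = ev n r (cf (1 + c)) ?S + ev n r (cf R) ?S"
          by (simp only: ev_add_left)
        moreover have "ev n r (cf (1 + c)) ?S = ev n r (cf 1) ?S + ev n r (cf c) ?S"
          unfolding ev_add_left[symmetric] by (intro arg_cong2[of _ _ _ _ "ev n r"]) auto
        moreover have "ev n r (cf 1) ?S = z $ j" by (simp add: ev_one state_def del: cf_simps)
        moreover have "ev n r (cf c) ?S = s * t ^ ?W * iter_bracket X I z $ j"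
        proof -
          have "ev n r (cf (bracket_poly I)) ?S = (\<Sum>(c, w)\<leftarrow>bracket_terms I. ev n r (cf (wmono c w)) ?S)"
            by (simp add: bracket_poly_def ev_sum_list o_def case_prod_unfold del: cf_wmono)
          also have "\<dots> = (\<Sum>(c, w)\<leftarrow>bracket_terms I. t ^ ?W * (c * word_deriv w ?f z))"
          proof (rule arg_cong[of _ _ sum_list], rule map_cong[OF refl], clarify)
            fix c w assume "(c, w) \<in> set (bracket_terms I)"
            from bracket_terms_words[OF this] show "ev n r (cf (wmono c w)) ?S = t ^ ?W * (c * word_deriv w ?f z)"
              using I by (subst ev_mono) (auto simp: state_def)
          qed
          also have "\<dots> = t ^ ?W * (\<Sum>(c, w)\<leftarrow>bracket_terms I. c * word_deriv w ?f z)"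
            by (simp add: sum_list_const_mult[symmetric] case_prod_unfold)
          also have "(\<Sum>(c, w)\<leftarrow>bracket_terms I. c * word_deriv w ?f z) = iter_bracket X I z $ j"
            using vf_apply_iter_bracket[OF I(1,2) Ck_on_coord I(3) order_refl z\<Omega>] by (simp add: vf_apply_coord)
          finally have *: "ev n r (cf (bracket_poly I)) ?S = t ^ ?W * iter_bracket X I z $ j" .
          have "cf (- bracket_poly I) = (\<lambda>w. (- 1) * cf (bracket_poly I) w)" by auto
          then have "ev n r (cf (- bracket_poly I)) ?S = - ev n r (cf (bracket_poly I)) ?S"
            by (simp only: ev_scale_left)
          then show ?thesis using c * by auto
        qed
        moreover have "\<bar>ev n r (cf R) ?S - ev n r (cf R) (\<lambda>_. 0)\<bar> \<le> C * (t ^ Suc ?W * B)"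
          unfolding C_def
        proof (rule ev_bound)
          fix w assume w: "set w \<subseteq> {0..n}" "weight w \<le> r" "cf R w \<noteq> 0"
          then have "Suc ?W \<le> weight w" using R unfolding vanish_def by (meson not_le)
          then have "t ^ weight w \<le> t ^ Suc ?W" using t by (intro power_decreasing) auto
          then show "\<bar>?S w - 0\<bar> \<le> t ^ Suc ?W * B"
            using B(1)[OF w(1,2) zK, of j] t by (auto simp: state_def abs_mult intro!: mult_mono)
        qed
        moreover have "ev n r (cf R) (\<lambda>_. 0) = 0" by (rule ev_zero_right)
        moreover have "e * t ^ r \<le> e * t ^ ?W" using t e I by (intro mult_left_mono power_decreasing) auto
        moreover have "C * (t ^ Suc ?W * B) \<le> e * t ^ ?W"
        proof -
          have "(t * (C * B)) * t ^ ?W \<le> e * t ^ ?W" using t by (intro mult_right_mono) (auto simp: algebra_simps)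
          then show ?thesis by (simp add: mult_ac)
        qed
        moreover have "state t ?f z' [] = z' $ j" by (simp add: state_def)
        ultimately have "\<bar>z' $ j - z $ j - s * t ^ ?W * iter_bracket X I z $ j\<bar> \<le> 2 * e * t ^ ?W" by linarith
        then show ?thesis using \<open>N > 0\<close> by (simp add: e_def)
      qed
      have "norm (z' - z - (s * t ^ ?W) *\<^sub>R iter_bracket X I z) \<le> (\<Sum>j\<in>(UNIV :: 'p set). \<epsilon> / N * t ^ ?W)"
        by (rule order_trans[OF norm_le_l1_cart sum_mono]) (rule comp)
      also have "\<dots> = \<epsilon> * t ^ ?W" using \<open>N > 0\<close> by (simp add: N_def[symmetric])
      finally show "norm (z' - z - (s * t ^ ?W) *\<^sub>R iter_bracket X I z) \<le> \<epsilon> * t ^ ?W" .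
    qed
  qed
qed

section \<open>Existence of flows and chains in a ball\<close>

lemma lipschitz_X:
  assumes "compact K" "convex K" "K \<subseteq> \<Omega>"
  obtains L where "0 \<le> L" "\<And>i x y. i \<le> n \<Longrightarrow> x \<in> K \<Longrightarrow> y \<in> K \<Longrightarrow> norm (X i x - X i y) \<le> L * norm (x - y)"
proof -
  have "\<exists>B\<ge>0. \<forall>x\<in>K. \<forall>y\<in>K. \<bar>X i x $ j - X i y $ j\<bar> \<le> B * norm (x - y)" if "i \<le> n" for i j
    using C1_lipschitz[OF open_dom C1_X[OF that] assms] by metis
  then obtain B where B: "\<And>i j. i \<le> n \<Longrightarrow> 0 \<le> B i j"
      "\<And>i j x y. i \<le> n \<Longrightarrow> x \<in> K \<Longrightarrow> y \<in> K \<Longrightarrow> \<bar>X i x $ j - X i y $ j\<bar> \<le> B i j * norm (x - y)"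
    by metis
  show ?thesis
  proof (rule that[of "\<Sum>i\<le>n. \<Sum>j\<in>UNIV. B i j"])
    show "0 \<le> (\<Sum>i\<le>n. \<Sum>j\<in>UNIV. B i j)" using B by (auto intro!: sum_nonneg)
    fix i x y assume i: "i \<le> n" and xy: "x \<in> K" "y \<in> K"
    have "norm (X i x - X i y) \<le> (\<Sum>j\<in>UNIV. \<bar>(X i x - X i y) $ j\<bar>)" by (rule norm_le_l1_cart)
    also have "\<dots> \<le> (\<Sum>j\<in>UNIV. B i j * norm (x - y))" using B(2)[OF i xy] by (intro sum_mono) auto
    also have "\<dots> = (\<Sum>j\<in>UNIV. B i j) * norm (x - y)" by (simp add: sum_distrib_right)
    also have "\<dots> \<le> (\<Sum>i\<le>n. \<Sum>j\<in>UNIV. B i j) * norm (x - y)"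
      using i B(1) by (intro mult_right_mono member_le_sum[of i "{..n}" "\<lambda>i. \<Sum>j\<in>UNIV. B i j"]) (auto intro: sum_nonneg)
    finally show "norm (X i x - X i y) \<le> (\<Sum>i\<le>n. \<Sum>j\<in>UNIV. B i j) * norm (x - y)" .
  qed
qed

text \<open>Composing the field with the nearest-point projection onto the ball gives a global field
  with Lipschitz constant \<open>t * L\<close>, less than 1 for small \<open>t\<close>. Its solution
  travels at most \<open>M * t\<close>, hence never leaves the ball, and there the projection is the
  identity.\<close>

lemma flow_in_exists:
  assumes K: "cball x0 \<rho> \<subseteq> \<Omega>" and "0 < \<rho>"
  shows "\<forall>\<^sub>F t in at_right 0. \<forall>\<sigma> i z. \<bar>\<sigma>\<bar> = 1 \<longrightarrow> i \<le> n \<longrightarrow> dist x0 z + M * t \<le> \<rho> \<longrightarrow>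
    (\<exists>\<psi>. flow_in (cball x0 \<rho>) t \<sigma> i \<psi> \<and> \<psi> 0 = z \<and> dist z (\<psi> 1) \<le> M * t)"
proof -
  let ?K = "cball x0 \<rho>"
  obtain L where L: "0 \<le> L" "\<And>i x y. i \<le> n \<Longrightarrow> x \<in> ?K \<Longrightarrow> y \<in> ?K \<Longrightarrow> norm (X i x - X i y) \<le> L * norm (x - y)"
    using lipschitz_X[OF compact_cball convex_cball K] by metis
  have "\<forall>\<^sub>F t in at_right 0. 0 < t \<and> t < min 1 (1 / (L + 1))"
    using L by (intro eventually_at_rightI[of 0 "min 1 (1 / (L + 1))"]) auto
  then show ?thesis
  proof (rule eventually_mono, intro allI impI)
    fix t \<sigma> :: real and i z
    assume t0: "0 < t \<and> t < min 1 (1 / (L + 1))" and \<sigma>: "\<bar>\<sigma>\<bar> = 1" and i: "i \<le> n" and z: "dist x0 z + M * t \<le> \<rho>"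
    have t: "0 < t" "t < 1" "t * (L + 1) < 1" using t0 L(1) unfolding min_less_iff_conj by (simp_all add: less_divide_eq)
    have tw: "t ^ wt i \<le> t" using t power_decreasing[of 1 "wt i" t] by (auto simp: Suc_leI)
    define p where "p = closest_point ?K"
    have p: "p x \<in> ?K" "x \<in> ?K \<Longrightarrow> p x = x" "norm (p x - p y) \<le> norm (x - y)" for x y
      using \<open>0 < \<rho>\<close> closest_point_in_set[of ?K x] closest_point_self[of x ?K] closest_point_lipschitz[of ?K x y]
      by (auto simp: p_def dist_norm)
    define F where "F x = (\<sigma> * t ^ wt i) *\<^sub>R X i (p x)" for x
    have F: "norm (F x - F y) \<le> (t * L) * norm (x - y)" for x y
    proof -
      have "norm (F x - F y) = t ^ wt i * norm (X i (p x) - X i (p y))"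
        using \<sigma> t by (simp add: F_def abs_mult flip: scaleR_diff_right)
      also have "\<dots> \<le> t * (L * norm (x - y))"
        using tw t p L(1) by (intro mult_mono order_trans[OF L(2)[OF i p(1) p(1)] mult_left_mono]) auto
      finally show ?thesis by (simp add: mult.assoc)
    qed
    obtain \<psi> where \<psi>: "\<psi> 0 = z" "\<And>s. s \<in> {0..1} \<Longrightarrow> (\<psi> has_vector_derivative F (\<psi> s)) (at s within {0..1})"
      using flow_exists[of "t * L" F z] F t L by (auto simp: algebra_simps)
    have d: "norm (\<psi> s - \<psi> 0) \<le> M * t" if "s \<in> {0..1}" for s
    proof -
      have "norm (\<psi> s - \<psi> 0) \<le> (t * M) * \<bar>s - 0\<bar>"
      proof (rule vector_derivative_lipschitz[OF \<psi>(2)])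
        fix u show "norm (F (\<psi> u)) \<le> t * M"
          using M_bound[OF i, of "p (\<psi> u)"] p(1) K tw \<sigma> t by (auto simp: F_def abs_mult subset_iff intro!: mult_mono)
      qed (use that in auto)
      also have "\<dots> \<le> (t * M) * 1" using that t M_nonneg by (intro mult_left_mono) auto
      finally show ?thesis by (simp add: mult.commute)
    qed
    have "\<psi> s \<in> ?K" if "s \<in> {0..1}" for s
      using d[OF that] z dist_triangle[of x0 "\<psi> s" z] by (auto simp: \<psi>(1) dist_norm norm_minus_commute)
    then have "flow_in ?K t \<sigma> i \<psi>"
      using \<psi>(2) p(2) by (auto simp: flow_in_def F_def)
    then show "\<exists>\<psi>. flow_in ?K t \<sigma> i \<psi> \<and> \<psi> 0 = z \<and> dist z (\<psi> 1) \<le> M * t"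
      using \<psi>(1) d[of 1] by (auto simp: dist_norm norm_minus_commute)
  qed
qed

text \<open>Every step uses up at most \<open>M * t\<close> of the distance left to the boundary of
  the ball; one threshold for \<open>t\<close> serves all steps and starting points.\<close>

lemma chain_exists:
  assumes K: "cball x0 \<rho> \<subseteq> \<Omega>" and "0 < \<rho>" and "valid_steps n l"
  shows "\<forall>\<^sub>F t in at_right 0. \<forall>z. dist x0 z + real (length l) * (M * t) \<le> \<rho> \<longrightarrow> (\<exists>z'. chain (cball x0 \<rho>) t l z z')"
proof -
  have "\<forall>\<^sub>F t in at_right 0. (0::real) < t" by (simp add: eventually_at_right_less)
  with flow_in_exists[OF assms(1,2)] show ?thesis
  proof eventually_elim
    case (elim t)
    have "valid_steps n l \<Longrightarrow> dist x0 z + real (length l) * (M * t) \<le> \<rho> \<Longrightarrow> \<exists>z'. chain (cball x0 \<rho>) t l z z'" for l z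
    proof (induction l arbitrary: z)
      case (Cons p l)
      obtain \<sigma> i where p: "p = (\<sigma>, i)" by force
      have nn: "0 \<le> real (length l) * (M * t)" using M_nonneg elim by auto
      have "dist x0 z + M * t \<le> \<rho>" using Cons.prems nn by (simp add: algebra_simps)
      then obtain \<psi> where \<psi>: "flow_in (cball x0 \<rho>) t \<sigma> i \<psi>" "\<psi> 0 = z" "dist z (\<psi> 1) \<le> M * t"
        using elim(1)[rule_format, of \<sigma> i z] Cons.prems by (auto simp: p)
      have "dist x0 (\<psi> 1) + real (length l) * (M * t) \<le> \<rho>"
        using Cons.prems \<psi>(3) dist_triangle[of x0 "\<psi> 1" z] by (simp add: algebra_simps)
      then obtain z' where "chain (cball x0 \<rho>) t l (\<psi> 1) z'" using Cons by (auto simp: p)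
      then show ?case using \<psi> by (auto simp: p)
    qed auto
    then show ?case using assms(3) by blast
  qed
qed

lemma chain_reach:
  assumes "chain K t l z z'" "K \<subseteq> \<Omega>" "valid_steps n l" "0 < t" "t \<le> D" "t \<le> 1"
  shows "reach \<Omega> n X M D (real (length l) * t) z z'"
  using assms
proof (induction l arbitrary: z)
  case Nil
  then show ?case using M_nonneg by (auto intro: reach_refl)
next
  case (Cons p l)
  obtain \<sigma> i where p: "p = (\<sigma>, i)" by force
  obtain \<psi> where \<psi>: "flow_in K t \<sigma> i \<psi>" "\<psi> 0 = z" "chain K t l (\<psi> 1) z'" using Cons.prems by (auto simp: p)
  have "reach \<Omega> n X M D t (\<psi> 0) (\<psi> 1)"
    using \<psi>(1) Cons.prems M_bound by (intro reach_flow[of i n t D \<sigma>]) (auto simp: p flow_in_def)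
  moreover have "reach \<Omega> n X M D (real (length l) * t) (\<psi> 1) z'" using \<psi>(3) Cons by (auto simp: p)
  ultimately show ?case using reach_trans \<psi>(2) by (fastforce simp: algebra_simps)
qed

end

section \<open>Approximate moves\<close>

lemma filterlim_powr_at_right_0:
  assumes "0 < (a::real)"
  shows "filterlim (\<lambda>h. h powr a) (at_right 0) (at_right 0)"
proof -
  have "((\<lambda>h. h powr a) \<longlongrightarrow> 0) (at_right 0)"
    using tendsto_powr2[of "\<lambda>h. h" 0 "at_right 0" "\<lambda>_. a" a] assms eventually_mono[OF eventually_at_right_less[of "0::real"]]
    by (simp add: tendsto_ident_at less_imp_le)
  moreover have "\<forall>\<^sub>F h in at_right 0. h powr a \<in> {0<..} - {0}"
    using eventually_at_right_less[of "0::real"] by (rule eventually_mono) auto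
  ultimately show ?thesis unfolding filterlim_at by auto
qed

lemma powr_power_swap: "0 \<le> b \<Longrightarrow> (b ^ k) powr a = (b powr a) ^ k" for a b :: real
  by (induction k) (simp_all add: powr_mult)

context vector_fields begin

text \<open>Every combination of \<open>W\<close> with small coefficients can be approximated, at the cost that the theorem allows.\<close>

definition movable :: "real^'p \<Rightarrow> (real^'p) set \<Rightarrow> bool" where
  "movable x0 W \<longleftrightarrow> (\<forall>\<epsilon>>0. \<exists>\<rho>>0. \<exists>c>0. \<forall>z\<in>ball x0 \<rho>. \<forall>h \<eta>. (\<forall>w\<in>W. \<bar>h w\<bar> \<le> \<eta>) \<longrightarrow> 0 < \<eta> \<longrightarrow> \<eta> \<le> \<rho> \<longrightarrow>
     (\<exists>z'. within_cost (c * \<eta> powr (1 / r)) z z' \<and>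
        norm (z' - z - (\<Sum>w\<in>W. h w *\<^sub>R w)) \<le> \<epsilon> * \<eta>))"

lemma movable_empty:
  assumes "x0 \<in> \<Omega>"
  shows "movable x0 {}"
  unfolding movable_def
proof (intro allI impI)
  fix \<epsilon> :: real assume "0 < \<epsilon>"
  obtain \<rho> where \<rho>: "0 < \<rho>" "ball x0 \<rho> \<subseteq> \<Omega>" using assms open_dom openE by blast
  have stay: "within_cost (1 * \<eta> powr (1 / r)) z z" if "z \<in> ball x0 \<rho>" for z \<eta>
    using that \<rho> by (intro reach_mono[OF reach_refl[of z \<Omega> 0 M n X] _ _ M_nonneg]) (auto simp: M_nonneg)
  show "\<exists>\<rho>>0. \<exists>c>0. \<forall>z\<in>ball x0 \<rho>. \<forall>h \<eta>. (\<forall>w\<in>{}. \<bar>h w\<bar> \<le> \<eta>) \<longrightarrow> 0 < \<eta> \<longrightarrow> \<eta> \<le> \<rho> \<longrightarrow>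
     (\<exists>z'. within_cost (c * \<eta> powr (1 / r)) z z' \<and>
        norm (z' - z - (\<Sum>w\<in>{}. h w *\<^sub>R w)) \<le> \<epsilon> * \<eta>)"
  proof (rule exI[of _ \<rho>], intro exI[of _ "1::real"] conjI ballI allI impI)
    fix z and h :: "real^'p \<Rightarrow> real" and \<eta> :: real
    assume "z \<in> ball x0 \<rho>" "0 < \<eta>"
    then show "\<exists>z'. within_cost (1 * \<eta> powr (1 / r)) z z' \<and>
        norm (z' - z - (\<Sum>w\<in>{}. h w *\<^sub>R w)) \<le> \<epsilon> * \<eta>"
      using stay[of z \<eta>] \<open>0 < \<epsilon>\<close> by (intro exI[of _ z]) auto
  qed (use \<rho> in auto)
qed

lemma movable_insert:
  assumes W: "movable x0 W" "finite W" "w \<notin> W" and w: "movable x0 {w}"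
  shows "movable x0 (insert w W)"
  unfolding movable_def
proof (intro allI impI)
  fix \<epsilon> :: real assume "0 < \<epsilon>"
  then have "\<epsilon> / 2 > 0" by simp
  obtain \<rho>1 c1 where 1: "0 < \<rho>1" "0 < c1" "\<And>z h \<eta>. z \<in> ball x0 \<rho>1 \<Longrightarrow> (\<forall>w\<in>W. \<bar>h w\<bar> \<le> \<eta>) \<Longrightarrow> 0 < \<eta> \<Longrightarrow> \<eta> \<le> \<rho>1 \<Longrightarrow>
     (\<exists>z'. within_cost (c1 * \<eta> powr (1 / r)) z z' \<and>
        norm (z' - z - (\<Sum>w\<in>W. h w *\<^sub>R w)) \<le> \<epsilon> / 2 * \<eta>)"
    using W(1)[unfolded movable_def, rule_format, OF \<open>\<epsilon> / 2 > 0\<close>] by auto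
  obtain \<rho>2 c2 where 2: "0 < \<rho>2" "0 < c2" "\<And>z h \<eta>. z \<in> ball x0 \<rho>2 \<Longrightarrow> \<bar>h w\<bar> \<le> \<eta> \<Longrightarrow> 0 < \<eta> \<Longrightarrow> \<eta> \<le> \<rho>2 \<Longrightarrow>
     (\<exists>z'. within_cost (c2 * \<eta> powr (1 / r)) z z' \<and>
        norm (z' - z - h w *\<^sub>R w) \<le> \<epsilon> / 2 * \<eta>)"
    using w[unfolded movable_def, rule_format, OF \<open>\<epsilon> / 2 > 0\<close>] by auto
  \<comment> \<open>The move along \<open>W\<close> displaces by at most \<open>A * \<eta>\<close>.
    The radius must be small enough that the intermediate point, at distance less than
    \<open>\<rho> * (A + 1)\<close> from \<open>x0\<close>, still admits the second move.\<close>
  define A where "A = \<epsilon> / 2 + (\<Sum>w\<in>W. norm w)"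
  have A: "0 \<le> A" using \<open>0 < \<epsilon>\<close> by (auto simp: A_def intro!: add_nonneg_nonneg sum_nonneg)
  define \<rho> where "\<rho> = min \<rho>1 (\<rho>2 / (A + 1))"
  have "\<rho> \<le> \<rho>2 / (A + 1)" by (simp add: \<rho>_def)
  then have \<rho>: "0 < \<rho>" "\<rho> \<le> \<rho>1" "\<rho> * (A + 1) \<le> \<rho>2"
    using 1(1) 2(1) A by (simp_all add: pos_le_divide_eq) (simp_all add: \<rho>_def add_nonneg_pos)
  have \<rho>2: "\<rho> \<le> \<rho>2" using \<rho> A mult_left_mono[of 1 "A + 1" \<rho>] by linarith
  show "\<exists>\<rho>>0. \<exists>c>0. \<forall>z\<in>ball x0 \<rho>. \<forall>h \<eta>. (\<forall>w\<in>insert w W. \<bar>h w\<bar> \<le> \<eta>) \<longrightarrow> 0 < \<eta> \<longrightarrow> \<eta> \<le> \<rho> \<longrightarrow>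
     (\<exists>z'. within_cost (c * \<eta> powr (1 / r)) z z' \<and>
        norm (z' - z - (\<Sum>w\<in>insert w W. h w *\<^sub>R w)) \<le> \<epsilon> * \<eta>)"
  proof (rule exI[of _ \<rho>], intro exI[of _ "c1 + c2"] conjI ballI allI impI)
    fix z and h :: "real^'p \<Rightarrow> real" and \<eta> :: real
    assume z: "z \<in> ball x0 \<rho>" and h: "\<forall>w\<in>insert w W. \<bar>h w\<bar> \<le> \<eta>" and \<eta>: "0 < \<eta>" "\<eta> \<le> \<rho>"
    obtain z1 where z1: "within_cost (c1 * \<eta> powr (1 / r)) z z1"
      "norm (z1 - z - (\<Sum>w\<in>W. h w *\<^sub>R w)) \<le> \<epsilon> / 2 * \<eta>"
      using 1(3)[of z h \<eta>] z h \<eta> \<rho> by auto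
    have "norm (\<Sum>w\<in>W. h w *\<^sub>R w) \<le> (\<Sum>w\<in>W. \<eta> * norm w)"
      using h by (intro sum_norm_le) (auto intro: mult_right_mono)
    then have "norm (z1 - z) \<le> A * \<eta>"
      using z1(2) norm_triangle_sub[of "z1 - z" "\<Sum>w\<in>W. h w *\<^sub>R w"] by (simp add: A_def algebra_simps sum_distrib_left)
    also have "\<dots> \<le> A * \<rho>" using A \<eta> by (intro mult_left_mono) auto
    finally have "dist x0 z1 < \<rho> + A * \<rho>"
      using z dist_triangle[of x0 z1 z] by (simp add: dist_norm norm_minus_commute)
    then have "z1 \<in> ball x0 \<rho>2" using \<rho>(3) by (simp add: algebra_simps)
    then obtain z2 where z2: "within_cost (c2 * \<eta> powr (1 / r)) z1 z2"
      "norm (z2 - z1 - h w *\<^sub>R w) \<le> \<epsilon> / 2 * \<eta>"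
      using 2(3)[of z1 h \<eta>] h \<eta> \<rho>2 by auto
    show "\<exists>z'. within_cost ((c1 + c2) * \<eta> powr (1 / r)) z z' \<and>
        norm (z' - z - (\<Sum>w\<in>insert w W. h w *\<^sub>R w)) \<le> \<epsilon> * \<eta>"
    proof (intro exI[of _ z2] conjI)
      have "reach \<Omega> n X M ((c1 + c2) * \<eta> powr (1 / r)) (c1 * \<eta> powr (1 / r) + c2 * \<eta> powr (1 / r)) z z2"
        by (rule reach_trans[OF reach_mono[OF z1(1) _ order_refl M_nonneg] reach_mono[OF z2(1) _ order_refl M_nonneg]])
          (use 1 2 in \<open>auto intro!: mult_right_mono\<close>)
      then show "within_cost ((c1 + c2) * \<eta> powr (1 / r)) z z2"
        by (simp add: distrib_right)
      have "z2 - z - (\<Sum>w\<in>insert w W. h w *\<^sub>R w) = (z1 - z - (\<Sum>w\<in>W. h w *\<^sub>R w)) + (z2 - z1 - h w *\<^sub>R w)"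
        using W by (simp add: algebra_simps)
      then show "norm (z2 - z - (\<Sum>w\<in>insert w W. h w *\<^sub>R w)) \<le> \<epsilon> * \<eta>"
        using norm_triangle_mono[OF z1(2) z2(2)] by (simp add: algebra_simps)
    qed
  qed (use \<rho> 1 2 in auto)
qed

text \<open>A coefficient g is realised by the chain for its sign, run with
  \<open>t ^ weight I = \<bar>g\<bar>\<close>. One half of \<epsilon> pays for the expansion error,
  the other for replacing the bracket at \<open>z\<close> by its value at \<open>x0\<close>.\<close>

lemma movable_bracket:
  assumes x0: "x0 \<in> \<Omega>" and I: "I \<noteq> []" "set I \<subseteq> {0..n}" "weight I \<le> r"
  shows "movable x0 {iter_bracket X I x0}"
  unfolding movable_def
proof (intro allI impI)
  fix \<epsilon> :: real assume "0 < \<epsilon>"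
  let ?W = "weight I"
  let ?v = "iter_bracket X I"
  have W: "?W > 0" using I by (simp add: weight_pos)
  obtain R0 where R0: "0 < R0" "ball x0 R0 \<subseteq> \<Omega>" using x0 open_dom openE by blast
  define R where "R = R0 / 2"
  let ?K = "cball x0 R"
  have R: "0 < R" "?K \<subseteq> \<Omega>" using R0 by (auto simp: R_def subset_iff)
  define steps where "steps s = (if s = (1::real) then bracket_steps I else inv_steps (bracket_steps I))" for s
  define m where "m = length (bracket_steps I)"
  have len: "length (steps s) = m" for s by (simp add: steps_def m_def inv_steps_def)
  have valid: "valid_steps n (steps s)" for s
    using valid_bracket_steps[OF I(2)] by (simp add: steps_def)
  have disp: "\<forall>\<^sub>F t in at_right 0. \<forall>z z'. chain ?K t (steps s) z z' \<longrightarrow>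
    norm (z' - z - (s * t ^ ?W) *\<^sub>R ?v z) \<le> \<epsilon> / 2 * t ^ ?W" if "s \<in> {1, -1}" for s
  proof (cases "s = 1")
    case True
    then show ?thesis
      using chain_displacement[OF compact_cball R(2) valid[of s] _ I, of "\<epsilon> / 2" "bracket_poly I" 1]
        leading_bracket_steps[OF I(1)] \<open>0 < \<epsilon>\<close> by (simp add: steps_def)
  next
    case False
    then show ?thesis
      using chain_displacement[OF compact_cball R(2) valid[of s] _ I, of "\<epsilon> / 2" "- bracket_poly I" "- 1"] that
        leading_inverse[OF leading_bracket_steps[OF I(1)] series_inv(2)] \<open>0 < \<epsilon>\<close> by (simp add: steps_def)
  qed
  have ex: "\<forall>\<^sub>F t in at_right 0. \<forall>z. dist x0 z + real m * (M * t) \<le> R \<longrightarrow> (\<exists>z'. chain ?K t (steps s) z z')" for s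
    using chain_exists[OF R(2,1) valid[of s]] by (simp add: len)
  have small: "\<forall>\<^sub>F t in at_right 0. 0 < t \<and> t < min 1 (R / (2 * (m * M + 1)))"
    using R M_nonneg by (intro eventually_at_rightI[of 0 "min 1 (R / (2 * (m * M + 1)))"]) (auto intro!: divide_pos_pos add_nonneg_pos mult_nonneg_nonneg)
  have "\<forall>\<^sub>F t in at_right 0. 0 < t \<and> t < 1 \<and> m * (M * t) \<le> R / 2 \<and> (\<forall>s\<in>{1, -1}. \<forall>z. dist x0 z \<le> R / 2 \<longrightarrow>
     (\<exists>z'. chain ?K t (steps s) z z' \<and> norm (z' - z - (s * t ^ ?W) *\<^sub>R ?v z) \<le> \<epsilon> / 2 * t ^ ?W))"
    using disp[OF insertI1] disp[OF insertI2[OF singletonI]] ex[of 1] ex[of "-1"] small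
  proof eventually_elim
    case (elim t)
    have pos: "0 < 2 * (m * M + 1)" using M_nonneg by (simp add: add_nonneg_pos)
    have t: "0 < t" "t < 1" "t * (2 * (m * M + 1)) < R" using elim(5) pos unfolding min_less_iff_conj by (simp_all add: less_divide_eq)
    then have mt: "m * (M * t) \<le> R / 2" by (simp add: algebra_simps)
    have "\<exists>z'. chain ?K t (steps s) z z' \<and> norm (z' - z - (s * t ^ ?W) *\<^sub>R ?v z) \<le> \<epsilon> / 2 * t ^ ?W"
      if s: "s \<in> {1, -1}" and "dist x0 z \<le> R / 2" for s z
    proof -
      have "dist x0 z + real m * (M * t) \<le> R" using that mt by linarith
      then obtain z' where "chain ?K t (steps s) z z'" using elim(3,4) s by blast
      then show ?thesis using elim(1,2) s by blast
    qed
    then show ?case using t mt by blast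
  qed
  \<comment> \<open>Substituting t = h^(1/W) restates the eventual property in terms of the size h
    of the displacement coefficient.\<close>
  then have "\<forall>\<^sub>F h in at_right 0. 0 < h powr (1 / ?W) \<and> h powr (1 / ?W) < 1 \<and> m * (M * h powr (1 / ?W)) \<le> R / 2 \<and> (\<forall>s\<in>{1, -1}. \<forall>z. dist x0 z \<le> R / 2 \<longrightarrow>
     (\<exists>z'. chain ?K (h powr (1 / ?W)) (steps s) z z' \<and> norm (z' - z - (s * (h powr (1 / ?W)) ^ ?W) *\<^sub>R ?v z) \<le> \<epsilon> / 2 * (h powr (1 / ?W)) ^ ?W))"
    using W by (intro filterlim_iff[THEN iffD1, rule_format, OF filterlim_powr_at_right_0[of "1 / ?W"]]) auto
  then obtain \<rho>1 where \<rho>1: "0 < \<rho>1" "\<And>h. 0 < h \<Longrightarrow> h < \<rho>1 \<Longrightarrow> 0 < h powr (1 / ?W) \<and> h powr (1 / ?W) < 1 \<and> m * (M * h powr (1 / ?W)) \<le> R / 2 \<and> (\<forall>s\<in>{1, -1}. \<forall>z. dist x0 z \<le> R / 2 \<longrightarrow>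
     (\<exists>z'. chain ?K (h powr (1 / ?W)) (steps s) z z' \<and> norm (z' - z - (s * (h powr (1 / ?W)) ^ ?W) *\<^sub>R ?v z) \<le> \<epsilon> / 2 * (h powr (1 / ?W)) ^ ?W))"
    unfolding eventually_at_right_field by blast
  have "continuous_on \<Omega> (\<lambda>z. \<chi> j. ?v z $ j)"
    by (intro continuous_on_vec_lambda Ck_on_imp_continuous[OF Ck_iter_bracket[OF I]])
  then have "continuous_on \<Omega> ?v" by simp
  then obtain \<rho>2 where \<rho>2: "0 < \<rho>2" "\<And>z. z \<in> \<Omega> \<Longrightarrow> dist z x0 < \<rho>2 \<Longrightarrow> dist (?v z) (?v x0) < \<epsilon> / 2"
    using x0 \<open>0 < \<epsilon>\<close> unfolding continuous_on_iff by (meson half_gt_zero)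
  \<comment> \<open>\<open>\<rho>1\<close> is halved because the property holds strictly below it.
    The bound 1 allows |g|^(1/W) to be replaced by the larger |g|^(1/r).\<close>
  define \<rho> where "\<rho> = min (min (\<rho>1 / 2) \<rho>2) (min (R / 2) 1)"
  have \<rho>: "0 < \<rho>" "\<rho> < \<rho>1" "\<rho> \<le> \<rho>2" "\<rho> \<le> R / 2" "\<rho> \<le> 1" using \<rho>1(1) \<rho>2(1) R(1) by (auto simp: \<rho>_def)
  \<comment> \<open>\<open>m\<close> steps of duration \<open>t\<close> have to fit into the cost,
    and so does the drift bound \<open>t\<close> itself; \<open>m + 1\<close> covers both.\<close>
  define c where "c = real m + 1"
  show "\<exists>\<rho>>0. \<exists>c>0. \<forall>z\<in>ball x0 \<rho>. \<forall>h \<eta>. (\<forall>w\<in>{?v x0}. \<bar>h w\<bar> \<le> \<eta>) \<longrightarrow> 0 < \<eta> \<longrightarrow> \<eta> \<le> \<rho> \<longrightarrow>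
     (\<exists>z'. within_cost (c * \<eta> powr (1 / r)) z z' \<and>
        norm (z' - z - (\<Sum>w\<in>{?v x0}. h w *\<^sub>R w)) \<le> \<epsilon> * \<eta>)"
  proof (rule exI[of _ \<rho>], intro exI[of _ c] conjI ballI allI impI)
    fix z and h :: "real^'p \<Rightarrow> real" and \<eta> :: real
    assume z: "z \<in> ball x0 \<rho>" and "\<forall>w\<in>{?v x0}. \<bar>h w\<bar> \<le> \<eta>" and \<eta>: "0 < \<eta>" "\<eta> \<le> \<rho>"
    define g where "g = h (?v x0)"
    have g: "\<bar>g\<bar> \<le> \<eta>" using \<open>\<forall>w\<in>{?v x0}. \<bar>h w\<bar> \<le> \<eta>\<close> by (simp add: g_def)
    have z\<Omega>: "z \<in> \<Omega>" using z \<rho> R by (auto simp: subset_iff)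
    have "\<exists>z'. within_cost (c * \<eta> powr (1 / r)) z z' \<and>
        norm (z' - z - g *\<^sub>R ?v x0) \<le> \<epsilon> * \<eta>"
    \<comment> \<open>For \<open>g = 0\<close> the time \<open>t\<close> would be 0, outside the
      range of the expansion; resting at \<open>z\<close> is an exact move.\<close>
    proof (cases "g = 0")
      case True
      have "within_cost (c * \<eta> powr (1 / r)) z z"
        using z\<Omega> by (intro reach_mono[OF reach_refl[of z \<Omega> 0 M n X] _ _ M_nonneg]) (auto simp: M_nonneg c_def)
      then show ?thesis using True \<open>0 < \<epsilon>\<close> \<eta> by (intro exI[of _ z]) auto
    next
      case False
      define t where "t = \<bar>g\<bar> powr (1 / ?W)"
      define s where "s = sgn g"
      have s: "s \<in> {1, -1}" "s * \<bar>g\<bar> = g" using False by (auto simp: s_def sgn_if)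
      have tW: "t ^ ?W = \<bar>g\<bar>" unfolding t_def using False W by (subst powr_realpow[symmetric]) (auto simp: powr_powr)
      have dz: "dist x0 z \<le> R / 2" using z \<rho> by auto
      have *: "0 < t" "t < 1" "\<exists>z'. chain ?K t (steps s) z z' \<and> norm (z' - z - (s * t ^ ?W) *\<^sub>R ?v z) \<le> \<epsilon> / 2 * t ^ ?W"
        using \<rho>1(2)[of "\<bar>g\<bar>"] False g \<eta> \<rho>(2) s(1) dz unfolding t_def by auto
      then obtain z' where z': "chain ?K t (steps s) z z'" "norm (z' - z - g *\<^sub>R ?v z) \<le> \<epsilon> / 2 * \<bar>g\<bar>"
        by (auto simp: tW s)
      have "t \<le> \<bar>g\<bar> powr (1 / r)" unfolding t_def
        using False g \<eta> \<rho> W I by (intro powr_mono') (auto simp: frac_le)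
      also have "\<dots> \<le> \<eta> powr (1 / r)" using g by (intro powr_mono2) auto
      finally have t: "t \<le> \<eta> powr (1 / r)" .
      have "m * t \<le> m * \<eta> powr (1 / r)" "1 * t \<le> 1 * \<eta> powr (1 / r)" "0 \<le> m * t" using t *(1) by (auto intro: mult_left_mono)
      then have le: "t \<le> c * \<eta> powr (1 / r)" "real m * t \<le> c * \<eta> powr (1 / r)"
        using powr_ge_zero[of \<eta> "1 / r"] mult_nonneg_nonneg[of "real m" "\<eta> powr (1 / r)"]
        unfolding c_def distrib_right by linarith+
      have "reach \<Omega> n X M t (real (length (steps s)) * t) z z'"
        using z' R(2) valid *(1,2) by (intro chain_reach[of ?K]) auto
      then have "within_cost (c * \<eta> powr (1 / r)) z z'"
        by (rule reach_mono) (use le M_nonneg in \<open>auto simp: len\<close>)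
      moreover have "norm (z' - z - g *\<^sub>R ?v x0) \<le> \<epsilon> * \<eta>"
      proof -
        have *: "norm (g *\<^sub>R (?v z - ?v x0)) \<le> \<epsilon> / 2 * \<bar>g\<bar>"
        proof -
          have "norm (?v z - ?v x0) \<le> \<epsilon> / 2"
            using \<rho>2(2)[OF z\<Omega>] z \<rho>(3) by (auto simp: dist_norm norm_minus_commute)
          from mult_left_mono[OF this abs_ge_zero[of g]] show ?thesis by (simp only: norm_scaleR mult.commute)
        qed
        have "norm ((z' - z - g *\<^sub>R ?v z) + g *\<^sub>R (?v z - ?v x0)) \<le> \<epsilon> / 2 * \<bar>g\<bar> + \<epsilon> / 2 * \<bar>g\<bar>"
          by (rule norm_triangle_mono[OF z'(2) *])
        also have "\<dots> \<le> \<epsilon> * \<eta>" using g \<open>0 < \<epsilon>\<close> by simp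
        finally show ?thesis by (simp add: algebra_simps)
      qed
      ultimately show ?thesis by blast
    qed
    then show "\<exists>z'. within_cost (c * \<eta> powr (1 / r)) z z' \<and>
        norm (z' - z - (\<Sum>w\<in>{?v x0}. h w *\<^sub>R w)) \<le> \<epsilon> * \<eta>" by (simp add: g_def)
  qed (use \<rho> in \<open>auto simp: c_def\<close>)
qed

lemma movable_finite:
  assumes "finite W" "x0 \<in> \<Omega>" "\<And>w. w \<in> W \<Longrightarrow> movable x0 {w}"
  shows "movable x0 W"
  using assms by (induction W rule: finite_induct) (auto intro: movable_empty movable_insert)

text \<open>\<open>W\<close> may be linearly dependent, so coefficients are not unique. One
  expansion of each unit vector is fixed and extended linearly, which makes the coefficients of
  \<open>v\<close> linear in \<open>v\<close> and hence bounded by a multiple of its norm.\<close>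

lemma small_coefficients:
  fixes W :: "(real^'p) set"
  assumes "finite W" "span W = UNIV"
  shows "\<exists>C\<ge>1. \<forall>v. \<exists>h. v = (\<Sum>w\<in>W. h w *\<^sub>R w) \<and> (\<forall>w\<in>W. \<bar>h w\<bar> \<le> C * norm v)"
proof -
  have "\<exists>q. v = (\<Sum>w\<in>W. q w *\<^sub>R w)" for v
  proof -
    have "v \<in> range (\<lambda>q. \<Sum>w\<in>W. q w *\<^sub>R w)" using span_finite[OF assms(1)] assms(2) by auto
    then show ?thesis by auto
  qed
  then have "\<forall>j :: 'p. \<exists>q. axis j 1 = (\<Sum>w\<in>W. q w *\<^sub>R w)" by blast
  from choice[OF this] obtain q where q: "\<And>j :: 'p. axis j 1 = (\<Sum>w\<in>W. q j w *\<^sub>R w)" by blast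
  define C where "C = 1 + (\<Sum>j\<in>UNIV. \<Sum>w\<in>W. \<bar>q j w\<bar>)"
  show ?thesis
  proof (intro exI[of _ C] conjI allI)
    show "1 \<le> C" by (auto simp: C_def intro!: sum_nonneg)
    fix v :: "real^'p"
    define h where "h w = (\<Sum>j\<in>UNIV. v $ j * q j w)" for w
    have "v = (\<Sum>j\<in>UNIV. v $ j *\<^sub>R axis j 1)" using basis_expansion[of v] by (simp add: scalar_mult_eq_scaleR)
    also have "\<dots> = (\<Sum>j\<in>UNIV. \<Sum>w\<in>W. (v $ j * q j w) *\<^sub>R w)" by (simp add: q scaleR_sum_right)
    also have "\<dots> = (\<Sum>w\<in>W. h w *\<^sub>R w)" by (subst sum.swap) (simp add: h_def scaleR_sum_left)
    finally have "v = (\<Sum>w\<in>W. h w *\<^sub>R w)" .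
    moreover have "\<bar>h w\<bar> \<le> C * norm v" if "w \<in> W" for w
    proof -
      have "\<bar>h w\<bar> \<le> (\<Sum>j\<in>UNIV. norm v * \<bar>q j w\<bar>)" unfolding h_def
        by (rule order_trans[OF sum_abs sum_mono]) (auto simp: abs_mult intro: mult_right_mono component_le_norm_cart)
      also have "\<dots> = norm v * (\<Sum>j\<in>UNIV. \<bar>q j w\<bar>)" by (simp add: sum_distrib_left)
      also have "\<dots> \<le> norm v * C"
      proof (rule mult_left_mono)
        have "(\<Sum>j\<in>UNIV. \<bar>q j w\<bar>) \<le> (\<Sum>j\<in>UNIV. \<Sum>w\<in>W. \<bar>q j w\<bar>)"
          using assms(1) that by (intro sum_mono member_le_sum) auto
        then show "(\<Sum>j\<in>UNIV. \<bar>q j w\<bar>) \<le> C" by (simp add: C_def)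
      qed simp
      finally show ?thesis by (simp add: mult.commute)
    qed
    ultimately show "\<exists>h. v = (\<Sum>w\<in>W. h w *\<^sub>R w) \<and> (\<forall>w\<in>W. \<bar>h w\<bar> \<le> C * norm v)" by blast
  qed
qed

text \<open>Halving the remaining distance at geometrically decreasing cost makes surjectivity of the approximate moves unnecessary.\<close>

lemma local_reach:
  assumes x0: "x0 \<in> \<Omega>" and "0 < r"
    and span: "span {iter_bracket X I x0 | I. I \<in> multiindices n \<and> weight I \<le> r} = UNIV"
  obtains \<delta> c where "0 < \<delta>" "0 < c" "\<And>x y. x \<in> ball x0 \<delta> \<Longrightarrow> y \<in> ball x0 \<delta> \<Longrightarrow>
     within_cost (c * norm (x - y) powr (1 / r)) x y"
proof -
  define W where "W = {iter_bracket X I x0 | I. I \<in> multiindices n \<and> weight I \<le> r}"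
  have finW: "finite W"
    unfolding W_def
    by (rule finite_subset[OF _ finite_imageI[OF finite_words[of n r], of "\<lambda>I. iter_bracket X I x0"]])
      (auto simp: multiindices_def)
  have "movable x0 W"
    by (rule movable_finite[OF finW x0]) (auto simp: W_def multiindices_def intro!: movable_bracket x0)
  obtain C where C: "1 \<le> C" "\<And>v. \<exists>h. v = (\<Sum>w\<in>W. h w *\<^sub>R w) \<and> (\<forall>w\<in>W. \<bar>h w\<bar> \<le> C * norm v)"
    using small_coefficients[OF finW span[folded W_def]] by blast
  \<comment> \<open>The moves will use \<open>\<eta> = C * norm v\<close>, so this accuracy leaves
    an error of at most half of \<open>norm v\<close>.\<close>
  have "1 / (2 * C) > 0" using C by simp
  then obtain \<rho> c where \<rho>: "0 < \<rho>" "0 < c" "\<And>z h \<eta>. z \<in> ball x0 \<rho> \<Longrightarrow> (\<forall>w\<in>W. \<bar>h w\<bar> \<le> \<eta>) \<Longrightarrow> 0 < \<eta> \<Longrightarrow> \<eta> \<le> \<rho> \<Longrightarrow>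
     (\<exists>z'. within_cost (c * \<eta> powr (1 / r)) z z' \<and>
        norm (z' - z - (\<Sum>w\<in>W. h w *\<^sub>R w)) \<le> 1 / (2 * C) * \<eta>)"
    using \<open>movable x0 W\<close>[unfolded movable_def, rule_format, OF \<open>1 / (2 * C) > 0\<close>] by auto
  obtain R0 where R0: "0 < R0" "ball x0 R0 \<subseteq> \<Omega>" using x0 open_dom openE by blast
  define c' where "c' = c * C powr (1 / r)"
  have c': "0 < c'" using \<rho> C by (simp add: c'_def)
  \<comment> \<open>The intermediate points stay within distance \<open>d < 2 * \<delta>\<close> of
    \<open>y\<close>: they lie within \<open>3 * \<delta>\<close> of \<open>x0\<close>, and
    \<open>C * norm v\<close> stays below \<open>2 * C * \<delta>\<close>. The factor
    \<open>4 * C\<close> keeps both below \<open>\<rho>\<close>.\<close>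
  define \<delta> where "\<delta> = min (\<rho> / (4 * C)) R0"
  have \<delta>: "0 < \<delta>" "4 * C * \<delta> \<le> \<rho>" "\<delta> \<le> R0" using \<rho> C R0 by (auto simp: \<delta>_def min_def field_simps)
  have \<delta>\<rho>: "4 * \<delta> \<le> \<rho>"   proof -
    have "1 * (4 * \<delta>) \<le> C * (4 * \<delta>)" using C(1) \<delta>(1) by (intro mult_right_mono) auto
    then show ?thesis using \<delta>(2) by linarith
  qed
  \<comment> \<open>Halving the distance multiplies a cost proportional to its r-th root by
    2^(-1/r).\<close>
  define q where "q = (1 / 2 :: real) powr (1 / r)"
  have q: "0 < q" "q < 1" using \<open>0 < r\<close> powr_less_mono2[of "1 / r" "1 / 2" 1] by (simp_all add: q_def)
  show ?thesis
  proof (rule that[of \<delta> "c' / (1 - q)"])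
    fix x y assume x: "x \<in> ball x0 \<delta>" and y: "y \<in> ball x0 \<delta>"
    define d where "d = norm (x - y)"
    have d: "d < 2 * \<delta>" using x y dist_triangle2[of x y x0] by (simp add: d_def dist_norm norm_minus_commute)
    have y\<Omega>: "y \<in> \<Omega>" using y R0 \<delta> by auto
    have step: "\<exists>z'. norm (z' - y) \<le> d / 2 ^ Suc k \<and> reach \<Omega> n X M (c' * d powr (1 / r)) (c' * d powr (1 / r) * q ^ k) z z'"
      if z: "norm (z - y) \<le> d / 2 ^ k" for z k
    proof (cases "z = y")
      \<comment> \<open>If the target has been reached, a move of size \<open>\<eta> = 0\<close> is
        not covered by \<open>movable\<close>; the sequence rests from then on.\<close>
      case True
      have "reach \<Omega> n X M (c' * d powr (1 / r)) (c' * d powr (1 / r) * q ^ k) y y"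
        using y\<Omega> q c' by (intro reach_mono[OF reach_refl[of y \<Omega> 0 M n X] _ _ M_nonneg]) (auto simp: M_nonneg)
      then show ?thesis using True by (intro exI[of _ y]) (auto simp: d_def)
    next
      case False
      define v where "v = y - z"
      have v: "0 < norm v" "norm v \<le> d / 2 ^ k" using False z by (auto simp: v_def norm_minus_commute)
      have "d / 2 ^ k \<le> d" using divide_left_mono[of 1 "2 ^ k" d] by (simp add: d_def)
      then have vd: "norm v \<le> d" using v by linarith
      have "dist x0 z \<le> dist x0 y + norm v" using dist_triangle[of x0 z y] by (simp add: v_def dist_norm)
      then have zb: "z \<in> ball x0 \<rho>" using y vd d \<delta>\<rho> \<delta>(1) by simp
      obtain h where h: "v = (\<Sum>w\<in>W. h w *\<^sub>R w)" "\<forall>w\<in>W. \<bar>h w\<bar> \<le> C * norm v" using C(2) by blast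
      have "C * norm v \<le> C * (2 * \<delta>)" using vd d C by (intro mult_left_mono) auto
      then have "C * norm v \<le> \<rho>" using \<delta>(2) \<rho>(1) by linarith
      then obtain z' where z': "within_cost (c * (C * norm v) powr (1 / r)) z z'"
        "norm (z' - z - v) \<le> 1 / (2 * C) * (C * norm v)"
        using \<rho>(3)[OF zb h(2)] v(1) C(1) unfolding h(1)[symmetric] by auto
      have "c * (C * norm v) powr (1 / r) = c' * norm v powr (1 / r)"
        using C(1) by (simp add: c'_def powr_mult)
      also have "\<dots> \<le> c' * (d / 2 ^ k) powr (1 / r)"
        using v c' by (intro mult_left_mono powr_mono2) auto
      also have "(d / 2 ^ k) powr (1 / r) = d powr (1 / r) * q ^ k"
      proof -
        have "d / 2 ^ k = d * (1 / 2) ^ k" by (simp add: power_divide)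
        moreover have "((1 / 2 :: real) ^ k) powr (1 / r) = q ^ k"
          unfolding q_def by (rule powr_power_swap) simp
        ultimately show ?thesis by (simp add: powr_mult d_def)
      qed
      finally have cost: "c * (C * norm v) powr (1 / r) \<le> c' * d powr (1 / r) * q ^ k" by (simp add: mult.assoc)
      moreover have "c' * d powr (1 / r) * q ^ k \<le> c' * d powr (1 / r) * 1"
        using c' q by (intro mult_left_mono power_le_one) auto
      ultimately have "reach \<Omega> n X M (c' * d powr (1 / r)) (c' * d powr (1 / r) * q ^ k) z z'"
        by (intro reach_mono[OF z'(1) _ _ M_nonneg]) auto
      moreover have "norm (z' - y) \<le> d / 2 ^ Suc k"
        using z'(2) v C(1) by (simp add: v_def)
      ultimately show ?thesis by blast
    qed
    have "\<exists>f. \<forall>k. (norm (f k - y) \<le> d / 2 ^ k \<and> (k = 0 \<longrightarrow> f k = x)) \<and>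
       reach \<Omega> n X M (c' * d powr (1 / r)) (c' * d powr (1 / r) * q ^ k) (f k) (f (Suc k))"
    proof (rule dependent_nat_choice)
      show "\<exists>z. norm (z - y) \<le> d / 2 ^ 0 \<and> (0 = (0::nat) \<longrightarrow> z = x)" by (auto simp: d_def)
    next
      fix z k assume "norm (z - y) \<le> d / 2 ^ k \<and> (k = 0 \<longrightarrow> z = x)"
      then show "\<exists>z'. (norm (z' - y) \<le> d / 2 ^ Suc k \<and> (Suc k = 0 \<longrightarrow> z' = x)) \<and>
          reach \<Omega> n X M (c' * d powr (1 / r)) (c' * d powr (1 / r) * q ^ k) z z'"
        using step[of z k] by simp
    qed
    then obtain f where f: "\<And>k. norm (f k - y) \<le> d / 2 ^ k" "f 0 = x"
       "\<And>k. reach \<Omega> n X M (c' * d powr (1 / r)) (c' * d powr (1 / r) * q ^ k) (f k) (f (Suc k))" by metis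
    have "reach \<Omega> n X M (c' * d powr (1 / r)) (suminf (\<lambda>k. c' * d powr (1 / r) * q ^ k)) (f 0) y"
    proof (rule reach_limit[where x = f])
      show "reach \<Omega> n X M (c' * d powr (1 / r)) (c' * d powr (1 / r) * q ^ k) (f k) (f (Suc k))" for k
        by (rule f(3))
      show "summable (\<lambda>k. c' * d powr (1 / r) * q ^ k)" using q by (intro summable_mult summable_geometric) auto
      have "(\<lambda>k. d / 2 ^ k) \<longlonglongrightarrow> 0" by (rule LIMSEQ_divide_realpow_zero) simp
      then have "(\<lambda>k. f k - y) \<longlonglongrightarrow> 0" by (rule Lim_null_comparison[rotated]) (use f(1) in auto)
      then show "f \<longlonglongrightarrow> y" by (simp add: LIM_zero_iff)
    qed (use y\<Omega> M_nonneg c' in auto)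
    moreover have "suminf (\<lambda>k. c' * d powr (1 / r) * q ^ k) = c' / (1 - q) * d powr (1 / r)"
      using q by (subst suminf_mult) (auto simp: suminf_geometric summable_geometric)
    ultimately have *: "reach \<Omega> n X M (c' * d powr (1 / r)) (c' / (1 - q) * d powr (1 / r)) x y"
      by (simp only: f(2))
    \<comment> \<open>The limit curve has drift bound \<open>c' * d powr (1 / r)\<close> and a
      larger total duration; the former is raised to the latter.\<close>
    have "c' \<le> c' / (1 - q)" using c' q by (simp add: field_simps)
    then have "c' * d powr (1 / r) \<le> c' / (1 - q) * d powr (1 / r)" by (rule mult_right_mono) simp
    from reach_mono[OF * this order_refl M_nonneg]
    show "within_cost (c' / (1 - q) * norm (x - y) powr (1 / r)) x y"
      by (simp only: d_def)
  qed (use \<delta> c' q in auto)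
qed

end

section \<open>Global estimate\<close>

context vector_fields begin

text \<open>Half radii in the finite cover give a number \<rho> such that two points closer than
  \<rho> lie in a common ball, where the local estimate applies. For the other pairs a uniform bound
  \<open>B\<close> suffices, as dividing it by \<rho>^(1/r) gives the right form. Connectedness
  supplies curves of some finite cost between the finitely many centres.\<close>

lemma compact_reach:
  assumes "0 < r" and K: "compact K" "connected K" "K \<subseteq> \<Omega>"
    and span: "\<And>x. x \<in> \<Omega> \<Longrightarrow> span {iter_bracket X I x | I. I \<in> multiindices n \<and> weight I \<le> r} = UNIV"
  shows "\<exists>c>0. \<forall>x\<in>K. \<forall>y\<in>K. within_cost (c * norm (x - y) powr (1 / r)) x y"
proof -
  have "\<forall>a\<in>K. \<exists>p. 0 < fst p \<and> 0 < snd p \<and> (\<forall>x y. x \<in> ball a (fst p) \<longrightarrow> y \<in> ball a (fst p) \<longrightarrow>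
     within_cost (snd p * norm (x - y) powr (1 / r)) x y)"
  proof
    fix a assume "a \<in> K"
    then have a: "a \<in> \<Omega>" using K by auto
    obtain \<delta> c where "0 < \<delta>" "0 < c" "\<And>x y. x \<in> ball a \<delta> \<Longrightarrow> y \<in> ball a \<delta> \<Longrightarrow>
     within_cost (c * norm (x - y) powr (1 / r)) x y"
      using local_reach[OF a \<open>0 < r\<close> span[OF a]] by blast
    then show "\<exists>p. 0 < fst p \<and> 0 < snd p \<and> (\<forall>x y. x \<in> ball a (fst p) \<longrightarrow> y \<in> ball a (fst p) \<longrightarrow>
     within_cost (snd p * norm (x - y) powr (1 / r)) x y)"
      by (intro exI[of _ "(\<delta>, c)"]) simp
  qed
  from bchoice[OF this] obtain P where P: "\<forall>a\<in>K. 0 < fst (P a) \<and> 0 < snd (P a) \<and> (\<forall>x y. x \<in> ball a (fst (P a)) \<longrightarrow> y \<in> ball a (fst (P a)) \<longrightarrow>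
     within_cost (snd (P a) * norm (x - y) powr (1 / r)) x y)" ..
  define \<delta> c where "\<delta> a = fst (P a)" and "c a = snd (P a)" for a
  have \<delta>: "a \<in> K \<Longrightarrow> 0 < \<delta> a" and c: "a \<in> K \<Longrightarrow> 0 < c a"
    and loc: "a \<in> K \<Longrightarrow> x \<in> ball a (\<delta> a) \<Longrightarrow> y \<in> ball a (\<delta> a) \<Longrightarrow>
      within_cost (c a * norm (x - y) powr (1 / r)) x y" for a x y
    using P by (simp_all add: \<delta>_def c_def)
  have "K \<subseteq> (\<Union>a\<in>K. ball a (\<delta> a / 2))" using \<delta> by force
  then obtain F where F: "F \<subseteq> K" "finite F" "K \<subseteq> (\<Union>a\<in>F. ball a (\<delta> a / 2))"
    using compactE_image[OF K(1), of K "\<lambda>a. ball a (\<delta> a / 2)"] by blast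
  \<comment> \<open>The inserted 1 keeps the minimum meaningful when \<open>K\<close>, and with it
    \<open>F\<close>, is empty.\<close>
  define \<rho> where "\<rho> = Min (insert 1 ((\<lambda>a. \<delta> a / 2) ` F))"
  have \<rho>: "0 < \<rho>" "\<And>a. a \<in> F \<Longrightarrow> \<rho> \<le> \<delta> a / 2"
  proof -
    show "0 < \<rho>" using F \<delta> by (auto simp: \<rho>_def)
    show "\<rho> \<le> \<delta> a / 2" if "a \<in> F" for a unfolding \<rho>_def using F(2) that by (intro Min_le) auto
  qed
  have c0: "0 \<le> c a" if "a \<in> F" for a using c[of a] F that by auto
  have "\<exists>D. within_cost D x y" if xy: "x \<in> K" "y \<in> K" for x y
  proof (rule connected_equivalence_relation_gen[OF K(2) xy TrueI TrueI, where R = "\<lambda>x y. \<exists>D. within_cost D x y"])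
    show "\<exists>D. within_cost D u w" if uv: "\<exists>D. within_cost D u v" and vw: "\<exists>D. within_cost D v w" for u v w
    proof -
      obtain D1 D2 where D: "within_cost D1 u v" "within_cost D2 v w" using uv vw by auto
      then have "0 \<le> D1" "0 \<le> D2" by (auto simp: reach_def)
      then have le: "D1 \<le> D1 + D2" "D2 \<le> D1 + D2" by auto
      have "within_cost (D1 + D2) u w"
        by (rule reach_trans[OF reach_mono[OF D(1) le(1) order_refl M_nonneg] reach_mono[OF D(2) le(2) order_refl M_nonneg]])
      then show ?thesis by blast
    qed
    show "\<exists>T. openin (top_of_set K) T \<and> a \<in> T \<and> (\<forall>x\<in>T. \<forall>y\<in>T. True \<and> True \<longrightarrow> (\<exists>D. within_cost D x y))"
      if a: "a \<in> K" for a
    proof (intro exI[of _ "K \<inter> ball a (\<delta> a)"] conjI ballI impI)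
      fix x y assume "x \<in> K \<inter> ball a (\<delta> a)" "y \<in> K \<inter> ball a (\<delta> a)"
      then show "\<exists>D. within_cost D x y" by (intro exI[of _ "c a * norm (x - y) powr (1 / r)"] loc a) auto
    qed (use a \<delta>[OF a] in \<open>auto intro!: openin_open_Int\<close>)
  qed auto
  then have "\<forall>p\<in>F \<times> F. \<exists>D. within_cost D (fst p) (snd p)" using F(1) by auto
  from bchoice[OF this] obtain D where D: "\<forall>p\<in>F \<times> F. within_cost (D p) (fst p) (snd p)" ..
  have D0: "0 \<le> D p" if "p \<in> F \<times> F" for p using D that by (auto simp: reach_def)
  define e where "e a = c a * \<delta> a powr (1 / r)" for a
  have e0: "0 \<le> e a" if "a \<in> F" for a using c0[OF that] by (simp add: e_def)
  \<comment> \<open>A route from \<open>x\<close> to \<open>y\<close> goes through the centres of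
    their balls: two local pieces and one of the fixed connections between centres.\<close>
  define B where "B = 2 * (\<Sum>a\<in>F. e a) + (\<Sum>p\<in>F \<times> F. D p)"
  have B0: "0 \<le> B" unfolding B_def by (intro add_nonneg_nonneg mult_nonneg_nonneg sum_nonneg e0 D0) auto
  have far: "within_cost B x y" if x: "x \<in> K" and y: "y \<in> K" for x y
  proof -
    obtain a b where ab: "a \<in> F" "b \<in> F" "x \<in> ball a (\<delta> a / 2)" "y \<in> ball b (\<delta> b / 2)" using F(3) x y by blast
    have pos: "0 < \<delta> a" "0 < \<delta> b" "a \<in> K" "b \<in> K" using \<delta> ab F by auto
    have 1: "within_cost (c a * norm (x - a) powr (1 / r)) x a"
      using ab pos by (intro loc) auto
    have 2: "within_cost (c b * norm (b - y) powr (1 / r)) b y"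
      using ab pos by (intro loc) auto
    have le: "c a * norm (x - a) powr (1 / r) \<le> e a" "c b * norm (b - y) powr (1 / r) \<le> e b"
      using ab pos c0 unfolding e_def by (auto simp: dist_norm norm_minus_commute intro!: mult_left_mono powr_mono2)
    have eF: "e a \<le> (\<Sum>a\<in>F. e a)" "e b \<le> (\<Sum>a\<in>F. e a)" using ab F e0 by (auto intro: member_le_sum)
    have DF: "D (a, b) \<le> (\<Sum>p\<in>F \<times> F. D p)" using ab F D0 by (intro member_le_sum) auto
    have nn: "0 \<le> e a" "0 \<le> e b" "0 \<le> D (a, b)" using e0 D0 ab by auto
    have B: "e a \<le> B" "e b \<le> B" "D (a, b) \<le> B" "e a + (D (a, b) + e b) \<le> B"
      using eF DF nn unfolding B_def by linarith+
    have 3: "within_cost (D (a, b)) a b" using bspec[OF D, of "(a, b)"] ab by simp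
    have "reach \<Omega> n X M B (e a + (D (a, b) + e b)) x y"
      using reach_trans[OF reach_mono[OF 1 order_trans[OF le(1) B(1)] le(1) M_nonneg]
        reach_trans[OF reach_mono[OF 3 B(3) order_refl M_nonneg] reach_mono[OF 2 order_trans[OF le(2) B(2)] le(2) M_nonneg]]] .
    from reach_mono[OF this order_refl B(4) M_nonneg] show ?thesis .
  qed
  define C where "C = 1 + (\<Sum>a\<in>F. c a) + B / \<rho> powr (1 / r)"
  have s0: "0 \<le> (\<Sum>a\<in>F. c a)" using c0 by (rule sum_nonneg)
  have b0: "0 \<le> B / \<rho> powr (1 / r)" using B0 by simp
  show ?thesis
  proof (intro exI[of _ C] conjI ballI)
    show "0 < C" using s0 b0 by (simp add: C_def)
    fix x y assume xy: "x \<in> K" "y \<in> K"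
    show "within_cost (C * norm (x - y) powr (1 / r)) x y"
    proof (cases "norm (x - y) < \<rho>")
      case True
      obtain a where a: "a \<in> F" "x \<in> ball a (\<delta> a / 2)" using F(3) xy by blast
      have aK: "a \<in> K" using a F by auto
      have "dist a y < \<delta> a"
        using dist_triangle[of a y x] a \<rho>(2)[OF a(1)] True by (simp add: dist_norm)
      moreover have "dist a x < \<delta> a" using a \<delta>[OF aK] by simp
      ultimately have R: "within_cost (c a * norm (x - y) powr (1 / r)) x y"
        by (intro loc aK) auto
      have "c a \<le> C"
        using member_le_sum[of a F c] a F c0 b0 unfolding C_def by auto
      then have "c a * norm (x - y) powr (1 / r) \<le> C * norm (x - y) powr (1 / r)" by (intro mult_right_mono) auto
      from reach_mono[OF R this this M_nonneg] show ?thesis .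
    next
      case False
      have "B = B / \<rho> powr (1 / r) * \<rho> powr (1 / r)" using \<rho>(1) by simp
      also have "\<dots> \<le> C * norm (x - y) powr (1 / r)"
        using False s0 b0 \<rho>(1) unfolding C_def by (intro mult_mono powr_mono2) auto
      finally have le: "B \<le> C * norm (x - y) powr (1 / r)" .
      from reach_mono[OF far[OF xy] le le M_nonneg] show ?thesis .
    qed
  qed
qed

end

text \<open>
  Cousin's lemma: away from the exceptional null set the increments over a fine division are controlled by
  the derivative, and over a small neighbourhood of that set by absolute continuity.
\<close>

lemma abs_continuous_increment:
  fixes \<phi> :: "real \<Rightarrow> 'a::real_normed_vector"
  assumes ac: "abs_continuous_on_interval 0 1 \<phi>"
    and ae: "AE t in lebesgue_on {0..1}. \<exists>v. (\<phi> has_vector_derivative v) (at t within {0..1}) \<and> norm v \<le> L"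
    and "0 \<le> L"
  shows "norm (\<phi> 1 - \<phi> 0) \<le> L"
proof (rule field_le_epsilon)
  fix e0 :: real assume "0 < e0"
  define e where "e = e0 / 2"
  have e: "0 < e" using \<open>0 < e0\<close> by (simp add: e_def)
  have "\<exists>\<eta>>0. \<forall>(N::nat) s t. (\<forall>k<N. 0 \<le> s k \<and> s k \<le> t k \<and> t k \<le> 1) \<longrightarrow>
        disjoint_family_on (\<lambda>k. {s k<..<t k}) {..<N} \<longrightarrow>
        (\<Sum>k<N. t k - s k) < \<eta> \<longrightarrow> (\<Sum>k<N. norm (\<phi> (t k) - \<phi> (s k))) < e"
    using ac e unfolding abs_continuous_on_interval_def by blast
  then obtain \<eta> where \<eta>: "0 < \<eta>" "\<And>(N::nat) s t. (\<forall>k<N. 0 \<le> s k \<and> s k \<le> t k \<and> t k \<le> 1) \<Longrightarrow>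
        disjoint_family_on (\<lambda>k. {s k<..<t k}) {..<N} \<Longrightarrow>
        (\<Sum>k<N. t k - s k) < \<eta> \<Longrightarrow> (\<Sum>k<N. norm (\<phi> (t k) - \<phi> (s k))) < e"
    by blast
  let ?good = "\<lambda>t. \<exists>v. (\<phi> has_vector_derivative v) (at t within {0..1}) \<and> norm v \<le> L"
  have "AE t in lebesgue. t \<in> {0..1} \<longrightarrow> ?good t" using ae by (subst (asm) AE_restrict_space_iff) auto
  then have "\<exists>Z\<in>null_sets lebesgue. {t \<in> space lebesgue. \<not> (t \<in> {0..1} \<longrightarrow> ?good t)} \<subseteq> Z"
    by (simp only: eventually_ae_filter)
  then obtain Z where "Z \<in> null_sets lebesgue" "{t \<in> space lebesgue. \<not> (t \<in> {0..1} \<longrightarrow> ?good t)} \<subseteq> Z" ..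
  then have Z: "Z \<in> null_sets lebesgue" "{t. \<not> (t \<in> {0..1} \<longrightarrow> ?good t)} \<subseteq> Z" by auto
  \<comment> \<open>Division intervals tagged in \<open>Z\<close> will lie in this open set, so
    their total length is below the \<eta> of absolute continuity.\<close>
  obtain U where U: "open U" "Z \<subseteq> U" "U - Z \<in> lmeasurable" "emeasure lebesgue (U - Z) < ennreal \<eta>"
    by (rule sets_lebesgue_outer_open[OF null_setsD2[OF Z(1)] \<eta>(1)])
  have "emeasure lebesgue U = emeasure lebesgue (U - Z)"
    by (rule emeasure_Diff_null_set[symmetric, OF Z(1)]) (use U(1) in \<open>auto intro: sets_completionI_sets\<close>)
  then have Um: "emeasure lebesgue U < ennreal \<eta>" using U(4) by simp
  \<comment> \<open>The gauge has two regimes: at points of \<open>Z\<close> it keeps the interval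
    inside \<open>U\<close>, at good points of the unit interval it is the radius on which the
    derivative controls increments up to the slope \<open>L + e\<close>.\<close>
  let ?Q = "\<lambda>t d. 0 < d \<and> (t \<in> Z \<longrightarrow> ball t d \<subseteq> U) \<and> (t \<in> {0..1} \<and> t \<notin> Z \<longrightarrow> (\<forall>s\<in>{0..1}. \<bar>s - t\<bar> < d \<longrightarrow> norm (\<phi> s - \<phi> t) \<le> (L + e) * \<bar>s - t\<bar>))"
  have "\<exists>d. ?Q t d" for t
  proof (cases "t \<in> Z \<or> t \<notin> {0..1}")
    case True
    moreover have "\<exists>d>0. ball t d \<subseteq> U" if "t \<in> Z" using U(1,2) that open_contains_ball by blast
    ultimately show ?thesis using zero_less_one by blast
  next
    case False
    then obtain v where v: "(\<phi> has_vector_derivative v) (at t within {0..1})" "norm v \<le> L" using Z(2) by auto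
    then obtain d where d: "0 < d" "\<And>s. s \<in> {0..1} \<Longrightarrow> norm (s - t) < d \<Longrightarrow> norm (\<phi> s - \<phi> t - (s - t) *\<^sub>R v) \<le> e * norm (s - t)"
      using e unfolding has_vector_derivative_def has_derivative_within_alt by metis
    have "norm (\<phi> s - \<phi> t) \<le> (L + e) * \<bar>s - t\<bar>" if "s \<in> {0..1}" "\<bar>s - t\<bar> < d" for s
    proof -
      have "norm (\<phi> s - \<phi> t) \<le> norm (\<phi> s - \<phi> t - (s - t) *\<^sub>R v) + norm ((s - t) *\<^sub>R v)"
        by (metis norm_triangle_sub add.commute)
      also have "\<dots> \<le> e * \<bar>s - t\<bar> + \<bar>s - t\<bar> * L"
        using d(2)[of s] that v(2) by (intro add_mono) (auto intro: mult_left_mono)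
      finally show ?thesis by (simp add: algebra_simps)
    qed
    then show ?thesis using d(1) False by blast
  qed
  then have "\<forall>t. \<exists>d. ?Q t d" by blast
  from choice[OF this] obtain g where "\<forall>t. ?Q t (g t)" ..
  then have g: "\<And>t. 0 < g t" "\<And>t. t \<in> Z \<Longrightarrow> ball t (g t) \<subseteq> U"
     "\<And>t s. t \<in> {0..1} \<Longrightarrow> t \<notin> Z \<Longrightarrow> s \<in> {0..1} \<Longrightarrow> \<bar>s - t\<bar> < g t \<Longrightarrow> norm (\<phi> s - \<phi> t) \<le> (L + e) * \<bar>s - t\<bar>"
    by blast+
  have "gauge (\<lambda>t. ball t (g t))" using g(1) by (simp add: gauge_def)
  then obtain p where p: "p tagged_division_of {0..1}" "(\<lambda>t. ball t (g t)) fine p"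
    using fine_division_exists_real by blast
  have fin: "finite p" using p(1) by auto
  have el: "\<exists>u w. k = {u..w} \<and> u \<le> x \<and> x \<le> w \<and> 0 \<le> u \<and> w \<le> 1 \<and> k \<subseteq> ball x (g x)" if "(x, k) \<in> p" for x k
  proof -
    have "x \<in> k" "k \<subseteq> {0..1}" "\<exists>a b. k = cbox a b" using tagged_division_ofD(2-4)[OF p(1) that] by auto
    then show ?thesis using p(2) that by (fastforce simp: fine_def)
  qed
  define inc where "inc q = norm (\<phi> (Sup (snd q)) - \<phi> (Inf (snd q)))" for q :: "real \<times> real set"
  \<comment> \<open>The division splits by tags: \<open>G\<close> has good tags and \<open>B\<close>
    tags in the null set \<open>Z\<close>.\<close>
  define G where "G = {q \<in> p. fst q \<notin> Z}"
  define B where "B = {q \<in> p. fst q \<in> Z}"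
  have pGB: "p = G \<union> B" "G \<inter> B = {}" "finite G" "finite B" using fin by (auto simp: G_def B_def)
  have "norm (\<phi> 1 - \<phi> 0) = norm (\<Sum>(x, k)\<in>p. \<phi> (Sup k) - \<phi> (Inf k))"
    using additive_tagged_division_1[OF _ p(1), of \<phi>] by simp
  also have "\<dots> \<le> (\<Sum>q\<in>p. inc q)" by (rule order_trans[OF norm_sum]) (simp add: inc_def case_prod_unfold)
  also have "\<dots> = (\<Sum>q\<in>G. inc q) + (\<Sum>q\<in>B. inc q)" unfolding pGB(1) using pGB by (intro sum.union_disjoint) auto
  also have "(\<Sum>q\<in>G. inc q) \<le> L + e"
  proof -
    have "inc q \<le> (L + e) * measure lborel (snd q)" if "q \<in> G" for q
    proof -
      obtain x k where q: "q = (x, k)" by force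
      have xk: "(x, k) \<in> p" "x \<notin> Z" using that by (auto simp: G_def q)
      obtain u w where uw: "k = {u..w}" "u \<le> x" "x \<le> w" "0 \<le> u" "w \<le> 1" "k \<subseteq> ball x (g x)" using el[OF xk(1)] by blast
      have "u \<in> k" "w \<in> k" using uw by auto
      then have "\<bar>u - x\<bar> < g x" "\<bar>w - x\<bar> < g x"
        using subsetD[OF uw(6)] by (auto simp: dist_real_def abs_minus_commute)
      \<comment> \<open>The derivative at the tag controls increments from the tag only. The tag
        lies between the endpoints, so the two estimates add up to the length of the
        interval.\<close>
      then have "norm (\<phi> u - \<phi> x) \<le> (L + e) * \<bar>u - x\<bar>" "norm (\<phi> w - \<phi> x) \<le> (L + e) * \<bar>w - x\<bar>"
        using g(3)[of x u] g(3)[of x w] xk(2) uw by auto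
      then have "norm (\<phi> w - \<phi> u) \<le> (L + e) * (w - x) + (L + e) * (x - u)"
        using norm_triangle_ineq4[of "\<phi> w - \<phi> x" "\<phi> u - \<phi> x"] uw by simp
      then show ?thesis using uw by (simp add: inc_def q algebra_simps)
    qed
    then have "(\<Sum>q\<in>G. inc q) \<le> (\<Sum>q\<in>G. (L + e) * measure lborel (snd q))" by (rule sum_mono)
    also have "\<dots> \<le> (\<Sum>q\<in>p. (L + e) * measure lborel (snd q))"
      using fin e \<open>0 \<le> L\<close> by (intro sum_mono2) (auto simp: G_def)
    also have "\<dots> = (L + e) * (\<Sum>(x, k)\<in>p. measure lborel k)" by (simp add: sum_distrib_left case_prod_unfold)
    also have "(\<Sum>(x, k)\<in>p. measure lborel k) = 1" using additive_content_tagged_division[of p 0 "1::real"] p(1) by simp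
    finally show ?thesis by simp
  qed
  also have "(\<Sum>q\<in>B. inc q) < e"
  proof -
    obtain h where h: "bij_betw h {..<card B} B" using pGB(4) ex_bij_betw_nat_finite by (metis atLeast0LessThan)
    define s where "s k = Inf (snd (h k))" for k
    define t where "t k = Sup (snd (h k))" for k
    have hB: "h k \<in> B" if "k < card B" for k using h that by (auto simp: bij_betw_def)
    have st: "snd (h k) = {s k..t k}" "0 \<le> s k" "s k \<le> t k" "t k \<le> 1" "{s k..t k} \<subseteq> U" if k: "k < card B" for k
    proof -
      obtain x K where hk: "h k = (x, K)" by force
      have xK: "(x, K) \<in> p" "x \<in> Z" using hB[OF k] by (auto simp: B_def hk)
      obtain u w where uw: "K = {u..w}" "u \<le> x" "x \<le> w" "0 \<le> u" "w \<le> 1" "K \<subseteq> ball x (g x)" using el[OF xK(1)] by blast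
      then have "s k = u" "t k = w" by (simp_all add: s_def t_def hk)
      then show "snd (h k) = {s k..t k}" "0 \<le> s k" "s k \<le> t k" "t k \<le> 1" "{s k..t k} \<subseteq> U"
        using uw g(2)[OF xK(2)] by (auto simp: hk)
    qed
    have dis: "disjoint_family_on (\<lambda>k. {s k<..<t k}) {..<card B}"
      unfolding disjoint_family_on_def
    proof (intro ballI impI)
      fix i j assume ij: "i \<in> {..<card B}" "j \<in> {..<card B}" "i \<noteq> j"
      then have "h i \<noteq> h j" using h by (auto simp: bij_betw_def inj_on_def)
      then have "interior (snd (h i)) \<inter> interior (snd (h j)) = {}"
        using tagged_division_ofD(5)[OF p(1), of "fst (h i)" "snd (h i)" "fst (h j)" "snd (h j)"] hB ij
        by (auto simp: B_def prod_eq_iff)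
      then show "{s i<..<t i} \<inter> {s j<..<t j} = {}" using st(1) ij by simp
    qed
    have "(\<Sum>k<card B. t k - s k) < \<eta>"
    proof -
      have "ennreal (\<Sum>k<card B. t k - s k) = (\<Sum>k<card B. emeasure lebesgue {s k<..<t k})"
        using st by (subst sum_ennreal[symmetric]) (auto intro!: sum.cong)
      also have "\<dots> = emeasure lebesgue (\<Union>k<card B. {s k<..<t k})"
        by (rule sum_emeasure) (use dis in auto)
      also have "\<dots> \<le> emeasure lebesgue U"
        using st(5) U(1) by (intro emeasure_mono) (fastforce simp: subset_iff)+
      also have "\<dots> < ennreal \<eta>" by (rule Um)
      finally have "ennreal (\<Sum>k<card B. t k - s k) < ennreal \<eta>" .
      moreover have "0 \<le> (\<Sum>k<card B. t k - s k)" using st(3) by (intro sum_nonneg) auto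
      ultimately show ?thesis by (simp only: ennreal_less_iff)
    qed
    then have "(\<Sum>k<card B. norm (\<phi> (t k) - \<phi> (s k))) < e" using st dis by (intro \<eta>(2)) auto
    moreover have "(\<Sum>q\<in>B. inc q) = (\<Sum>k<card B. norm (\<phi> (t k) - \<phi> (s k)))"
      unfolding inc_def s_def t_def by (rule sum.reindex_bij_betw[OF h, symmetric])
    ultimately show ?thesis by simp
  qed
  finally show "norm (\<phi> 1 - \<phi> 0) \<le> L + e0" by (simp add: e_def)
qed

section \<open>The lower bound for the control distance\<close>

lemma control_dist_lower:
  fixes X :: "nat \<Rightarrow> real^'p \<Rightarrow> real^'p"
  assumes "bounded \<Omega>" and M: "0 \<le> M" "\<And>i x. i \<le> n \<Longrightarrow> x \<in> \<Omega> \<Longrightarrow> norm (X i x) \<le> M"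
  shows "\<exists>c>0. \<forall>x\<in>\<Omega>. \<forall>y\<in>\<Omega>. ereal (c * norm (x - y)) \<le> control_dist \<Omega> n X x y"
proof -
  define C where "C = real (Suc n) * M + diameter \<Omega> + 1"
  have C: "0 < C" using M diameter_ge_0[OF assms(1)] by (simp add: C_def add_nonneg_pos)
  have "norm (x - y) \<le> C * \<delta>" if \<delta>: "0 < \<delta>" and \<phi>: "\<phi> \<in> admissible_curves \<Omega> n X \<delta>" "\<phi> 0 = x" "\<phi> 1 = y" for x y \<delta> \<phi>
  \<comment> \<open>For \<delta> at most 1 the drift bound \<delta>^2 is at most \<delta>, so the
    speed is at most (n + 1) M \<delta>. For larger \<delta> the diameter of the bounded domain
    already bounds the distance.\<close>
  proof (cases "\<delta> \<le> 1")
    case True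
    obtain a where ac: "abs_continuous_on_interval 0 1 \<phi>" and im: "\<phi> ` {0..1} \<subseteq> \<Omega>" and
      a: "\<forall>t\<in>{0..1}. \<bar>a 0 t\<bar> \<le> \<delta>\<^sup>2 \<and> (\<forall>i\<in>{1..n}. \<bar>a i t\<bar> \<le> \<delta>)" and
      ae: "AE t in lebesgue_on {0..1}. (\<phi> has_vector_derivative (\<Sum>i\<le>n. a i t *\<^sub>R X i (\<phi> t))) (at t within {0..1})"
      using \<phi>(1) unfolding admissible_curves_def by blast
    have bound: "norm (\<Sum>i\<le>n. a i t *\<^sub>R X i (\<phi> t)) \<le> real (Suc n) * M * \<delta>" if t: "t \<in> {0..1}" for t
    proof -
      have "norm (a i t *\<^sub>R X i (\<phi> t)) \<le> \<delta> * M" if "i \<le> n" for i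
      proof -
        have "\<delta>\<^sup>2 \<le> \<delta>" using True \<delta> by (simp add: power2_eq_square mult_left_le)
        then have "\<bar>a i t\<bar> \<le> \<delta>" using a t that by (cases "i = 0") (auto intro: order_trans)
          then show ?thesis using M(2)[OF that subsetD[OF im imageI[OF t]]] \<delta> by (auto intro!: mult_mono)
      qed
      then have "norm (\<Sum>i\<le>n. a i t *\<^sub>R X i (\<phi> t)) \<le> (\<Sum>i\<le>n. \<delta> * M)" by (intro sum_norm_le) auto
      then show ?thesis by (simp add: algebra_simps)
    qed
    have "AE t in lebesgue_on {0..1}. \<exists>v. (\<phi> has_vector_derivative v) (at t within {0..1}) \<and> norm v \<le> real (Suc n) * M * \<delta>"
      using ae AE_space by eventually_elim (use bound in auto)
    then have "norm (\<phi> 1 - \<phi> 0) \<le> real (Suc n) * M * \<delta>"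
      using M \<delta> by (intro abs_continuous_increment[OF ac]) auto
    also have "\<dots> \<le> C * \<delta>" using \<delta> diameter_ge_0[OF assms(1)] by (intro mult_right_mono) (auto simp: C_def)
    finally show ?thesis using \<phi> by (simp add: norm_minus_commute)
  next
    case False
    have "\<phi> 0 \<in> \<Omega>" "\<phi> 1 \<in> \<Omega>" using \<phi>(1) by (auto simp: admissible_curves_def)
    then have "norm (x - y) \<le> diameter \<Omega>" using diameter_bounded_bound[OF assms(1), of x y] \<phi> by (simp add: dist_norm)
    also have "\<dots> \<le> C" using M by (simp add: C_def)
    also have "\<dots> \<le> C * \<delta>" using C False by simp
    finally show ?thesis .
  qed
  then have "ereal (1 / C * norm (x - y)) \<le> control_dist \<Omega> n X x y" for x y
    unfolding control_dist_def using C by (intro Inf_greatest) (auto simp: field_simps)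
  then show ?thesis using C by (intro exI[of _ "1 / C"]) auto
qed

text \<open>The coefficients extend continuously to the closure, which is compact because the domain
  is bounded.\<close>

lemma assumptions_C_bound:
  fixes X :: "nat \<Rightarrow> real^'p \<Rightarrow> real^'p"
  assumes "bounded \<Omega>" "assumptions_C \<Omega> n r X"
  shows "\<exists>M\<ge>0. \<forall>i\<le>n. \<forall>x\<in>\<Omega>. norm (X i x) \<le> M"
proof -
  have ext: "extends_continuously \<Omega> f" if "Ck_closure k \<Omega> f" for k f using that by (cases k) auto
  have "\<exists>B\<ge>0. \<forall>x\<in>\<Omega>. \<bar>X i x $ j\<bar> \<le> B" if "i \<le> n" for i j
  proof -
    have "\<exists>k. Ck_closure k \<Omega> (\<lambda>x. X i x $ j)"
      using assms(2) that unfolding assumptions_C_def by (cases "i = 0") (blast, force)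
    then have "extends_continuously \<Omega> (\<lambda>x. X i x $ j)" using ext by blast
    then obtain g where g: "continuous_on (closure \<Omega>) g" "\<forall>x\<in>\<Omega>. g x = X i x $ j" by (auto simp: extends_continuously_def)
    have "bounded (g ` closure \<Omega>)"
      using g assms(1) by (intro compact_imp_bounded compact_continuous_image) (auto simp: compact_closure)
    then obtain B where "\<forall>x\<in>closure \<Omega>. \<bar>g x\<bar> \<le> B" by (auto simp: bounded_iff)
    then have "\<forall>x\<in>\<Omega>. \<bar>X i x $ j\<bar> \<le> \<bar>B\<bar>" using g(2) closure_subset[of \<Omega>] by fastforce
    then show ?thesis by (intro exI[of _ "\<bar>B\<bar>"]) auto
  qed
  then have "\<forall>i. \<forall>j. \<exists>B. i \<le> n \<longrightarrow> 0 \<le> B \<and> (\<forall>x\<in>\<Omega>. \<bar>X i x $ j\<bar> \<le> B)" by blast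
  then obtain B where B: "\<And>i j. i \<le> n \<Longrightarrow> 0 \<le> B i j \<and> (\<forall>x\<in>\<Omega>. \<bar>X i x $ j\<bar> \<le> B i j)" by metis
  show ?thesis
  proof (intro exI[of _ "\<Sum>i\<le>n. \<Sum>j\<in>UNIV. B i j"] conjI allI impI ballI)
    show "0 \<le> (\<Sum>i\<le>n. \<Sum>j\<in>UNIV. B i j)" using B by (intro sum_nonneg) auto
    fix i x assume i: "i \<le> n" and x: "x \<in> \<Omega>"
    have "norm (X i x) \<le> (\<Sum>j\<in>UNIV. \<bar>X i x $ j\<bar>)" by (rule norm_le_l1_cart)
    also have "\<dots> \<le> (\<Sum>j\<in>UNIV. B i j)" using B[OF i] x by (intro sum_mono) auto
    also have "\<dots> \<le> (\<Sum>i\<le>n. \<Sum>j\<in>UNIV. B i j)"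
      using i B by (intro member_le_sum[of i "{..n}" "\<lambda>i. \<Sum>j\<in>UNIV. B i j"]) (auto intro: sum_nonneg)
    finally show "norm (X i x) \<le> (\<Sum>i\<le>n. \<Sum>j\<in>UNIV. B i j)" .
  qed
qed

theorem proposition5p8:
  fixes \<Omega> :: "(real^'p) set" and X :: "nat \<Rightarrow> real^'p \<Rightarrow> real^'p" and n r :: nat
  assumes "is_domain \<Omega>" and "bounded \<Omega>"
    and "r \<ge> 2" and "assumptions_C \<Omega> n r X"
  shows "\<forall>\<Omega>'. \<Omega>' \<Subset> \<Omega> \<longrightarrow>
    (\<exists>c1>0. \<exists>c2>0. \<forall>x\<in>\<Omega>'. \<forall>y\<in>\<Omega>'.
       ereal (c1 * norm (x - y)) \<le> control_dist \<Omega> n X x y \<and>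
       control_dist \<Omega> n X x y \<le> ereal (c2 * norm (x - y) powr (1 / real r)))"
proof (intro allI impI)
  fix \<Omega>' assume \<Omega>': "\<Omega>' \<Subset> \<Omega>"
  obtain M where M: "0 \<le> M" "\<And>i x. i \<le> n \<Longrightarrow> x \<in> \<Omega> \<Longrightarrow> norm (X i x) \<le> M"
    using assumptions_C_bound[OF assms(2,4)] by blast
  have Ck: "Ck_on (r - wt i) \<Omega> (\<lambda>x. X i x $ j)" if "i \<le> n" for i j
  proof (rule Ck_closure_imp_Ck_on, cases "i = 0")
    case True
    then show "Ck_closure (r - wt i) \<Omega> (\<lambda>x. X i x $ j)"
      using assms(4) by (simp add: assumptions_C_def wt_def)
  next
    case False
    then have "i \<in> {1..n}" using that by simp
    with assms(4) have "Ck_closure (r - 1) \<Omega> (\<lambda>x. X i x $ j)" unfolding assumptions_C_def by blast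
    then show "Ck_closure (r - wt i) \<Omega> (\<lambda>x. X i x $ j)" using False by (simp add: wt_def)
  qed
  interpret vector_fields \<Omega> n r X M
  proof
    show "open \<Omega>" using assms(1) by (simp add: is_domain_def)
    show "Ck_on (Suc 0) \<Omega> (\<lambda>x. X i x $ j)" if "i \<le> n" for i j
    \<comment> \<open>Only here does the extra C^1 condition on the drift for \<open>r = 2\<close>
      enter; in all other cases \<open>r - wt i\<close> is at least 1.\<close>
    proof (cases "i = 0 \<and> r = 2")
      case True
      then show ?thesis using assms(4) by (simp add: assumptions_C_def)
    next
      case False
      then show ?thesis using assms(3) by (intro Ck_on_mono[OF Ck[OF that]]) (auto simp: wt_def)
    qed
  qed (use M Ck in auto)
  have \<Omega>'\<Omega>: "\<Omega>' \<subseteq> \<Omega>" using \<Omega>' closure_subset[of \<Omega>'] by (auto simp: compactly_inside_def)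
  have "\<exists>c>0. \<forall>x\<in>closure \<Omega>'. \<forall>y\<in>closure \<Omega>'.
      reach \<Omega> n X M (c * norm (x - y) powr (1 / r)) (c * norm (x - y) powr (1 / r)) x y"
  proof (rule compact_reach)
    show "compact (closure \<Omega>')" "closure \<Omega>' \<subseteq> \<Omega>" "connected (closure \<Omega>')"
      using \<Omega>' by (auto simp: compactly_inside_def is_domain_def intro: connected_imp_connected_closure)
    show "span {iter_bracket X I x |I. I \<in> multiindices n \<and> weight I \<le> r} = UNIV" if "x \<in> \<Omega>" for x
      using assms(4) that by (simp add: assumptions_C_def)
  qed (use assms(3) in auto)
  then obtain c2 where c2: "0 < c2" "\<And>x y. x \<in> \<Omega>' \<Longrightarrow> y \<in> \<Omega>' \<Longrightarrow>
      reach \<Omega> n X M (c2 * norm (x - y) powr (1 / r)) (c2 * norm (x - y) powr (1 / r)) x y"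
    using closure_subset[of \<Omega>'] by blast
  have upper: "control_dist \<Omega> n X x y \<le> ereal (c2 * norm (x - y) powr (1 / r))" if "x \<in> \<Omega>'" "y \<in> \<Omega>'" for x y
  \<comment> \<open>On the diagonal the right side is 0, but the infimum runs over positive values:
    the constant curve is admissible for each of them, so the infimum is at most 0.\<close>
  proof (cases "x = y")
    case True
    have "control_dist \<Omega> n X x x \<le> ereal D" if "0 < D" for D
      using \<open>x \<in> \<Omega>'\<close> \<Omega>'\<Omega> M(1) that by (intro reach_control_dist[OF reach_refl]) auto
    then have "control_dist \<Omega> n X x x \<le> 0" by (intro ereal_le_epsilon2[of _ 0] allI impI) simp
    then show ?thesis using True by (simp add: zero_ereal_def)
  next
    case False
    then show ?thesis using c2 that by (intro reach_control_dist[OF c2(2)]) auto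
  qed
  have "\<exists>c>0. \<forall>x\<in>\<Omega>. \<forall>y\<in>\<Omega>. ereal (c * norm (x - y)) \<le> control_dist \<Omega> n X x y"
    by (rule control_dist_lower[OF assms(2)]) (use M in auto)
  then obtain c1 where "0 < c1" "\<And>x y. x \<in> \<Omega> \<Longrightarrow> y \<in> \<Omega> \<Longrightarrow> ereal (c1 * norm (x - y)) \<le> control_dist \<Omega> n X x y"
    by blast
  then show "\<exists>c1>0. \<exists>c2>0. \<forall>x\<in>\<Omega>'. \<forall>y\<in>\<Omega>'.
       ereal (c1 * norm (x - y)) \<le> control_dist \<Omega> n X x y \<and>
       control_dist \<Omega> n X x y \<le> ereal (c2 * norm (x - y) powr (1 / real r))"
    using upper c2(1) \<Omega>'\<Omega> by blast
qed

end
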